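(* Let $A$ be a unital AF-algebra. Then a maximal UHF-subalgebra $MU(A)$ of $A$ exists. Moreover, for any UHF C*-subalgebra $D$ of $A$ containing the unit of $A$, there exists a unital embedding $\phi:D\to MU(A)$ with $\iota_{MU(A)}\circ\phi\approx_{a.u.}\iota_D$, where $\iota_D:D\to A$ and $\iota_{MU(A)}:MU(A)\to A$ denote the inclusion maps.
   Context: UHF-algebra: a C*-algebra isomorphic to the inductive limit of a sequence $\mathrm{M}_{k_1}\to \mathrm{M}_{k_2}\to\cdots$ of full matrix algebras with unital connecting maps and $k_i\mid k_{i+1}$ (so $\mathbb{C}$ and all $\mathrm{M}_k$ are included). A UHF C*-subalgebra $B$ of a unital C*-algebra $A$ is a maximal UHF-subalgebra of $A$ if $1_B=1_A$ and for every UHF C*-subalgebra $D$ of $A$ with $1_D=1_A$ there exists a unital embedding $D\to B$; it is denoted $MU(A)$. Here AF-algebras are inductive limits of sequences of finite-dimensional C*-algebras. Two $*$-homomorphisms $\varphi,\psi:D\to A$ between separable C*-algebras, with $A$ unital, are approximately unitarily equivalent, $\varphi\approx_{a.u.}\psi$, if there is a sequence of unitaries $u_n\in A$ with $\lim_n\|u_n^*\varphi(a)u_n-\psi(a)\|=0$ for all $a\in D$. *)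

theory Defs
  imports Complex_Main "Jordan_Normal_Form.Schur_Decomposition"
begin

section \<open>Unital C*-algebras as a type class\<close>

text \<open>
  The class axiom \<open>norm 1 = 1\<close> inherited from \<^class>\<open>real_normed_algebra_1\<close> holds in every
  nonzero unital C*-algebra, so the instances are exactly the nonzero unital C*-algebras.
\<close>

class cstar_algebra = real_normed_algebra_1 + banach +
  fixes scaleC :: "complex \<Rightarrow> 'a \<Rightarrow> 'a"
    and star :: "'a \<Rightarrow> 'a"
  assumes scaleC_of_real: "scaleC (complex_of_real r) x = scaleR r x"
    and scaleC_add_left: "scaleC (c + d) x = scaleC c x + scaleC d x"
    and scaleC_add_right: "scaleC c (x + y) = scaleC c x + scaleC c y"
    and scaleC_scaleC: "scaleC c (scaleC d x) = scaleC (c * d) x"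
    and scaleC_mult_left: "scaleC c x * y = scaleC c (x * y)"
    and scaleC_mult_right: "x * scaleC c y = scaleC c (x * y)"
    and norm_scaleC: "norm (scaleC c x) = cmod c * norm x"
    and star_star: "star (star x) = x"
    and star_add: "star (x + y) = star x + star y"
    and star_scaleC: "star (scaleC c x) = scaleC (cnj c) (star x)"
    and star_mult: "star (x * y) = star y * star x"
    and cstar_identity: "norm (star x * x) = (norm x)\<^sup>2"

instantiation complex :: cstar_algebra
begin
definition scaleC_complex :: "complex \<Rightarrow> complex \<Rightarrow> complex" where "scaleC_complex = (*)"
definition star_complex :: "complex \<Rightarrow> complex" where "star_complex = cnj"
instance
  by standard
    (auto simp: scaleC_complex_def star_complex_def scaleR_conv_of_real algebra_simps
      norm_mult power2_eq_square)
end

definition unitary_element :: "'a::cstar_algebra \<Rightarrow> bool" where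
  "unitary_element u \<longleftrightarrow> star u * u = 1 \<and> u * star u = 1"


section \<open>C*-algebras with explicit carrier\<close>

text \<open>
  The members of an inductive system and the subalgebras of a given algebra do not form types,
  so they are given as records. No unit is part of the structure.
\<close>

record 'a star_alg = "'a partial_object" +
  calg_add :: "'a \<Rightarrow> 'a \<Rightarrow> 'a"
  calg_zero :: 'a
  calg_mult :: "'a \<Rightarrow> 'a \<Rightarrow> 'a"
  calg_scale :: "complex \<Rightarrow> 'a \<Rightarrow> 'a"
  calg_star :: "'a \<Rightarrow> 'a"

record 'a cstar_alg = "'a star_alg" +
  calg_norm :: "'a \<Rightarrow> real"

definition calg_dist :: "('a, 'm) cstar_alg_scheme \<Rightarrow> 'a \<Rightarrow> 'a \<Rightarrow> real" where
  "calg_dist X x y = calg_norm X (calg_add X x (calg_scale X (- 1) y))"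

locale cstar_structure =
  fixes X :: "('a, 'm) cstar_alg_scheme"
  assumes zero_closed: "calg_zero X \<in> carrier X"
    and add_closed: "\<lbrakk>x \<in> carrier X; y \<in> carrier X\<rbrakk> \<Longrightarrow> calg_add X x y \<in> carrier X"
    and mult_closed: "\<lbrakk>x \<in> carrier X; y \<in> carrier X\<rbrakk> \<Longrightarrow> calg_mult X x y \<in> carrier X"
    and scale_closed: "x \<in> carrier X \<Longrightarrow> calg_scale X c x \<in> carrier X"
    and star_closed: "x \<in> carrier X \<Longrightarrow> calg_star X x \<in> carrier X"
    and add_assoc: "\<lbrakk>x \<in> carrier X; y \<in> carrier X; z \<in> carrier X\<rbrakk> \<Longrightarrow>
          calg_add X (calg_add X x y) z = calg_add X x (calg_add X y z)"
    and add_commute: "\<lbrakk>x \<in> carrier X; y \<in> carrier X\<rbrakk> \<Longrightarrow> calg_add X x y = calg_add X y x"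
    and add_zero: "x \<in> carrier X \<Longrightarrow> calg_add X x (calg_zero X) = x"
    and add_inverse: "x \<in> carrier X \<Longrightarrow> calg_add X x (calg_scale X (- 1) x) = calg_zero X"
    and scale_add_left: "x \<in> carrier X \<Longrightarrow>
          calg_scale X (c + d) x = calg_add X (calg_scale X c x) (calg_scale X d x)"
    and scale_add_right: "\<lbrakk>x \<in> carrier X; y \<in> carrier X\<rbrakk> \<Longrightarrow>
          calg_scale X c (calg_add X x y) = calg_add X (calg_scale X c x) (calg_scale X c y)"
    and scale_scale: "x \<in> carrier X \<Longrightarrow> calg_scale X c (calg_scale X d x) = calg_scale X (c * d) x"
    and scale_one: "x \<in> carrier X \<Longrightarrow> calg_scale X 1 x = x"
    and mult_assoc: "\<lbrakk>x \<in> carrier X; y \<in> carrier X; z \<in> carrier X\<rbrakk> \<Longrightarrow>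
          calg_mult X (calg_mult X x y) z = calg_mult X x (calg_mult X y z)"
    and distrib_left: "\<lbrakk>x \<in> carrier X; y \<in> carrier X; z \<in> carrier X\<rbrakk> \<Longrightarrow>
          calg_mult X x (calg_add X y z) = calg_add X (calg_mult X x y) (calg_mult X x z)"
    and distrib_right: "\<lbrakk>x \<in> carrier X; y \<in> carrier X; z \<in> carrier X\<rbrakk> \<Longrightarrow>
          calg_mult X (calg_add X x y) z = calg_add X (calg_mult X x z) (calg_mult X y z)"
    and mult_scale_left: "\<lbrakk>x \<in> carrier X; y \<in> carrier X\<rbrakk> \<Longrightarrow>
          calg_mult X (calg_scale X c x) y = calg_scale X c (calg_mult X x y)"
    and mult_scale_right: "\<lbrakk>x \<in> carrier X; y \<in> carrier X\<rbrakk> \<Longrightarrow>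
          calg_mult X x (calg_scale X c y) = calg_scale X c (calg_mult X x y)"
    and star_star: "x \<in> carrier X \<Longrightarrow> calg_star X (calg_star X x) = x"
    and star_add: "\<lbrakk>x \<in> carrier X; y \<in> carrier X\<rbrakk> \<Longrightarrow>
          calg_star X (calg_add X x y) = calg_add X (calg_star X x) (calg_star X y)"
    and star_scale: "x \<in> carrier X \<Longrightarrow>
          calg_star X (calg_scale X c x) = calg_scale X (cnj c) (calg_star X x)"
    and star_mult: "\<lbrakk>x \<in> carrier X; y \<in> carrier X\<rbrakk> \<Longrightarrow>
          calg_star X (calg_mult X x y) = calg_mult X (calg_star X y) (calg_star X x)"
    and norm_nonneg: "x \<in> carrier X \<Longrightarrow> 0 \<le> calg_norm X x"
    and norm_eq_zero: "x \<in> carrier X \<Longrightarrow> calg_norm X x = 0 \<longleftrightarrow> x = calg_zero X"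
    and norm_triangle: "\<lbrakk>x \<in> carrier X; y \<in> carrier X\<rbrakk> \<Longrightarrow>
          calg_norm X (calg_add X x y) \<le> calg_norm X x + calg_norm X y"
    and norm_scale: "x \<in> carrier X \<Longrightarrow> calg_norm X (calg_scale X c x) = cmod c * calg_norm X x"
    and norm_mult_le: "\<lbrakk>x \<in> carrier X; y \<in> carrier X\<rbrakk> \<Longrightarrow>
          calg_norm X (calg_mult X x y) \<le> calg_norm X x * calg_norm X y"
    and cstar_identity: "x \<in> carrier X \<Longrightarrow>
          calg_norm X (calg_mult X (calg_star X x) x) = (calg_norm X x)\<^sup>2"
    and complete: "\<lbrakk>\<And>n. s n \<in> carrier X;
          \<And>e. e > 0 \<Longrightarrow> \<exists>N. \<forall>m\<ge>N. \<forall>n\<ge>N. calg_dist X (s m) (s n) < e\<rbrakk> \<Longrightarrow>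
          \<exists>l\<in>carrier X. (\<lambda>n. calg_dist X (s n) l) \<longlonglongrightarrow> 0"

definition complex_subspace :: "('a, 'm) star_alg_scheme \<Rightarrow> 'a set \<Rightarrow> bool" where
  "complex_subspace X V \<longleftrightarrow> V \<subseteq> carrier X \<and> calg_zero X \<in> V \<and>
     (\<forall>x\<in>V. \<forall>y\<in>V. calg_add X x y \<in> V) \<and> (\<forall>c. \<forall>x\<in>V. calg_scale X c x \<in> V)"

definition finite_dim :: "('a, 'm) star_alg_scheme \<Rightarrow> bool" where
  "finite_dim X \<longleftrightarrow> (\<exists>S. finite S \<and> S \<subseteq> carrier X \<and>
     \<Inter>{V. complex_subspace X V \<and> S \<subseteq> V} = carrier X)"

definition star_hom ::
  "('a, 'm) star_alg_scheme \<Rightarrow> ('b, 'n) star_alg_scheme \<Rightarrow> ('a \<Rightarrow> 'b) \<Rightarrow> bool" where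
  "star_hom X Y f \<longleftrightarrow>
     (\<forall>x\<in>carrier X. f x \<in> carrier Y) \<and>
     (\<forall>x\<in>carrier X. \<forall>y\<in>carrier X. f (calg_add X x y) = calg_add Y (f x) (f y)) \<and>
     (\<forall>x\<in>carrier X. \<forall>y\<in>carrier X. f (calg_mult X x y) = calg_mult Y (f x) (f y)) \<and>
     (\<forall>c. \<forall>x\<in>carrier X. f (calg_scale X c x) = calg_scale Y c (f x)) \<and>
     (\<forall>x\<in>carrier X. f (calg_star X x) = calg_star Y (f x))"

definition is_unit_of :: "('a, 'm) star_alg_scheme \<Rightarrow> 'a \<Rightarrow> bool" where
  "is_unit_of X e \<longleftrightarrow> e \<in> carrier X \<and>
     (\<forall>x\<in>carrier X. calg_mult X e x = x \<and> calg_mult X x e = x)"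

definition unital_star_hom ::
  "('a, 'm) star_alg_scheme \<Rightarrow> ('b, 'n) star_alg_scheme \<Rightarrow> ('a \<Rightarrow> 'b) \<Rightarrow> bool" where
  "unital_star_hom X Y f \<longleftrightarrow> star_hom X Y f \<and> (\<exists>e. is_unit_of X e \<and> is_unit_of Y (f e))"

definition unital_embedding ::
  "('a, 'm) star_alg_scheme \<Rightarrow> ('b, 'n) star_alg_scheme \<Rightarrow> ('a \<Rightarrow> 'b) \<Rightarrow> bool" where
  "unital_embedding X Y f \<longleftrightarrow> unital_star_hom X Y f \<and> inj_on f (carrier X)"


section \<open>Inductive limits\<close>

text \<open>
  The *-algebra of sequences that are eventually coherent for the connecting maps
  \<open>f n : F n \<rightarrow> F (n + 1)\<close>. Modulo the sequences that are null for the C*-seminorm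
  \<open>a \<mapsto> lim \<parallel>a n\<parallel>\<close>, its completion is the inductive limit in the category of C*-algebras.
\<close>

definition coherent_sequences ::
  "(nat \<Rightarrow> ('b, 'm) star_alg_scheme) \<Rightarrow> (nat \<Rightarrow> 'b \<Rightarrow> 'b) \<Rightarrow> (nat \<Rightarrow> 'b) star_alg" where
  "coherent_sequences F f =
     \<lparr>carrier = {a. (\<forall>n. a n \<in> carrier (F n)) \<and> (\<exists>N. \<forall>n\<ge>N. a (Suc n) = f n (a n))},
      calg_add = (\<lambda>a b n. calg_add (F n) (a n) (b n)),
      calg_zero = (\<lambda>n. calg_zero (F n)),
      calg_mult = (\<lambda>a b n. calg_mult (F n) (a n) (b n)),
      calg_scale = (\<lambda>c a n. calg_scale (F n) c (a n)),
      calg_star = (\<lambda>a n. calg_star (F n) (a n))\<rparr>"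

text \<open>
  \<open>X\<close> is (isomorphic to) the inductive limit: there is a *-homomorphism with dense range from the
  coherent sequences to \<open>X\<close> that carries the seminorm above to the norm of \<open>X\<close>. The usual maps
  \<open>F n \<rightarrow> X\<close> send \<open>x\<close> to the image of the sequence \<open>0, \<dots>, 0, x, f n x, f (n + 1) (f n x), \<dots>\<close>.
\<close>

definition is_inductive_limit ::
  "(nat \<Rightarrow> ('b, 'm) cstar_alg_scheme) \<Rightarrow> (nat \<Rightarrow> 'b \<Rightarrow> 'b) \<Rightarrow> ('a, 'n) cstar_alg_scheme \<Rightarrow> bool"
  where
  "is_inductive_limit F f X \<longleftrightarrow> (\<exists>j. star_hom (coherent_sequences F f) X j \<and>
     (\<forall>a\<in>carrier (coherent_sequences F f). (\<lambda>n. calg_norm (F n) (a n)) \<longlonglongrightarrow> calg_norm X (j a)) \<and>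
     (\<forall>x\<in>carrier X. \<forall>e>0. \<exists>a\<in>carrier (coherent_sequences F f). calg_dist X (j a) x < e))"

text \<open>
  The finite-dimensional algebras live on an arbitrary type \<open>'b\<close>; a hypothesis
  \<open>AF_algebra TYPE('b) X\<close> with \<open>'b\<close> a free type variable covers all sequences of
  finite-dimensional C*-algebras. The connecting maps need be neither unital nor injective.
\<close>

definition AF_algebra :: "'b itself \<Rightarrow> ('a, 'n) cstar_alg_scheme \<Rightarrow> bool" where
  "AF_algebra _ X \<longleftrightarrow> cstar_structure X \<and>
     (\<exists>(F :: nat \<Rightarrow> 'b cstar_alg) f.
       (\<forall>n. cstar_structure (F n) \<and> finite_dim (F n)) \<and>
       (\<forall>n. star_hom (F n) (F (Suc n)) (f n)) \<and>
       is_inductive_limit F f X)"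


section \<open>Full matrix algebras and UHF-algebras\<close>

definition l2_norm_vec :: "complex vec \<Rightarrow> real" where
  "l2_norm_vec v = sqrt (\<Sum>i<dim_vec v. (cmod (v $ i))\<^sup>2)"

definition op_norm_mat :: "complex mat \<Rightarrow> real" where
  "op_norm_mat A = Sup {l2_norm_vec (A *\<^sub>v v) | v. v \<in> carrier_vec (dim_col A) \<and> l2_norm_vec v \<le> 1}"

definition matrix_cstar :: "nat \<Rightarrow> complex mat cstar_alg" where
  "matrix_cstar k =
     \<lparr>carrier = carrier_mat k k, calg_add = (+), calg_zero = 0\<^sub>m k k, calg_mult = (*),
      calg_scale = (\<cdot>\<^sub>m), calg_star = mat_adjoint, calg_norm = op_norm_mat\<rparr>"

definition UHF_algebra :: "('a, 'n) cstar_alg_scheme \<Rightarrow> bool" where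
  "UHF_algebra X \<longleftrightarrow> cstar_structure X \<and>
     (\<exists>k f. (\<forall>i. k i > 0 \<and> k i dvd k (Suc i)) \<and>
       (\<forall>i. unital_star_hom (matrix_cstar (k i)) (matrix_cstar (k (Suc i))) (f i)) \<and>
       is_inductive_limit (\<lambda>i. matrix_cstar (k i)) f X)"


section \<open>Subalgebras of a unital C*-algebra\<close>

definition cstar_subalgebra :: "'a::cstar_algebra set \<Rightarrow> bool" where
  "cstar_subalgebra B \<longleftrightarrow> 0 \<in> B \<and> (\<forall>x\<in>B. \<forall>y\<in>B. x + y \<in> B) \<and> (\<forall>x\<in>B. \<forall>y\<in>B. x * y \<in> B) \<and>
     (\<forall>c. \<forall>x\<in>B. scaleC c x \<in> B) \<and> (\<forall>x\<in>B. star x \<in> B) \<and> closed B"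

definition cstar_of :: "'a::cstar_algebra set \<Rightarrow> 'a cstar_alg" where
  "cstar_of B = \<lparr>carrier = B, calg_add = (+), calg_zero = 0, calg_mult = (*),
     calg_scale = scaleC, calg_star = star, calg_norm = norm\<rparr>"

lemma scaleC_minus_one: "scaleC (- 1) x = - (x::'a::cstar_algebra)"
  using scaleC_of_real[of "- 1" x] by simp

lemma scaleC_one: "scaleC 1 x = (x::'a::cstar_algebra)"
  using scaleC_of_real[of 1 x] by simp

lemma cstar_structure_cstar_of:
  assumes "cstar_subalgebra (B :: 'a::cstar_algebra set)"
  shows "cstar_structure (cstar_of B)"
proof (unfold_locales, goal_cases)
  case (29 s)
  have d: "calg_dist (cstar_of B) x y = dist x y" for x y
    by (simp add: calg_dist_def cstar_of_def scaleC_minus_one dist_norm)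
  have "Cauchy s" using 29(2) unfolding d by (auto simp: Cauchy_def)
  then obtain l where l: "s \<longlonglongrightarrow> l" using Cauchy_convergent convergent_def by blast
  moreover have "closed B" "\<And>n. s n \<in> B"
    using assms 29(1) by (auto simp: cstar_subalgebra_def cstar_of_def)
  ultimately have "l \<in> B" by (metis closed_sequentially)
  moreover have "(\<lambda>n. dist (s n) l) \<longlonglongrightarrow> 0" using l tendsto_dist_iff by blast
  ultimately show ?case unfolding d by (auto simp: cstar_of_def)
qed (use assms in \<open>simp_all add: cstar_of_def cstar_subalgebra_def scaleC_minus_one scaleC_one
   add.assoc add.commute mult.assoc distrib_left distrib_right scaleC_add_left scaleC_add_right
   scaleC_scaleC scaleC_mult_left scaleC_mult_right norm_scaleC cstar_algebra_class.star_star
   cstar_algebra_class.star_add star_scaleC cstar_algebra_class.star_mult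
   cstar_algebra_class.cstar_identity norm_triangle_ineq norm_mult_ineq\<close>)

text \<open>A subalgebra with \<open>1 \<in> D\<close> is one whose unit is the unit of the ambient algebra.\<close>

definition unital_UHF_subalgebra :: "'a::cstar_algebra set \<Rightarrow> bool" where
  "unital_UHF_subalgebra D \<longleftrightarrow> cstar_subalgebra D \<and> UHF_algebra (cstar_of D) \<and> 1 \<in> D"

definition maximal_UHF_subalgebra :: "'a::cstar_algebra set \<Rightarrow> bool" where
  "maximal_UHF_subalgebra B \<longleftrightarrow> unital_UHF_subalgebra B \<and>
     (\<forall>D :: 'a set. unital_UHF_subalgebra D \<longrightarrow> (\<exists>f. unital_embedding (cstar_of D) (cstar_of B) f))"

definition approx_unitarily_equiv ::
  "('d, 'm) star_alg_scheme \<Rightarrow> ('d \<Rightarrow> 'a::cstar_algebra) \<Rightarrow> ('d \<Rightarrow> 'a) \<Rightarrow> bool" where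
  "approx_unitarily_equiv D f g \<longleftrightarrow> (\<exists>u :: nat \<Rightarrow> 'a. (\<forall>n. unitary_element (u n)) \<and>
     (\<forall>a\<in>carrier D. (\<lambda>n. norm (star (u n) * f a * u n - g a)) \<longlonglongrightarrow> 0))"

end

theory Submission
  imports Defs "HOL-Computational_Algebra.Fundamental_Theorem_Algebra"
    "HOL-Analysis.L2_Norm" "HOL-Analysis.Elementary_Metric_Spaces"
begin

text \<open>
  Full matrix algebras are described by systems of matrix units. In a finite-dimensional C*-algebra
  \<open>B\<close> the unit is a sum of minimal projections, and the number of summands equivalent to a given
  minimal projection \<open>p\<close> is the dimension of \<open>p B\<close> (\<open>multiplicity_eq_dim\<close>). Unital \<open>k \<times> k\<close> matrix units
  exist in \<open>B\<close> exactly if \<open>k\<close> divides all these multiplicities. Two consequences replace K-theory: unital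
  matrix units of the same size are unitarily equivalent in \<open>B\<close> (\<open>matrix_units_conjugate\<close>), and if sizes
  \<open>m\<close> and \<open>n\<close> occur, then so does \<open>lcm m n\<close> (\<open>matrix_units_lcm\<close>).

  An AF-algebra has an increasing sequence of unital finite-dimensional subalgebras with dense union,
  and every unital system of matrix units lies close to a system in one of them
  (\<open>matrix_units_perturb\<close>). Hence the set of sizes of unitally embedded matrix algebras is closed under
  least common multiples. A chain of such sizes for divisibility that is cofinal in this set can be
  realised by matrix algebras inside each other, since embeddings can be made compatible by unitary
  conjugation in the finite-dimensional subalgebras (\<open>coherent_homs\<close>). The closure of the union of
  these matrix algebras is the maximal UHF-subalgebra. Any other UHF-subalgebra \<open>D\<close> is a limit of matrix
  algebras whose sizes divide members of the chain; again by \<open>coherent_homs\<close> these map compatibly into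
  the chain, and the resulting map extends to \<open>D\<close> because unital homomorphisms from matrix algebras are
  isometric (\<open>unital_mat_hom_isometric\<close>, \<open>uhf_system_extend\<close>).

  Given any maximal UHF-subalgebra and any embedding of \<open>D\<close> into it, the embedding and the inclusion of
  \<open>D\<close> restrict to two homomorphisms on each matrix algebra of \<open>D\<close>. Perturbed into a common
  finite-dimensional subalgebra they become unitarily equivalent (\<open>homs_near_conjugate\<close>), which yields
  the approximate unitary equivalence (\<open>maximal_UHF_approx_unitarily_equiv\<close>).
\<close>

section \<open>Elementary C*-algebra\<close>

global_interpretation complex_vector: vector_space "scaleC :: complex \<Rightarrow> 'a \<Rightarrow> 'a::cstar_algebra"
  by standard (simp_all add: scaleC_add_left scaleC_add_right scaleC_scaleC scaleC_one)

lemma star_zero [simp]: "star 0 = (0::'a::cstar_algebra)"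
  by (metis add_cancel_right_left star_add)

lemma star_minus: "star (- x) = - star (x::'a::cstar_algebra)"
  by (metis add.right_inverse add_eq_0_iff star_add star_zero)

lemma star_diff: "star (x - y) = star x - star (y::'a::cstar_algebra)"
  by (metis star_add star_minus uminus_add_conv_diff add.commute)

lemma star_one [simp]: "star 1 = (1::'a::cstar_algebra)"
  by (metis mult.left_neutral mult.right_neutral star_mult star_star)

lemma star_sum: "star (sum f I) = (\<Sum>i\<in>I. star (f i :: 'a::cstar_algebra))"
  by (induction I rule: infinite_finite_induct) (simp_all add: star_add)

lemma norm_star [simp]: "norm (star x) = norm (x::'a::cstar_algebra)"
proof -
  have le: "norm y \<le> norm (star y)" for y :: 'a
  proof (cases "norm y = 0")
    case False
    have "norm y * norm y \<le> norm (star y) * norm y"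
      using cstar_identity[of y] norm_mult_ineq[of "star y" y] by (simp add: power2_eq_square)
    then show ?thesis using False by simp
  qed simp
  show ?thesis using le[of x] le[of "star x"] by (simp add: star_star)
qed

lemma star_mult_self_eq_zero [simp]: "star x * x = 0 \<longleftrightarrow> x = (0::'a::cstar_algebra)"
  using cstar_identity[of x] by auto

lemma self_star_mult_eq_zero [simp]: "x * star x = 0 \<longleftrightarrow> x = (0::'a::cstar_algebra)"
  by (metis star_mult_self_eq_zero star_star star_zero)

lemma scaleC_eq_0_iff [simp]: "scaleC c x = 0 \<longleftrightarrow> c = 0 \<or> x = (0::'a::cstar_algebra)"
  by (fact complex_vector.scale_eq_0_iff)

lemma tendsto_star: "(f \<longlongrightarrow> l) F \<Longrightarrow> ((\<lambda>x. star (f x :: 'a::cstar_algebra)) \<longlongrightarrow> star l) F"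
proof (subst tendsto_dist_iff)
  assume "(f \<longlongrightarrow> l) F"
  then have "((\<lambda>x. dist (f x) l) \<longlongrightarrow> 0) F" by (subst (asm) tendsto_dist_iff)
  moreover have "dist (star x) (star y) = dist x y" for x y :: 'a
    by (simp add: dist_norm star_diff[symmetric])
  ultimately show "((\<lambda>x. dist (star (f x)) (star l)) \<longlongrightarrow> 0) F" by simp
qed

lemma tendsto_scaleC: "(f \<longlongrightarrow> l) F \<Longrightarrow> ((\<lambda>x. scaleC c (f x :: 'a::cstar_algebra)) \<longlongrightarrow> scaleC c l) F"
proof (subst tendsto_dist_iff)
  assume "(f \<longlongrightarrow> l) F"
  then have "((\<lambda>x. cmod c * dist (f x) l) \<longlongrightarrow> cmod c * 0) F"
    by (intro tendsto_intros) (simp add: tendsto_dist_iff[symmetric])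
  moreover have "dist (scaleC c x) (scaleC c y) = cmod c * dist x y" for x y :: 'a
    by (simp add: dist_norm norm_scaleC complex_vector.scale_right_diff_distrib[symmetric])
  ultimately show "((\<lambda>x. dist (scaleC c (f x)) (scaleC c l)) \<longlongrightarrow> 0) F" by simp
qed

text \<open>Projections are the self-adjoint idempotents; \<open>0\<close> is included.\<close>

definition projection :: "'a::cstar_algebra \<Rightarrow> bool" where
  "projection p \<longleftrightarrow> star p = p \<and> p * p = p"

lemma projection_0 [simp]: "projection 0" and projection_1 [simp]: "projection 1"
  by (simp_all add: projection_def)

lemma projection_mult_swap:
  assumes "projection p" "projection q" "p * q = r" "star r = r"
  shows "q * p = r"
  by (metis assms projection_def star_mult)

lemma projection_diff:
  assumes "projection p" "projection q" "q * p = p"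
  shows "projection (q - p)"
  using assms projection_mult_swap[of q p p] by (simp add: projection_def star_diff algebra_simps)

lemma projection_norm:
  assumes "projection p" "p \<noteq> 0"
  shows "norm p = 1"
proof -
  have "norm p = (norm p)\<^sup>2" using cstar_identity[of p] assms by (simp add: projection_def)
  with assms(2) show ?thesis by (simp add: power2_eq_square)
qed

lemma projection_norm_le: "projection p \<Longrightarrow> norm p \<le> 1"
  using projection_norm by fastforce

lemma projection_sum:
  assumes "\<And>i. i \<in> I \<Longrightarrow> projection (p i)"
    and "\<And>i j. i \<in> I \<Longrightarrow> j \<in> I \<Longrightarrow> i \<noteq> j \<Longrightarrow> p i * p j = 0"
  shows "projection (sum p I)"
proof (cases "finite I")
  case True
  have "sum p I * sum p I = (\<Sum>i\<in>I. \<Sum>j\<in>I. p i * p j)" by (simp add: sum_product)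
  also have "\<dots> = (\<Sum>i\<in>I. \<Sum>j\<in>I. if j = i then p i else 0)"
    using assms by (intro sum.cong refl) (auto simp: projection_def)
  also have "\<dots> = sum p I" using True by simp
  finally show ?thesis using assms by (simp add: projection_def star_sum)
qed simp

lemma orthogonal_sum_mult_left:
  assumes "finite I" "i \<in> I" "projection (p i)"
    and "\<And>j. j \<in> I \<Longrightarrow> i \<noteq> j \<Longrightarrow> p i * p j = (0::'a::cstar_algebra)"
  shows "p i * sum p I = p i"
proof -
  have "p i * sum p I = (\<Sum>j\<in>I. if j = i then p i else 0)"
    unfolding sum_distrib_left using assms by (intro sum.cong refl) (auto simp: projection_def)
  then show ?thesis using assms by simp
qed

lemma orthogonal_sum_mult_right:
  assumes "finite I" "i \<in> I" "projection (p i)"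
    and "\<And>j. j \<in> I \<Longrightarrow> j \<noteq> i \<Longrightarrow> p j * p i = (0::'a::cstar_algebra)"
  shows "sum p I * p i = p i"
proof -
  have "sum p I * p i = (\<Sum>j\<in>I. if j = i then p i else 0)"
    unfolding sum_distrib_right using assms by (intro sum.cong refl) (auto simp: projection_def)
  then show ?thesis using assms by simp
qed

lemma self_adjoint_scaleC_real:
  assumes "star x = x" "star (scaleC c x) = scaleC c x" "x \<noteq> (0::'a::cstar_algebra)"
  shows "c \<in> \<real>"
proof -
  have "scaleC (cnj c - c) x = 0"
    using assms by (simp add: star_scaleC complex_vector.scale_left_diff_distrib)
  then show ?thesis using assms(3) by (simp add: Reals_cnj_iff)
qed

section \<open>Projections in finite-dimensional subalgebras\<close>

text \<open>
  A finite-dimensional *-subalgebra that contains the unit of the ambient algebra. Finite dimension is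
  expressed by a finite spanning set over the complex numbers, which need not lie in the subalgebra;
  closedness is not required.
\<close>

locale fd_subalgebra =
  fixes B :: "'a::cstar_algebra set"
  assumes one_closed: "1 \<in> B"
    and add_closed: "x \<in> B \<Longrightarrow> y \<in> B \<Longrightarrow> x + y \<in> B"
    and mult_closed: "x \<in> B \<Longrightarrow> y \<in> B \<Longrightarrow> x * y \<in> B"
    and scale_closed: "x \<in> B \<Longrightarrow> scaleC c x \<in> B"
    and star_closed: "x \<in> B \<Longrightarrow> star x \<in> B"
    and finite_dimensional: "\<exists>S. finite S \<and> B \<subseteq> complex_vector.span S"
begin

lemma zero_closed: "0 \<in> B"
  using scale_closed[OF one_closed, of 0] by simp

lemma minus_closed: "x \<in> B \<Longrightarrow> - x \<in> B"
  using scale_closed[of x "-1"] by (simp add: scaleC_minus_one)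

lemma diff_closed: "x \<in> B \<Longrightarrow> y \<in> B \<Longrightarrow> x - y \<in> B"
  using add_closed[of x "- y"] by (simp add: minus_closed)

lemma sum_closed: "(\<And>i. i \<in> I \<Longrightarrow> f i \<in> B) \<Longrightarrow> sum f I \<in> B"
  by (induction I rule: infinite_finite_induct) (auto intro: zero_closed add_closed)

lemma power_closed: "x \<in> B \<Longrightarrow> x ^ n \<in> B"
  by (induction n) (auto intro: one_closed mult_closed)

lemmas closed = one_closed zero_closed add_closed mult_closed scale_closed star_closed
  minus_closed diff_closed

end

text \<open>The value of a complex polynomial at an element of the algebra.\<close>

definition poly_at :: "complex poly \<Rightarrow> 'a::cstar_algebra \<Rightarrow> 'a" where
  "poly_at p h = (\<Sum>i\<le>degree p. scaleC (coeff p i) (h ^ i))"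

lemma poly_at_bound:
  assumes "degree p \<le> n"
  shows "poly_at p h = (\<Sum>i\<le>n. scaleC (coeff p i) (h ^ i))"
  unfolding poly_at_def using assms
  by (intro sum.mono_neutral_left) (auto simp: coeff_eq_0)

lemma poly_at_linear_mult:
  "poly_at ([:- l, 1:] * q) h = poly_at q h * (h - scaleC l 1)"
proof -
  let ?n = "degree q"
  have deg: "degree ([:- l, 1:] * q) \<le> Suc ?n"
    using degree_mult_le[of "[:- l, 1:]" q] by simp
  have c: "coeff ([:- l, 1:] * q) i = (case i of 0 \<Rightarrow> 0 | Suc j \<Rightarrow> coeff q j) - l * coeff q i" for i
    by (cases i) (simp_all add: coeff_pCons)
  have "poly_at ([:- l, 1:] * q) h =
      (\<Sum>i\<le>Suc ?n. scaleC (case i of 0 \<Rightarrow> 0 | Suc j \<Rightarrow> coeff q j) (h ^ i)) -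
      (\<Sum>i\<le>Suc ?n. scaleC (l * coeff q i) (h ^ i))"
    unfolding poly_at_bound[OF deg] c
    by (simp only: complex_vector.scale_left_diff_distrib sum_subtractf)
  also have "(\<Sum>i\<le>Suc ?n. scaleC (case i of 0 \<Rightarrow> 0 | Suc j \<Rightarrow> coeff q j) (h ^ i)) = poly_at q h * h"
    unfolding sum.atMost_Suc_shift poly_at_def
    by (simp add: sum_distrib_right scaleC_mult_left power_commutes)
  also have "(\<Sum>i\<le>Suc ?n. scaleC (l * coeff q i) (h ^ i)) = scaleC l (poly_at q h)"
    by (simp add: poly_at_def coeff_eq_0 complex_vector.scale_sum_right)
  finally show ?thesis by (simp add: algebra_simps scaleC_mult_right)
qed

lemma complex_dependent_sequence:
  assumes "finite S" "\<And>i. f i \<in> complex_vector.span S"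
  shows "\<exists>c n. (\<exists>i\<le>n. c i \<noteq> 0) \<and> (\<Sum>i\<le>n::nat. scaleC (c i) (f i :: 'a::cstar_algebra)) = 0"
proof (cases "inj_on f {..card S}")
  case True
  have "complex_vector.dependent (f ` {..card S})"
  proof (rule ccontr)
    assume "complex_vector.independent (f ` {..card S})"
    then have "card (f ` {..card S}) \<le> card S"
      using complex_vector.independent_span_bound[of S "f ` {..card S}"] assms by auto
    then show False using True by (simp add: card_image)
  qed
  then obtain u v where u: "v \<in> f ` {..card S}" "u v \<noteq> 0" "(\<Sum>v\<in>f ` {..card S}. scaleC (u v) v) = 0"
    by (subst (asm) complex_vector.dependent_finite) auto
  then show ?thesis
    using True by (intro exI[of _ "u \<circ> f"] exI[of _ "card S"]) (auto simp: sum.reindex)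
next
  case False
  then obtain i j where ij: "i \<noteq> j" "f i = f j" "i \<le> card S" "j \<le> card S" by (auto simp: inj_on_def)
  let ?c = "\<lambda>k. (if k = i then 1 else 0) - (if k = j then 1 else 0) :: complex"
  have "(\<Sum>k\<le>card S. scaleC (?c k) (f k)) =
      (\<Sum>k\<le>card S. if k = i then f k else 0) - (\<Sum>k\<le>card S. if k = j then f k else 0)"
    unfolding sum_subtractf[symmetric]
    by (intro sum.cong) (auto simp: scaleC_one scaleC_minus_one)
  then show ?thesis using ij by (intro exI[of _ ?c] exI[of _ "card S"]) auto
qed

context fd_subalgebra
begin

lemma annihilating_poly:
  assumes "h \<in> B"
  shows "\<exists>p. p \<noteq> 0 \<and> poly_at p h = 0"
proof -
  obtain S where S: "finite S" "B \<subseteq> complex_vector.span S" using finite_dimensional by auto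
  have "h ^ i \<in> complex_vector.span S" for i using power_closed[OF assms] S(2) by auto
  from complex_dependent_sequence[OF S(1), of "\<lambda>i. h ^ i", OF this]
  obtain c n where c: "\<exists>i\<le>n. c i \<noteq> 0" "(\<Sum>i\<le>n::nat. scaleC (c i) (h ^ i)) = 0"
    by (elim exE) (erule conjE, rule that)
  define p where "p = (\<Sum>i\<le>n. monom (c i) i)"
  have co: "coeff p i = (if i \<le> n then c i else 0)" for i
    by (auto simp: p_def coeff_sum)
  have "degree p \<le> n" by (rule degree_le) (auto simp: co)
  then have "poly_at p h = 0" using c by (simp add: poly_at_bound co)
  moreover have "p \<noteq> 0" using c(1) co by (metis coeff_0)
  ultimately show ?thesis by blast
qed

text \<open>
  A projection that dominates no other nonzero projection of the algebra is minimal in the sense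
  that its corner is one-dimensional. A self-adjoint element of the corner has an eigenvector in
  the corner that is a polynomial in the element, and this yields an eigenprojection.
\<close>

lemma corner_self_adjoint_scalar:
  assumes q: "q \<in> B" "projection q" and h: "h \<in> B" "star h = h" "q * h = h"
    and only: "\<And>p. p \<in> B \<Longrightarrow> projection p \<Longrightarrow> q * p = p \<Longrightarrow> p \<noteq> 0 \<Longrightarrow> p = q"
  shows "\<exists>c. h = scaleC c q"
proof (cases "q = 0")
  case True
  then show ?thesis using h by auto
next
  case False
  \<comment> \<open>
    \<open>K\<close> collects elements of the corner that act, together with their adjoints, as scalars on each
    eigenvector of \<open>h\<close> in the corner; it contains \<open>q\<close> and is stable under multiplication by \<open>h - l\<close>.\<close>
  define K where "K y \<longleftrightarrow> y \<in> B \<and> q * y = y \<and>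
    (\<forall>l x. q * x = x \<longrightarrow> h * x = scaleC l x \<longrightarrow> (\<exists>c. y * x = scaleC c x) \<and> (\<exists>c. star y * x = scaleC c x))" for y
  have hq: "h * q = h" by (metis h(2,3) q(2) projection_def star_mult)
  have Kq: "K q" using q by (auto simp: K_def projection_def intro: exI[of _ 1])
  have Kstep: "K ((h - scaleC l 1) * y)" if "K y" for l y
  proof -
    have "q * ((h - scaleC l 1) * y) = (h - scaleC l 1) * y"
      using that h(3) by (simp add: K_def algebra_simps scaleC_mult_left mult.assoc[symmetric] scaleC_mult_right)
    moreover have "\<exists>c. (h - scaleC l 1) * y * x = scaleC c x"
      "\<exists>c. star ((h - scaleC l 1) * y) * x = scaleC c x"
      if x: "q * x = x" "h * x = scaleC m x" for m x
    proof -
      obtain c d where c: "y * x = scaleC c x" "star y * x = scaleC d x"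
        using \<open>K y\<close> x unfolding K_def by blast
      have "(h - scaleC l 1) * y * x = scaleC c ((h - scaleC l 1) * x)"
        by (simp only: mult.assoc c scaleC_mult_right)
      also have "(h - scaleC l 1) * x = scaleC (m - l) x"
        by (simp add: left_diff_distrib scaleC_mult_left x complex_vector.scale_left_diff_distrib)
      finally have "(h - scaleC l 1) * y * x = scaleC (c * (m - l)) x"
        by (simp add: scaleC_scaleC)
      moreover have "star ((h - scaleC l 1) * y) * x = scaleC ((m - cnj l) * d) x"
        by (simp add: star_mult star_diff star_scaleC h mult.assoc left_diff_distrib scaleC_mult_left x
            complex_vector.scale_left_diff_distrib[symmetric] scaleC_mult_right c scaleC_scaleC)
      ultimately show "\<exists>c. (h - scaleC l 1) * y * x = scaleC c x"
        "\<exists>c. star ((h - scaleC l 1) * y) * x = scaleC c x" by blast+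
    qed
    moreover have "(h - scaleC l 1) * y \<in> B"
      using that h q by (auto simp: K_def intro!: closed)
    ultimately show ?thesis unfolding K_def by blast
  qed
  have eig: "\<exists>l y. K y \<and> y \<noteq> 0 \<and> h * y = scaleC l y"
    if "p \<noteq> 0" "K y" "y \<noteq> 0" "poly_at p h * y = 0" for p y
    using that
  proof (induction "degree p" arbitrary: p y rule: less_induct)
    case less
    show ?case
    proof (cases "degree p = 0")
      case True
      then have "scaleC (coeff p 0) y = 0" using less.prems(4) by (simp add: poly_at_def scaleC_mult_left)
      moreover have "coeff p 0 \<noteq> 0" using True less.prems(1) by (metis leading_coeff_0_iff)
      ultimately show ?thesis using less.prems by simp
    next
      case False
      then obtain l where "poly p l = 0"
        using fundamental_theorem_of_algebra[of p] by (auto simp: constant_degree)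
      then obtain r where r: "p = [:- l, 1:] * r" by (metis dvdE poly_eq_0_iff_dvd)
      then have "r \<noteq> 0" using less.prems by auto
      then have deg: "degree r < degree p" unfolding r by (subst degree_mult_eq) auto
      let ?y = "(h - scaleC l 1) * y"
      show ?thesis
      proof (cases "?y = 0")
        case True
        then have "h * y = scaleC l y" by (simp add: algebra_simps scaleC_mult_left)
        then show ?thesis using less.prems by blast
      next
        case False
        have "poly_at r h * ?y = 0"
          using less.prems(4) unfolding r poly_at_linear_mult by (simp add: mult.assoc)
        then show ?thesis using less.hyps[OF deg \<open>r \<noteq> 0\<close> Kstep False] less.prems by blast
      qed
    qed
  qed
  \<comment> \<open>For an eigenvector \<open>y\<close> in \<open>K\<close>, a multiple of \<open>y * star y\<close> is a projection below \<open>q\<close>.\<close>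
  obtain p where "p \<noteq> 0" "poly_at p h = 0" using annihilating_poly[OF h(1)] by blast
  then obtain l y where y: "K y" "y \<noteq> 0" "h * y = scaleC l y"
    using eig[of p q] Kq False by auto
  define z where "z = y * star y"
  have zB: "z \<in> B" and zq: "q * z = z" and z0: "z \<noteq> 0" and zs: "star z = z"
    using y by (auto simp: z_def K_def mult.assoc[symmetric] star_mult star_star intro: mult_closed star_closed)
  have hz: "h * z = scaleC l z" using y(3) by (simp add: z_def mult.assoc[symmetric] scaleC_mult_left)
  obtain c d where "y * z = scaleC c z" "star y * z = scaleC d z"
    using y(1) hz zq unfolding K_def by blast
  then have "z * z = scaleC (c * d) z"
    by (metis z_def mult.assoc scaleC_mult_right scaleC_scaleC mult.commute)
  then obtain k where zz: "z * z = scaleC k z" by blast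
  have "k \<noteq> 0" using zz z0 zs star_mult_self_eq_zero[of z] by auto
  have "k \<in> \<real>"
    using self_adjoint_scaleC_real[of z k] zs z0 zz by (metis star_mult)
  define e where "e = inverse k"
  have e: "e \<noteq> 0" "cnj e = e"
    using \<open>k \<noteq> 0\<close> \<open>k \<in> \<real>\<close> by (simp_all add: e_def Reals_cnj_iff)
  have "projection (scaleC e z)"
    using e \<open>k \<noteq> 0\<close> zs zz e_def
    by (simp add: projection_def star_scaleC scaleC_mult_left scaleC_mult_right scaleC_scaleC)
  moreover have "scaleC e z \<in> B" "q * scaleC e z = scaleC e z" "scaleC e z \<noteq> 0"
    using zB zq z0 e(1) by (auto intro: scale_closed simp: scaleC_mult_right)
  ultimately have "scaleC e z = q" using only by blast
  then have "h * q = scaleC l q"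
    by (metis hz scaleC_mult_right scaleC_scaleC mult.commute)
  then show ?thesis using hq by auto
qed

text \<open>
  Minimal projections of the algebra are defined by one-dimensional corners, the form in which
  minimality is used below.
\<close>

definition min_proj :: "'a \<Rightarrow> bool" where
  "min_proj p \<longleftrightarrow> p \<in> B \<and> projection p \<and> p \<noteq> 0 \<and> (\<forall>x\<in>B. \<exists>c. p * x * p = scaleC c p)"

lemma min_projI:
  assumes q: "q \<in> B" "projection q" "q \<noteq> 0"
    and only: "\<And>p. p \<in> B \<Longrightarrow> projection p \<Longrightarrow> q * p = p \<Longrightarrow> p \<noteq> 0 \<Longrightarrow> p = q"
  shows "min_proj q"
  unfolding min_proj_def
proof (intro conjI ballI q)
  fix x assume x: "x \<in> B"
  have qq: "q * q = q" "star q = q" using q by (auto simp: projection_def)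
  define y where "y = q * x * q"
  have yB: "y \<in> B" using x q by (auto simp: y_def intro!: closed)
  have qy: "q * y = y" "q * star y = star y"
    using qq by (simp_all add: y_def star_mult mult.assoc[symmetric])
  \<comment> \<open>The real and imaginary parts of an element of the corner are scalars.\<close>
  have 1: "\<exists>c. y + star y = scaleC c q"
    by (rule corner_self_adjoint_scalar[OF q(1,2)])
      (use yB qy only in \<open>auto simp: star_add star_star algebra_simps intro: closed\<close>)
  have 2: "\<exists>c. scaleC \<i> (y - star y) = scaleC c q"
    by (rule corner_self_adjoint_scalar[OF q(1,2)])
      (use yB qy only in \<open>auto simp: star_diff star_star star_scaleC algebra_simps scaleC_mult_right complex_vector.scale_right_diff_distrib intro!: closed\<close>)
  obtain c d where cd: "y + star y = scaleC c q" "scaleC \<i> (y - star y) = scaleC d q"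
    using 1 2 by blast
  have "y - star y = scaleC (- \<i>) (scaleC \<i> (y - star y))" by (simp add: scaleC_scaleC scaleC_one)
  then have d: "y - star y = scaleC (- \<i> * d) q" by (simp add: cd scaleC_scaleC)
  have "scaleC (1/2) (y + y) = y"
    by (simp add: scaleC_add_right scaleC_one flip: scaleC_add_left)
  then have "y = scaleC (1/2) ((y + star y) + (y - star y))" by simp
  also have "\<dots> = scaleC ((c - \<i> * d) / 2) q"
    unfolding cd(1) d
    by (simp add: scaleC_scaleC complex_vector.scale_left_diff_distrib
        complex_vector.scale_right_diff_distrib diff_divide_distrib)
  finally show "\<exists>c. q * x * q = scaleC c q" unfolding y_def by blast
qed

text \<open>Sets of pairwise orthogonal nonzero projections, which are linearly independent.\<close>

definition orth_family :: "'a set \<Rightarrow> bool" where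
  "orth_family Q \<longleftrightarrow> (\<forall>p\<in>Q. p \<in> B \<and> projection p \<and> p \<noteq> 0) \<and> (\<forall>p\<in>Q. \<forall>q\<in>Q. p \<noteq> q \<longrightarrow> p * q = 0)"

lemma orth_family_bound: "\<exists>n. \<forall>Q. orth_family Q \<longrightarrow> finite Q \<and> card Q \<le> n"
proof -
  obtain S where S: "finite S" "B \<subseteq> complex_vector.span S" using finite_dimensional by auto
  have "finite Q \<and> card Q \<le> card S" if Q: "orth_family Q" for Q
  proof (rule complex_vector.independent_span_bound[OF S(1)])
    show "Q \<subseteq> complex_vector.span S" using Q S by (auto simp: orth_family_def)
    show "complex_vector.independent Q"
      unfolding complex_vector.independent_explicit_module
    proof (intro allI impI)
      fix T u v assume T: "finite T" "T \<subseteq> Q" "(\<Sum>v\<in>T. scaleC (u v) v) = 0" "v \<in> T"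
      have "0 = v * (\<Sum>w\<in>T. scaleC (u w) w)" using T by simp
      also have "\<dots> = (\<Sum>w\<in>T. if w = v then scaleC (u v) v else 0)"
        unfolding sum_distrib_left using T Q
        by (intro sum.cong) (auto simp: scaleC_mult_right orth_family_def projection_def subset_iff)
      also have "\<dots> = scaleC (u v) v" using T by simp
      finally show "u v = 0" using T Q by (auto simp: orth_family_def)
    qed
  qed
  then show ?thesis by blast
qed

text \<open>A family of orthogonal nonzero subprojections of \<open>e\<close> of maximal size has sum \<open>e\<close>, and none of its
  members can be split, so that they are minimal.\<close>

lemma min_proj_decomposition:
  assumes e: "e \<in> B" "projection e"
  shows "\<exists>Q. finite Q \<and> (\<forall>q\<in>Q. min_proj q) \<and> (\<forall>p\<in>Q. \<forall>q\<in>Q. p \<noteq> q \<longrightarrow> p * q = 0) \<and> \<Sum>Q = e"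
proof -
  define P where "P Q \<longleftrightarrow> orth_family Q \<and> (\<forall>q\<in>Q. e * q = q)" for Q
  obtain n where n: "\<And>Q. orth_family Q \<Longrightarrow> finite Q \<and> card Q \<le> n" using orth_family_bound by blast
  have "P {}" by (simp add: P_def orth_family_def)
  moreover have "\<forall>Q. P Q \<longrightarrow> card Q < Suc n" using n by (auto simp: P_def less_Suc_eq_le)
  ultimately obtain Q where Q: "P Q" and max: "\<And>Q'. P Q' \<Longrightarrow> card Q' \<le> card Q"
    using ex_has_greatest_nat[of P "{}" card "Suc n"] by blast
  have fin: "finite Q" using Q n by (auto simp: P_def)
  have orth: "p * q = 0" if "p \<in> Q" "q \<in> Q" "p \<noteq> q" for p q using Q that by (auto simp: P_def orth_family_def)
  have Qp: "p \<in> B" "projection p" "p \<noteq> 0" "e * p = p" if "p \<in> Q" for p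
    using Q that by (auto simp: P_def orth_family_def)
  have big: False if p: "p \<in> B" "projection p" "p \<noteq> 0" "e * p = p"
    and R: "finite R" "P R" "\<And>q. q \<in> R \<Longrightarrow> q * p = 0" and c: "card Q \<le> card R" for p R
  proof -
    have pR: "p \<notin> R" using R(3) p by (auto simp: projection_def)
    have "p * q = 0" if "q \<in> R" for q
      using R(3)[OF that] R(2) that p(2) projection_mult_swap[of q p 0] by (auto simp: P_def orth_family_def)
    then have "P (insert p R)" using R p by (auto simp: P_def orth_family_def)
    then have "card (insert p R) \<le> card Q" by (rule max)
    then show False using R pR c by simp
  qed
  have total: "\<Sum>Q = e"
  proof (rule ccontr)
    assume neq: "\<Sum>Q \<noteq> e"
    have sp: "projection (\<Sum>Q)" by (rule projection_sum) (use Qp orth in auto)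
    have es: "e * \<Sum>Q = \<Sum>Q" unfolding sum_distrib_left using Qp by (intro sum.cong) auto
    have "q * (e - \<Sum>Q) = 0" if "q \<in> Q" for q
    proof -
      have "q * \<Sum>Q = q" by (rule orthogonal_sum_mult_left[where p = "\<lambda>x. x"]) (use fin that Qp orth in auto)
      moreover have "q * e = q"
        using Qp[OF that] e projection_mult_swap[of e q q] by (auto simp: projection_def)
      ultimately show ?thesis by (simp add: right_diff_distrib)
    qed
    moreover have "projection (e - \<Sum>Q)" by (rule projection_diff[OF sp e(2) es])
    moreover have "e * (e - \<Sum>Q) = e - \<Sum>Q" using e es by (simp add: projection_def right_diff_distrib)
    ultimately show False
      using big[of "e - \<Sum>Q" Q] neq fin Q e Qp by (auto intro!: diff_closed sum_closed)
  qed
  have "min_proj q" if q: "q \<in> Q" for q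
  proof (rule min_projI)
    fix p assume p: "p \<in> B" "projection p" "q * p = p" "p \<noteq> 0"
    show "p = q"
    proof (rule ccontr)
      assume neq: "p \<noteq> q"
      have pq: "p * q = p" using p Qp[OF q] projection_mult_swap[of q p p] by (auto simp: projection_def)
      let ?R = "insert p (Q - {q})"
      have 1: "r * p = 0" "p * r = 0" if "r \<in> Q - {q}" for r
        using that orth[of r q] orth[of q r] q p(3) pq
         by (metis DiffE insertI1 mult.assoc mult_zero_left mult_zero_right)+
      have PR: "P ?R" using p Q 1 Qp[OF q] by (auto simp: P_def orth_family_def) (metis mult.assoc)
      have pn: "p \<notin> Q - {q}" using 1(1)[of p] p by (auto simp: projection_def)
      have "card Q \<le> card ?R" using fin q pn by (simp add: card_Diff_singleton) 
      moreover have "r * (q - p) = 0" if "r \<in> ?R" for r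
        using that 1 orth[of r q] q pq p by (auto simp: right_diff_distrib projection_def)
      moreover have "e * (q - p) = q - p"
        using Qp[OF q] p by (simp add: right_diff_distrib) (metis mult.assoc)
      ultimately show False
        using big[of "q - p" ?R] projection_diff[of p q] p neq Qp[OF q] fin PR by (auto intro: diff_closed)
    qed
  qed (use Qp q in auto)
  then show ?thesis using fin orth total by blast
qed

end

section \<open>The spectral theorem in finite-dimensional subalgebras\<close>

text \<open>
  Finite sets of orthogonal projections with sum \<open>1\<close>. They are indexed by themselves: a combination
  of the projections is given by a coefficient function on the algebra.
\<close>

definition resolution_of_unity :: "'a::cstar_algebra set \<Rightarrow> bool" where
  "resolution_of_unity Q \<longleftrightarrow> finite Q \<and> (\<forall>q\<in>Q. projection q) \<and>
     (\<forall>p\<in>Q. \<forall>q\<in>Q. p \<noteq> q \<longrightarrow> p * q = 0) \<and> \<Sum>Q = 1"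

lemma resolution_mult:
  assumes "resolution_of_unity Q"
  shows "(\<Sum>q\<in>Q. scaleC (c q) q) * (\<Sum>q\<in>Q. scaleC (d q) q) = (\<Sum>q\<in>Q. scaleC (c q * d q) q)"
proof -
  have "(\<Sum>q\<in>Q. scaleC (c q) q) * (\<Sum>q\<in>Q. scaleC (d q) q) =
      (\<Sum>p\<in>Q. \<Sum>q\<in>Q. scaleC (c p * d q) (p * q))"
    by (simp add: sum_product scaleC_mult_left scaleC_mult_right scaleC_scaleC mult.commute)
  also have "\<dots> = (\<Sum>p\<in>Q. \<Sum>q\<in>Q. if q = p then scaleC (c p * d p) p else 0)"
    using assms by (intro sum.cong refl) (auto simp: resolution_of_unity_def projection_def)
  also have "\<dots> = (\<Sum>p\<in>Q. scaleC (c p * d p) p)"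
    using assms by (simp add: resolution_of_unity_def)
  finally show ?thesis .
qed

lemma resolution_star:
  assumes "resolution_of_unity Q"
  shows "star (\<Sum>q\<in>Q. scaleC (c q) q) = (\<Sum>q\<in>Q. scaleC (cnj (c q)) q)"
  using assms by (simp add: star_sum star_scaleC resolution_of_unity_def projection_def)

lemma norm_unitary:
  assumes "star u * u = (1::'a::cstar_algebra)"
  shows "norm u = 1"
proof -
  have "(norm u)\<^sup>2 = 1" using cstar_identity[of u] assms by simp
  then show ?thesis using norm_ge_zero[of u] by (auto simp: power2_eq_1_iff simp del: norm_ge_zero)
qed

text \<open>
  A real combination with coefficients in \<open>[-1, 1]\<close> is the real part of a unitary.
\<close>

lemma resolution_norm_le_1:
  assumes Q: "resolution_of_unity Q" and g: "\<And>q. q \<in> Q \<Longrightarrow> \<bar>g q\<bar> \<le> 1"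
  shows "norm (\<Sum>q\<in>Q. scaleC (complex_of_real (g q)) q) \<le> 1"
proof -
  define c where "c q = Complex (g q) (sqrt (1 - (g q)\<^sup>2))" for q
  define u where "u = (\<Sum>q\<in>Q. scaleC (c q) q)"
  have su: "star u = (\<Sum>q\<in>Q. scaleC (cnj (c q)) q)" unfolding u_def by (rule resolution_star[OF Q])
  have "cnj (c q) * c q = 1" if "q \<in> Q" for q
  proof -
    have "(g q)\<^sup>2 \<le> 1" using g[OF that] by (simp add: abs_square_le_1)
    then show ?thesis by (simp add: c_def complex_eq_iff power2_eq_square[symmetric])
  qed
  then have "star u * u = 1"
    unfolding su unfolding u_def resolution_mult[OF Q] using Q
    by (simp add: scaleC_one resolution_of_unity_def)
  then have nu: "norm u = 1" by (rule norm_unitary)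
  have re: "c q + cnj (c q) = 2 * complex_of_real (g q)" for q
    by (simp add: c_def complex_eq_iff)
  have "u + star u = (\<Sum>q\<in>Q. scaleC (2 * complex_of_real (g q)) q)"
    unfolding su unfolding u_def re[symmetric] by (simp add: scaleC_add_left sum.distrib)
  also have "(\<Sum>q\<in>Q. scaleC (2 * complex_of_real (g q)) q) =
      scaleC 2 (\<Sum>q\<in>Q. scaleC (complex_of_real (g q)) q)"
    by (simp add: complex_vector.scale_sum_right scaleC_scaleC)
  finally have "2 * norm (\<Sum>q\<in>Q. scaleC (complex_of_real (g q)) q) = norm (u + star u)"
    by (simp add: norm_scaleC)
  also have "\<dots> \<le> 2" using norm_triangle_ineq[of u "star u"] nu by simp
  finally show ?thesis by simp
qed

lemma resolution_norm_le:
  assumes Q: "resolution_of_unity Q" and g: "\<And>q. q \<in> Q \<Longrightarrow> \<bar>g q\<bar> \<le> M" and M: "0 \<le> M"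
  shows "norm (\<Sum>q\<in>Q. scaleC (complex_of_real (g q)) q) \<le> M"
proof (cases "M = 0")
  case True
  then show ?thesis using g by simp
next
  case False
  then have M0: "M > 0" using M by simp
  have "\<bar>g q / M\<bar> \<le> 1" if "q \<in> Q" for q using g[OF that] M0 by simp
  then have "norm (\<Sum>q\<in>Q. scaleC (complex_of_real (g q / M)) q) \<le> 1"
    by (rule resolution_norm_le_1[OF Q])
  moreover have "(\<Sum>q\<in>Q. scaleC (complex_of_real (g q)) q) =
      scaleC (complex_of_real M) (\<Sum>q\<in>Q. scaleC (complex_of_real (g q / M)) q)"
    using M0 by (simp add: complex_vector.scale_sum_right scaleC_scaleC)
  ultimately show ?thesis using M0 by (simp add: norm_scaleC)
qed

context fd_subalgebra
begin

lemma min_projD: "min_proj p \<Longrightarrow> x \<in> B \<Longrightarrow> \<exists>c. p * x * p = scaleC c p"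
  by (simp add: min_proj_def)

text \<open>
  The spectral projections are obtained as the minimal projections of the commutative subalgebra of
  all elements that commute with everything commuting with \<open>h\<close>.
\<close>

lemma spectral_resolution:
  assumes h: "h \<in> B" "star h = h"
  obtains Q and l :: "'a \<Rightarrow> real" where "resolution_of_unity Q"
    "\<And>q. q \<in> Q \<Longrightarrow> q \<in> B" "\<And>q. q \<in> Q \<Longrightarrow> q \<noteq> 0"
    "\<And>q. q \<in> Q \<Longrightarrow> h * q = scaleC (complex_of_real (l q)) q"
    "\<And>q z. q \<in> Q \<Longrightarrow> z * h = h * z \<Longrightarrow> z * q = q * z"
proof -
  define C where "C = {x \<in> B. \<forall>z. z * h = h * z \<longrightarrow> z * x = x * z}"
  have CI: "x \<in> C" if "x \<in> B" "\<And>z. z * h = h * z \<Longrightarrow> z * x = x * z" for x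
    using that unfolding C_def by blast
  have CB: "x \<in> B" if "x \<in> C" for x using that unfolding C_def by blast
  have Cc: "z * x = x * z" if "x \<in> C" "z * h = h * z" for x z using that unfolding C_def by blast
  obtain S where S: "finite S" "B \<subseteq> complex_vector.span S" using finite_dimensional by auto
  interpret C: fd_subalgebra C
  proof
    show "1 \<in> C" by (rule CI) (auto intro: closed)
  next
    fix x y assume "x \<in> C" "y \<in> C"
    then show "x + y \<in> C"
      by (intro CI) (simp_all add: Cc[of x] Cc[of y] distrib_left distrib_right add_closed CB)
  next
    fix x y assume xy: "x \<in> C" "y \<in> C"
    show "x * y \<in> C"
    proof (rule CI)
      fix z assume "z * h = h * z"
      then show "z * (x * y) = x * y * z" using Cc[of x z] Cc[of y z] xy by (metis mult.assoc)
    qed (use xy CB in \<open>auto intro: closed\<close>)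
  next
    fix x c assume "x \<in> C"
    then show "scaleC c x \<in> C"
      by (intro CI) (simp_all add: Cc[of x] scaleC_mult_right scaleC_mult_left scale_closed CB)
  next
    fix x assume x: "x \<in> C"
    show "star x \<in> C"
    proof (rule CI)
      fix z assume "z * h = h * z"
      then have "star z * h = h * star z" by (metis h(2) star_mult)
      then have "star z * x = x * star z" by (rule Cc[OF x])
      then show "z * star x = star x * z" by (metis star_mult star_star)
    qed (use x CB in \<open>auto intro: closed\<close>)
  next
    show "\<exists>S. finite S \<and> C \<subseteq> complex_vector.span S" using S CB by blast
  qed
  have hC: "h \<in> C" using h by (intro CI)
  obtain Q where Q: "finite Q" "\<forall>q\<in>Q. C.min_proj q" "\<forall>p\<in>Q. \<forall>q\<in>Q. p \<noteq> q \<longrightarrow> p * q = 0" "\<Sum>Q = 1"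
    using C.min_proj_decomposition[OF C.one_closed projection_1] by blast
  have res: "resolution_of_unity Q" using Q by (simp add: resolution_of_unity_def C.min_proj_def)
  have "\<exists>l. h * q = scaleC (complex_of_real l) q" if qQ: "q \<in> Q" for q
  proof -
    have q: "q \<in> C" "projection q" "q \<noteq> 0" using Q qQ by (auto simp: C.min_proj_def)
    then have hq: "h * q = q * h" using Cc[of q h] by simp
    obtain c where "q * h * q = scaleC c q" using C.min_projD[of q h] Q(2) qQ hC by blast
    then have c: "h * q = scaleC c q" using hq q by (metis mult.assoc projection_def)
    have "star (h * q) = h * q" using q(2) h(2) hq by (metis star_mult projection_def)
    then have "c \<in> \<real>" using q c self_adjoint_scaleC_real[of q c] by (auto simp: projection_def)
    then show ?thesis using c by (auto elim!: Reals_cases)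
  qed
  then obtain l where "\<And>q. q \<in> Q \<Longrightarrow> h * q = scaleC (complex_of_real (l q)) q" by metis
  then show thesis using res Q by (intro that[of Q l]) (auto simp: C.min_proj_def CB Cc)
qed

section \<open>Comparison of projections in finite-dimensional subalgebras\<close>

text \<open>Murray-von Neumann equivalence, implemented by partial isometries of the subalgebra itself.\<close>

definition mvn :: "'a \<Rightarrow> 'a \<Rightarrow> bool" where
  "mvn p q \<longleftrightarrow> projection p \<and> (\<exists>v\<in>B. star v * v = p \<and> v * star v = q)"

end

lemma partial_isometry_source:
  assumes "projection p" "star v * v = (p::'a::cstar_algebra)"
  shows "v * p = v"
proof -
  have "star (v - v * p) * (v - v * p) = 0"
    using assms by (simp add: star_diff star_mult algebra_simps projection_def)
      (simp add: mult.assoc[symmetric])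
  then show ?thesis by simp
qed

lemma partial_isometry_range:
  assumes "projection p" "star v * v = (p::'a::cstar_algebra)"
  shows "projection (v * star v)" "v * star v * v = v"
  using partial_isometry_source[OF assms] assms
  by (simp_all add: projection_def star_mult star_star mult.assoc) (simp add: mult.assoc[symmetric])

context fd_subalgebra
begin

lemma mvn_projections: "mvn p q \<Longrightarrow> projection p \<and> projection q"
  using partial_isometry_range unfolding mvn_def by blast

lemma mvn_refl: "p \<in> B \<Longrightarrow> projection p \<Longrightarrow> mvn p p"
  unfolding mvn_def by (auto simp: projection_def intro!: bexI[of _ p])

lemma mvn_sym: "mvn p q \<Longrightarrow> mvn q p"
  using mvn_projections[of p q] unfolding mvn_def by (metis star_closed star_star)

lemma mvn_trans:
  assumes "mvn p q" "mvn q r"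
  shows "mvn p r"
proof -
  obtain v w where v: "v \<in> B" "star v * v = p" "v * star v = q"
    and w: "w \<in> B" "star w * w = q" "w * star w = r"
    using assms by (auto simp: mvn_def)
  have p: "projection p" and q: "projection q" using assms by (auto simp: mvn_def)
  have "star (w * v) * (w * v) = star v * (star w * w) * v" by (simp add: star_mult mult.assoc)
  also have "\<dots> = star v * (q * v)" using w by (simp add: mult.assoc)
  also have "q * v = v" using partial_isometry_range(2)[OF p v(2)] v(3) by simp
  finally have 1: "star (w * v) * (w * v) = p" using v by simp
  have "(w * v) * star (w * v) = w * (v * star v) * star w" by (simp add: star_mult mult.assoc)
  also have "\<dots> = r" using partial_isometry_source[OF q w(2)] v w by simp
  finally show ?thesis using 1 p v w unfolding mvn_def by (blast intro: mult_closed)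
qed

text \<open>
  Polar decomposition of an approximate partial isometry. The element \<open>star x * x + (1 - p)\<close> is
  close to the unit, so its inverse square root is given by the spectral theorem.
\<close>

lemma polar_near_partial_isometry:
  assumes p: "p \<in> B" "projection p" and q: "q \<in> B" "projection q"
    and x: "x \<in> B" "q * x = x" "x * p = x"
    and d: "norm (star x * x - p) \<le> 1/2" and d': "norm (x * star x - q) < 1"
  shows "\<exists>v\<in>B. star v * v = p \<and> v * star v = q \<and> norm (v - x) \<le> 2 * norm x * norm (star x * x - p)"
proof -
  define h where "h = star x * x + (1 - p)"
  have hB: "h \<in> B" using p x by (auto simp: h_def intro!: closed)
  have hs: "star h = h" using p by (simp add: h_def star_add star_diff star_mult star_star projection_def)
  have px: "p * star x = star x" using p x by (metis projection_def star_mult)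
  have hp: "h * p = star x * x" "p * h = star x * x"
    using p(2) x(3) px
    by (simp_all add: h_def distrib_left distrib_right left_diff_distrib right_diff_distrib
        projection_def mult.assoc flip: mult.assoc[of p])
  obtain Q and l :: "'a \<Rightarrow> real" where Q: "resolution_of_unity Q"
    and QB: "\<And>q. q \<in> Q \<Longrightarrow> q \<in> B" and Q0: "\<And>q. q \<in> Q \<Longrightarrow> q \<noteq> 0"
    and l: "\<And>q. q \<in> Q \<Longrightarrow> h * q = scaleC (complex_of_real (l q)) q"
    and comm: "\<And>q z. q \<in> Q \<Longrightarrow> z * h = h * z \<Longrightarrow> z * q = q * z"
    using spectral_resolution[OF hB hs] by metis
  define D where "D = norm (star x * x - p)"
  have lD: "\<bar>l r - 1\<bar> \<le> D" if r: "r \<in> Q" for r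
  proof -
    have "norm r = 1" using Q r Q0 by (auto simp: resolution_of_unity_def intro!: projection_norm)
    have "(star x * x - p) * r = scaleC (complex_of_real (l r - 1)) r"
      using l[OF r] by (simp add: h_def algebra_simps complex_vector.scale_left_diff_distrib scaleC_one)
    then have "\<bar>l r - 1\<bar> = norm ((star x * x - p) * r)"
      using \<open>norm r = 1\<close> by (simp only: norm_scaleC norm_of_real mult_1_right)
    also have "\<dots> \<le> D" using norm_mult_ineq[of "star x * x - p" r] \<open>norm r = 1\<close> by (simp add: D_def)
    finally show ?thesis .
  qed
  have lpos: "l r \<ge> 1/2" if "r \<in> Q" for r using lD[OF that] d by (auto simp: D_def)
  define s where "s = (\<Sum>r\<in>Q. scaleC (complex_of_real (1 / sqrt (l r))) r)"
  have sB: "s \<in> B" using QB by (auto simp: s_def intro!: sum_closed closed)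
  have ss: "star s = s" unfolding s_def resolution_star[OF Q] by simp
  have hsum: "h = (\<Sum>r\<in>Q. scaleC (complex_of_real (l r)) r)"
  proof -
    have "h = h * \<Sum>Q" using Q by (simp add: resolution_of_unity_def)
    then show ?thesis using l by (simp add: sum_distrib_left)
  qed
  have shs: "s * h * s = 1"
  proof -
    have "s * h * s = (\<Sum>r\<in>Q. scaleC (complex_of_real (1 / sqrt (l r)) * complex_of_real (l r) * complex_of_real (1 / sqrt (l r))) r)"
      unfolding s_def hsum resolution_mult[OF Q] ..
    also have "\<dots> = (\<Sum>r\<in>Q. r)"
    proof (intro sum.cong refl)
      fix r assume "r \<in> Q"
      then have "l r > 0" using lpos[of r] by simp
      then have "1 / sqrt (l r) * l r * (1 / sqrt (l r)) = 1"
        by (simp add: field_simps)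
      then have "complex_of_real (1 / sqrt (l r)) * complex_of_real (l r) * complex_of_real (1 / sqrt (l r)) = 1"
        by (metis of_real_mult of_real_1)
      then show "scaleC (complex_of_real (1 / sqrt (l r)) * complex_of_real (l r) * complex_of_real (1 / sqrt (l r))) r = r"
        by (simp only: scaleC_one)
    qed
    finally show ?thesis using Q by (simp add: resolution_of_unity_def)
  qed
  have sh: "s * h = h * s" unfolding s_def hsum resolution_mult[OF Q] by (simp add: mult.commute)
  have sp: "s * p = p * s" unfolding s_def sum_distrib_left sum_distrib_right
    using comm[of _ p] hp by (intro sum.cong refl) (simp add: scaleC_mult_left scaleC_mult_right)
  define v where "v = x * s"
  have "star v * v = s * (star x * x) * s" by (simp add: v_def star_mult ss mult.assoc)
  also have "\<dots> = s * h * s * p" by (simp add: hp(1)[symmetric] mult.assoc sp)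
  finally have vp: "star v * v = p" by (simp add: shs)
  have qv: "q * v = v" using x by (simp add: v_def mult.assoc[symmetric])
  \<comment> \<open>The defect \<open>r\<close> of the range projection annihilates \<open>x\<close>, whereas \<open>x * star x\<close> is close to \<open>q\<close>.\<close>
  define r where "r = q - v * star v"
  have pr: "projection r" unfolding r_def
    using partial_isometry_range(1)[OF p(2) vp] q(2) qv
    by (intro projection_diff) (simp_all add: mult.assoc[symmetric])
  have "v * star v * x = x * (s * s * (star x * x))" by (simp add: v_def star_mult ss mult.assoc)
  also have "\<dots> = x * (s * h * s * p)" unfolding hp(1)[symmetric] using sh by (simp add: mult.assoc) (simp add: mult.assoc[symmetric] sh)
  finally have "v * star v * x = x" using x by (simp add: shs)
  then have rx: "r * x = 0" using x by (simp add: r_def left_diff_distrib)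
  have rq: "r * q = r"
    using q qv by (simp add: r_def left_diff_distrib projection_def) (metis mult.assoc star_mult)
  have "r * (x * star x - q) = - r"
    using rx rq by (simp add: right_diff_distrib mult.assoc[symmetric])
  then have "norm r \<le> norm r * norm (x * star x - q)"
    by (metis norm_mult_ineq norm_minus_cancel)
  then have "r = 0" using d' by (smt (verit) mult_less_cancel_left2 norm_eq_zero norm_ge_zero mult_le_cancel_left1)
  then have vq: "v * star v = q" by (simp add: r_def)
  have "s - 1 = (\<Sum>r\<in>Q. scaleC (complex_of_real (1 / sqrt (l r) - 1)) r)"
    using Q by (simp add: s_def complex_vector.scale_left_diff_distrib sum_subtractf scaleC_one resolution_of_unity_def)
  also have "norm \<dots> \<le> 2 * D"
  proof (rule resolution_norm_le[OF Q])
    fix r assume r: "r \<in> Q"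
    have lr: "l r \<ge> 1/2" using lpos r by simp
    define t where "t = sqrt (l r)"
    have "sqrt (1/4) \<le> t" unfolding t_def using lr by (intro real_sqrt_le_mono) simp
    then have t: "t \<ge> 1/2" "t * t = l r" using lr by (simp_all add: t_def real_sqrt_divide)
    have "t * (1 + t) \<ge> 1/2"
      using lr t by (simp add: distrib_left)
    have "(1 / t - 1) * (t * (1 + t)) = 1 - l r" using t by (simp add: field_simps)
    then have "\<bar>1 / t - 1\<bar> * (t * (1 + t)) = \<bar>1 - l r\<bar>" using t by (metis abs_mult abs_of_nonneg \<open>1/2 \<le> t * (1 + t)\<close> order_trans zero_le_divide_1_iff zero_le_numeral)
    moreover have "\<bar>1 / t - 1\<bar> * (1/2) \<le> \<bar>1 / t - 1\<bar> * (t * (1 + t))"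
      using \<open>t * (1 + t) \<ge> 1/2\<close> by (intro mult_left_mono) auto
    ultimately have "\<bar>1 / t - 1\<bar> * (1/2) \<le> \<bar>1 - l r\<bar>" by (simp only:)
    also have "\<dots> \<le> D" using lD[OF r] by (simp only: abs_minus_commute[of 1 "l r"])
    finally show "\<bar>1 / sqrt (l r) - 1\<bar> \<le> 2 * D" unfolding t_def by (simp only: mult_2) simp
  qed (simp add: D_def)
  finally have "norm (s - 1) \<le> 2 * D" .
  moreover have "norm (v - x) \<le> norm x * norm (s - 1)"
    using norm_mult_ineq[of x "s - 1"] by (simp add: v_def right_diff_distrib)
  ultimately have "norm (v - x) \<le> norm x * (2 * D)"
    by (meson mult_left_mono norm_ge_zero order_trans)
  then show ?thesis using vp vq x sB by (intro bexI[of _ v]) (auto simp: D_def v_def mult.commute mult.left_commute intro: closed)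
qed

text \<open>
  Positivity of \<open>star x * x\<close> in a one-dimensional corner. If \<open>star y * y = - p\<close>, then, with
  \<open>p * y = scaleC m p\<close>, the element \<open>z = p + t y\<close> satisfies
  \<open>star z * z = (1 + 2 t Re m - t\<^sup>2) p\<close>, which vanishes for some \<open>t > 0\<close>.
\<close>

lemma min_proj_star_mult:
  assumes p: "min_proj p" and x: "x \<in> B" "x * p = x" "x \<noteq> 0"
  shows "\<exists>c>0. star x * x = scaleC (complex_of_real c) p"
proof -
  have pp: "p \<in> B" "p * p = p" "star p = p" "p \<noteq> 0" using p by (auto simp: min_proj_def projection_def)
  have px: "p * star x = star x" using x pp by (metis star_mult)
  have "star x * x \<in> B" using x by (auto intro: closed)
  then obtain c where "p * (star x * x) * p = scaleC c p" using min_projD[OF p] by blast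
  then have c: "star x * x = scaleC c p" using px x by (metis mult.assoc)
  have "star (star x * x) = star x * x" by (simp add: star_mult star_star)
  then have "c \<in> \<real>" using self_adjoint_scaleC_real[of p c] c pp by auto
  then obtain r where r: "c = complex_of_real r" by (auto elim: Reals_cases)
  have "r \<noteq> 0" using r c x(3) by auto
  moreover have False if "r < 0"
  proof -
    define y where "y = scaleC (complex_of_real (1 / sqrt (- r))) x"
    have yp: "y * p = y" using x by (simp add: y_def scaleC_mult_left)
    have "star y * y = scaleC (complex_of_real (1 / sqrt (- r) * (1 / sqrt (- r)) * r)) p"
      unfolding y_def star_scaleC scaleC_mult_left scaleC_mult_right scaleC_scaleC c r
      by (simp only: complex_cnj_complex_of_real of_real_mult mult.assoc)
    also have "1 / sqrt (- r) * (1 / sqrt (- r)) * r = -1" using that by (simp add: field_simps)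
    finally have yy: "star y * y = - p" by (simp add: scaleC_minus_one)
    have "y \<in> B" using x by (auto simp: y_def intro: closed)
    then obtain m where "p * y * p = scaleC m p" using min_projD[OF p] by blast
    then have py: "p * y = scaleC m p" using yp by (metis mult.assoc)
    then have yp': "star y * p = scaleC (cnj m) p" by (metis pp(3) star_mult star_scaleC)
    define t where "t = Re m + sqrt ((Re m)\<^sup>2 + 1)"
    have "sqrt ((Re m)\<^sup>2 + 1) > sqrt ((Re m)\<^sup>2)" by (intro real_sqrt_less_mono) simp
    then have t0: "t > 0" by (simp add: t_def)
    have "(t - Re m)\<^sup>2 = (Re m)\<^sup>2 + 1" by (simp add: t_def)
    then have t1: "1 + 2 * t * Re m - t * t = 0" by (simp add: power2_eq_square algebra_simps)
    let ?t = "complex_of_real t"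
    define z where "z = p + scaleC ?t y"
    have sz: "star z = p + scaleC ?t (star y)" by (simp add: z_def star_add star_scaleC pp)
    have "star z * z = p + scaleC ?t (p * y) + scaleC ?t (star y * p) + scaleC (?t * ?t) (star y * y)"
      unfolding sz unfolding z_def
      by (simp add: distrib_left distrib_right scaleC_mult_left scaleC_mult_right scaleC_scaleC pp algebra_simps)
    also have "\<dots> = scaleC (1 + ?t * m + ?t * cnj m - ?t * ?t) p"
      by (simp add: py yp' yy scaleC_scaleC scaleC_add_left complex_vector.scale_left_diff_distrib scaleC_one)
    also have "1 + ?t * m + ?t * cnj m - ?t * ?t = complex_of_real (1 + 2 * t * Re m - t * t)"
      by (simp add: complex_eq_iff)
    finally have "z = 0" unfolding t1 by simp
    then have "p = - scaleC ?t y" by (simp add: z_def eq_neg_iff_add_eq_0)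
    then have "star p * p = scaleC (?t * ?t) (star y * y)"
      by (simp add: star_minus star_scaleC scaleC_mult_left scaleC_mult_right scaleC_scaleC)
    then have "p + scaleC (?t * ?t) p = 0" using pp yy by (simp add: eq_neg_iff_add_eq_0)
    then have "scaleC (complex_of_real (1 + t * t)) p = 0" by (simp add: scaleC_add_left scaleC_one)
    moreover have "1 + t * t > 0" using t0 by (simp add: add_pos_pos)
    ultimately show False using pp(4) by (simp only: scaleC_eq_0_iff of_real_eq_0_iff) auto
  qed
  ultimately show ?thesis using c r by (metis linorder_neqE_linordered_idom)
qed

lemma min_proj_mvn:
  assumes p: "min_proj p" and q: "min_proj q" and x: "x \<in> B" "q * x = x" "x * p = x" "x \<noteq> 0"
  shows "mvn p q"
proof -
  obtain c where c: "c > 0" "star x * x = scaleC (complex_of_real c) p"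
    using min_proj_star_mult[OF p x(1,3,4)] by blast
  have pp: "projection p" and qp: "projection q" using p q by (auto simp: min_proj_def)
  define v where "v = scaleC (complex_of_real (1 / sqrt c)) x"
  have vB: "v \<in> B" using x by (auto simp: v_def intro: closed)
  have "star v * v = scaleC (complex_of_real (1 / sqrt c * (1 / sqrt c) * c)) p"
    unfolding v_def star_scaleC scaleC_mult_left scaleC_mult_right scaleC_scaleC c
    by (simp only: complex_cnj_complex_of_real of_real_mult mult.assoc)
  also have "1 / sqrt c * (1 / sqrt c) * c = 1" using c by (simp add: field_simps)
  finally have vv: "star v * v = p" by (simp add: scaleC_one)
  have pv: "projection (v * star v)" by (rule partial_isometry_range(1)[OF pp vv])
  have qv: "q * v = v" using x by (simp add: v_def scaleC_mult_right)
  have "v * star v \<in> B" using vB by (auto intro: closed)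
  then obtain d where "q * (v * star v) * q = scaleC d q" using min_projD[OF q] by blast
  moreover have "q * (v * star v) * q = v * star v"
    using qv qp by (metis mult.assoc projection_def star_mult)
  ultimately have d: "v * star v = scaleC d q" by simp
  have "scaleC (d * d) q = scaleC d q"
    using pv qp unfolding d by (simp add: projection_def scaleC_mult_left scaleC_mult_right scaleC_scaleC)
  then have "scaleC (d * d - d) q = 0" by (simp add: complex_vector.scale_left_diff_distrib)
  then have "d * (d - 1) = 0" using q by (simp add: min_proj_def algebra_simps)
  moreover have "d \<noteq> 0" using d vv p by (auto simp: min_proj_def)
  ultimately have "d = 1" by simp
  then show ?thesis using d vv pp vB by (auto simp: mvn_def scaleC_one)
qed

text \<open>Decompositions of a projection into orthogonal minimal projections.\<close>

definition min_decomposition :: "'a set \<Rightarrow> 'a \<Rightarrow> bool" where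
  "min_decomposition Q e \<longleftrightarrow> finite Q \<and> (\<forall>q\<in>Q. min_proj q) \<and> (\<forall>p\<in>Q. \<forall>q\<in>Q. p \<noteq> q \<longrightarrow> p * q = 0) \<and> \<Sum>Q = e"

text \<open>The number of members of \<open>Q\<close> that are equivalent to the minimal projection \<open>p\<close>.\<close>

definition multiplicity_of :: "'a \<Rightarrow> 'a set \<Rightarrow> nat" where
  "multiplicity_of p Q = card {q \<in> Q. mvn p q}"

text \<open>
  The multiplicities of the minimal projections in a decomposition of the unit do not depend on the
  decomposition: \<open>p B\<close> has a basis that consists of one partial isometry with range \<open>p\<close> for each
  member of the decomposition that is equivalent to \<open>p\<close>.
\<close>

lemma multiplicity_eq_dim:
  assumes Q: "min_decomposition Q 1" and p: "min_proj p"
  shows "multiplicity_of p Q = complex_vector.dim ((*) p ` B)"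
proof -
  define Qp where "Qp = {q \<in> Q. mvn p q}"
  have pp: "projection p" "p * p = p" "p \<in> B" "star p = p" using p by (auto simp: min_proj_def projection_def)
  have Qm: "min_proj q" "projection q" "q \<in> B" "q * q = q" "q \<noteq> 0" if "q \<in> Q" for q
    using that Q by (auto simp: min_decomposition_def min_proj_def projection_def)
  have "\<forall>q\<in>Qp. \<exists>w\<in>B. star w * w = q \<and> w * star w = p"
    using mvn_sym[of p] by (auto simp: Qp_def mvn_def[of _ p])
  then obtain w where w: "\<And>q. q \<in> Qp \<Longrightarrow> w q \<in> B \<and> star (w q) * w q = q \<and> w q * star (w q) = p"
    by metis
  have wq: "w q * q = w q" "p * w q = w q" if "q \<in> Qp" for q
    using partial_isometry_source[of q "w q"] partial_isometry_range(2)[of q "w q"] w[OF that] Qm that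
    by (auto simp: Qp_def)
  have inj: "inj_on w Qp" by (rule inj_onI) (metis w)
  have fin: "finite Qp" using Q by (simp add: Qp_def min_decomposition_def)
  have "card (w ` Qp) = complex_vector.dim ((*) p ` B)"
  proof (rule complex_vector.basis_card_eq_dim)
    show "w ` Qp \<subseteq> (*) p ` B" using w wq by (metis image_subsetI rev_image_eqI)
    show "complex_vector.independent (w ` Qp)"
      unfolding complex_vector.independent_explicit_module
    proof (intro allI impI)
      fix T u v assume T: "finite T" "T \<subseteq> w ` Qp" "(\<Sum>v\<in>T. scaleC (u v) v) = 0" "v \<in> T"
      then obtain q where q: "q \<in> Qp" "v = w q" by auto
      have "t * q = (if t = v then v else 0)" if "t \<in> T" for t
      proof -
        obtain r where r: "r \<in> Qp" "t = w r" using T \<open>t \<in> T\<close> by auto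
        show ?thesis
        proof (cases "r = q")
          case True
          then show ?thesis using r q wq by auto
        next
          case False
          then have "t \<noteq> v" using inj r q by (auto simp: inj_on_def)
          moreover have "r * q = 0" using Q r q False by (auto simp: Qp_def min_decomposition_def)
          then have "t * q = 0" using wq(1)[OF r(1)] r by (metis mult.assoc mult_zero_right)
          ultimately show ?thesis by simp
        qed
      qed
      then have "(\<Sum>t\<in>T. scaleC (u t) t) * q = (\<Sum>t\<in>T. if t = v then scaleC (u v) v else 0)"
        unfolding sum_distrib_right by (intro sum.cong) (auto simp: scaleC_mult_left)
      then have "scaleC (u v) v = 0" using T by simp
      moreover have "v \<noteq> 0" using w[OF q(1)] q Qm by (auto simp: Qp_def)
      ultimately show "u v = 0" by simp
    qed
    show "(*) p ` B \<subseteq> complex_vector.span (w ` Qp)"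
    proof
      fix y assume "y \<in> (*) p ` B"
      then have y: "y \<in> B" "p * y = y" using pp by (auto intro: closed simp: mult.assoc[symmetric])
      have "y = (\<Sum>q\<in>Q. y * q)" using Q by (simp add: min_decomposition_def flip: sum_distrib_left)
      also have "\<dots> \<in> complex_vector.span (w ` Qp)"
      proof (rule complex_vector.span_sum)
        fix q assume q: "q \<in> Q"
        show "y * q \<in> complex_vector.span (w ` Qp)"
        proof (cases "y * q = 0")
          case True
          then show ?thesis by (simp add: complex_vector.span_zero)
        next
          case False
          have "mvn q p"
            by (rule min_proj_mvn[OF Qm(1)[OF q] p, of "y * q"])
              (use y q Qm False in \<open>auto simp: mult.assoc intro: closed simp flip: mult.assoc[of p]\<close>)
          then have qQ: "q \<in> Qp" using q mvn_sym by (auto simp: Qp_def)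
          have "y * star (w q) \<in> B" using y w[OF qQ] by (auto intro: closed)
          then obtain c where "p * (y * star (w q)) * p = scaleC c p" using min_projD[OF p] by blast
          moreover have "star (w q) * p = star (w q)" using wq(2)[OF qQ] pp by (metis star_mult)
          ultimately have "y * star (w q) = scaleC c p" using y by (metis mult.assoc)
          then have "y * star (w q) * w q = scaleC c (w q)" using wq[OF qQ] by (simp add: scaleC_mult_left)
          then have "y * q = scaleC c (w q)" using w[OF qQ] by (simp add: mult.assoc)
          then show ?thesis using qQ by (simp add: complex_vector.span_scale complex_vector.span_base)
        qed
      qed
      finally show "y \<in> complex_vector.span (w ` Qp)" .
    qed
  qed
  then show ?thesis using inj by (simp add: multiplicity_of_def Qp_def[symmetric] card_image)
qed

lemma mvn_if_multiplicities_eq: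
  assumes "min_decomposition I e" "min_decomposition J f"
    and "\<And>p. min_proj p \<Longrightarrow> multiplicity_of p I = multiplicity_of p J"
  shows "mvn e f"
  using assms
proof (induction "card I" arbitrary: I J e f)
  case 0
  then have I: "I = {}" "e = 0" by (auto simp: min_decomposition_def)
  have "J = {}"
  proof (rule ccontr)
    assume "J \<noteq> {}"
    then obtain b where b: "b \<in> J" by blast
    then have "min_proj b" using "0.prems" by (auto simp: min_decomposition_def)
    then have "card {q \<in> J. mvn b q} = 0" "mvn b b"
      using "0.prems"(3)[of b] I by (auto simp: multiplicity_of_def min_proj_def mvn_refl)
    then show False using b "0.prems"(2) by (auto simp: min_decomposition_def)
  qed
  then show ?case using I "0.prems" mvn_refl[OF zero_closed projection_0] by (auto simp: min_decomposition_def)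
next
  case (Suc n)
  have fI: "finite I" and fJ: "finite J" using Suc.prems by (auto simp: min_decomposition_def)
  obtain a where a: "a \<in> I" using Suc.hyps(2) by fastforce
  then have am: "min_proj a" using Suc.prems by (auto simp: min_decomposition_def)
  then have "a \<in> {q \<in> I. mvn a q}" using a by (simp add: mvn_refl min_proj_def)
  then have "card {q \<in> I. mvn a q} \<noteq> 0" using fI by auto
  then have "card {q \<in> J. mvn a q} \<noteq> 0" using Suc.prems(3)[OF am] by (simp add: multiplicity_of_def)
  then obtain b where b: "b \<in> J" "mvn a b" by (metis (no_types, lifting) Collect_empty_eq card.empty)
  have ap: "projection a" and bp: "projection b" using mvn_projections[OF b(2)] by auto
  have dI: "min_decomposition (I - {a}) (e - a)" and dJ: "min_decomposition (J - {b}) (f - b)"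
    using Suc.prems a b by (auto simp: min_decomposition_def sum_diff1)
  have "multiplicity_of p (I - {a}) = multiplicity_of p (J - {b})" if p: "min_proj p" for p
  proof -
    have iff: "mvn p a \<longleftrightarrow> mvn p b" using b mvn_trans mvn_sym by blast
    have "{q \<in> I - {a}. mvn p q} = {q \<in> I. mvn p q} - {a}" "{q \<in> J - {b}. mvn p q} = {q \<in> J. mvn p q} - {b}"
      by auto
    then show ?thesis using Suc.prems(3)[OF p] iff a b fI fJ
      by (auto simp: multiplicity_of_def card_Diff_singleton_if)
  qed
  then have "mvn (e - a) (f - b)" using Suc.hyps(1)[OF _ dI dJ] Suc.hyps(2) a by auto
  then obtain v where v: "v \<in> B" "star v * v = e - a" "v * star v = f - b" and ep: "projection (e - a)"
    by (auto simp: mvn_def)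
  obtain w where w: "w \<in> B" "star w * w = a" "w * star w = b" using b by (auto simp: mvn_def)
  have ea: "(e - a) * a = 0" and fb: "(f - b) * b = 0"
  proof -
    have "(\<Sum>(I - {a})) * a = 0" "(\<Sum>(J - {b})) * b = 0"
      using Suc.prems a b unfolding sum_distrib_right min_decomposition_def by (auto intro!: sum.neutral)
    then show "(e - a) * a = 0" "(f - b) * b = 0" using dI dJ by (auto simp: min_decomposition_def)
  qed
  have vs: "v * (e - a) = v" and vr: "(f - b) * v = v"
    using partial_isometry_source[OF ep v(2)] partial_isometry_range[OF ep v(2)] v by auto
  have ws: "w * a = w" and wr: "b * w = w"
    using partial_isometry_source[OF ap w(2)] partial_isometry_range[OF ap w(2)] w by auto
  have fp: "projection (f - b)" using partial_isometry_range(1)[OF ep v(2)] v by simp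
  have 1: "star v * w = 0"
  proof -
    have "star v * w = (star v * (f - b)) * (b * w)" using vr fp wr by (metis projection_def star_mult)
    also have "\<dots> = star v * ((f - b) * b) * w" by (simp only: mult.assoc)
    finally show ?thesis by (simp add: fb)
  qed
  have 2: "v * star w = 0"
  proof -
    have "v * star w = (v * (e - a)) * (a * star w)" using ws ap vs by (metis projection_def star_mult)
    also have "\<dots> = v * ((e - a) * a) * star w" by (simp only: mult.assoc)
    finally show ?thesis by (simp add: ea)
  qed
  have 3: "star w * v = 0" "w * star v = 0"
    using arg_cong[OF 1, of star] arg_cong[OF 2, of star] by (simp_all add: star_mult star_star)
  have "star (v + w) * (v + w) = e" "(v + w) * star (v + w) = f"
    using 1 2 3 v w by (simp_all add: star_add distrib_left distrib_right)
  moreover have "projection e"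
    using Suc.prems(1) unfolding min_decomposition_def
    by (auto intro!: projection_sum[of I "\<lambda>x. x"] simp: min_proj_def)
  ultimately show ?case using v w unfolding mvn_def by (blast intro: add_closed)
qed

end

section \<open>Matrix units\<close>

text \<open>
  A system of \<open>k \<times> k\<close> matrix units with indices below \<open>k\<close> and diagonal sum \<open>s\<close>; it is unital if \<open>s\<close> is \<open>1\<close>.
\<close>

definition matrix_units :: "'a::cstar_algebra \<Rightarrow> nat \<Rightarrow> (nat \<Rightarrow> nat \<Rightarrow> 'a) \<Rightarrow> bool" where
  "matrix_units s k e \<longleftrightarrow>
     (\<forall>i<k. \<forall>j<k. \<forall>l<k. \<forall>m<k. e i j * e l m = (if j = l then e i m else 0)) \<and>
     (\<forall>i<k. \<forall>j<k. star (e i j) = e j i) \<and> (\<Sum>i<k. e i i) = s"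

lemma matrix_unitsD:
  assumes "matrix_units s k e" "i < k" "j < k"
  shows "l < k \<Longrightarrow> m < k \<Longrightarrow> e i j * e l m = (if j = l then e i m else 0)"
    and "star (e i j) = e j i" and "s * e i j = e i j" and "e i j * s = e i j"
    and "projection (e i i)"
proof -
  show *: "e i j * e l m = (if j = l then e i m else 0)" if "l < k" "m < k" for l m
    using assms that by (simp add: matrix_units_def)
  show "star (e i j) = e j i" using assms by (simp add: matrix_units_def)
  have s: "s = (\<Sum>l<k. e l l)" using assms by (simp add: matrix_units_def)
  have "s * e i j = (\<Sum>l<k. if l = i then e i j else 0)"
    unfolding s sum_distrib_right using assms by (intro sum.cong) (auto simp: matrix_units_def)
  then show "s * e i j = e i j" using assms by simp
  have "e i j * s = (\<Sum>l<k. if l = j then e i j else 0)"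
    unfolding s sum_distrib_left using assms by (intro sum.cong) (auto simp: matrix_units_def)
  then show "e i j * s = e i j" using assms by simp
  show "projection (e i i)" using assms by (simp add: matrix_units_def projection_def)
qed

lemma matrix_units_star_unit: "matrix_units s k e \<Longrightarrow> star s = s"
  by (auto simp: matrix_units_def star_sum)

lemma matrix_units_add:
  assumes e: "matrix_units s k e" and f: "matrix_units t k f" and st: "s * t = 0"
  shows "matrix_units (s + t) k (\<lambda>i j. e i j + f i j)"
proof -
  have ts: "t * s = 0"
    using arg_cong[OF st, of star] matrix_units_star_unit[OF e] matrix_units_star_unit[OF f]
    by (simp add: star_mult)
  have 1: "e i j * f l m = 0" if "i < k" "j < k" "l < k" "m < k" for i j l m
  proof -
    have "e i j * f l m = (e i j * s) * (t * f l m)"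
      using matrix_unitsD[OF e] matrix_unitsD[OF f] that by simp
    also have "\<dots> = e i j * (s * t) * f l m" by (simp only: mult.assoc)
    finally show ?thesis by (simp add: st)
  qed
  have 2: "f i j * e l m = 0" if "i < k" "j < k" "l < k" "m < k" for i j l m
  proof -
    have "f i j * e l m = (f i j * t) * (s * e l m)"
      using matrix_unitsD[OF e] matrix_unitsD[OF f] that by simp
    also have "\<dots> = f i j * (t * s) * e l m" by (simp only: mult.assoc)
    finally show ?thesis by (simp add: ts)
  qed
  show ?thesis
    using e f 1 2 by (auto simp: matrix_units_def distrib_left distrib_right star_add sum.distrib)
qed

lemma matrix_units_of_partial_isometries:
  assumes "\<And>i. i < k \<Longrightarrow> star (v i) * v i = p" "projection p"
    and "\<And>i j. i < k \<Longrightarrow> j < k \<Longrightarrow> i \<noteq> j \<Longrightarrow> (v i * star (v i)) * (v j * star (v j)) = 0"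
  shows "matrix_units (\<Sum>i<k. v i * star (v i)) k (\<lambda>i j. v i * star (v j))"
proof -
  have vp: "v i * p = v i" and vv: "v i * star (v i) * v i = v i" if "i < k" for i
    using partial_isometry_source partial_isometry_range(2) assms that by metis+
  have 0: "star (v j) * v l = 0" if "j < k" "l < k" "j \<noteq> l" for j l
  proof -
    have "star (v j) * v l = star (v j * star (v j) * v j) * (v l * star (v l) * v l)"
      using vv that by simp
    also have "\<dots> = star (v j) * ((v j * star (v j)) * (v l * star (v l))) * v l"
      by (simp add: star_mult star_star mult.assoc)
    finally show ?thesis using assms(3)[OF that] by simp
  qed
  have "v i * star (v j) * (v l * star (v m)) = (if j = l then v i * star (v m) else 0)"
    if "i < k" "j < k" "l < k" "m < k" for i j l m
  proof -
    have "v i * star (v j) * (v l * star (v m)) = v i * (star (v j) * v l) * star (v m)"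
      by (simp only: mult.assoc)
    then show ?thesis using 0[of j l] assms(1)[of j] vp[of i] that by auto
  qed
  then show ?thesis by (simp add: matrix_units_def star_mult star_star)
qed

lemma unitary_conj_mult:
  assumes "unitary_element u"
  shows "(u * x * star u) * (u * y * star u) = u * (x * y) * star u"
proof -
  have "(u * x * star u) * (u * y * star u) = u * x * (star u * u) * y * star u"
    by (simp only: mult.assoc)
  also have "star u * u = 1" using assms by (simp add: unitary_element_def)
  finally show ?thesis by (simp add: mult.assoc)
qed

context fd_subalgebra
begin

text \<open>
  A decomposition of the corner projection \<open>e 0 0\<close> is transported along the first column to a
  decomposition of the unit, with multiplicities multiplied by \<open>k\<close>.
\<close>

lemma multiplicity_matrix_units:
  assumes e: "matrix_units 1 k e" and eB: "\<And>i j. i < k \<Longrightarrow> j < k \<Longrightarrow> e i j \<in> B"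
    and k: "0 < k" and I: "min_decomposition I (e 0 0)"
  shows "\<exists>Q. min_decomposition Q 1 \<and> (\<forall>p. min_proj p \<longrightarrow> multiplicity_of p Q = k * multiplicity_of p I)"
proof -
  note mu = matrix_unitsD[OF e]
  have Im: "min_proj a" "projection a" "a \<in> B" "a \<noteq> 0" "star a = a" "a * a = a" if "a \<in> I" for a
    using that I by (auto simp: min_decomposition_def min_proj_def projection_def)
  have orth: "a * b = 0" if "a \<in> I" "b \<in> I" "a \<noteq> b" for a b
    using I that by (auto simp: min_decomposition_def)
  have fI: "finite I" and sI: "\<Sum>I = e 0 0" using I by (auto simp: min_decomposition_def)
  have ea: "e 0 0 * a = a" "a * e 0 0 = a" if "a \<in> I" for a
    using orthogonal_sum_mult_right[of I a "\<lambda>x. x"] orthogonal_sum_mult_left[of I a "\<lambda>x. x"]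
      that fI Im orth sI by auto
  define f where "f i a = e i 0 * a * e 0 i" for i a
  have fm: "f i a * f j b = (if i = j then e i 0 * (a * b) * e 0 i else 0)"
    if "i < k" "j < k" "a \<in> I" "b \<in> I" for i j a b
  proof -
    have "f i a * f j b = e i 0 * a * (e 0 i * e j 0) * b * e 0 j" by (simp add: f_def mult.assoc)
    also have "\<dots> = (if i = j then e i 0 * a * (e 0 0 * b) * e 0 j else 0)"
      using mu(1)[of 0 i j 0] that k by (simp add: mult.assoc)
    finally show ?thesis using ea that by (simp add: mult.assoc)
  qed
  have rec: "e 0 i * f i a * e i 0 = a" if "i < k" "a \<in> I" for i a
  proof -
    have "e 0 i * f i a * e i 0 = (e 0 i * e i 0) * a * (e 0 i * e i 0)" by (simp add: f_def mult.assoc)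
    then show ?thesis using mu(1)[of 0 i i 0] that k ea by simp
  qed
  have fstar: "star (f i a) = f i a" if "i < k" "a \<in> I" for i a
    using mu(2) that k Im by (simp add: f_def star_mult mult.assoc)
  have fB: "f i a \<in> B" if "i < k" "a \<in> I" for i a using eB that k Im by (auto simp: f_def intro!: closed)
  have f0: "f i a \<noteq> 0" if "i < k" "a \<in> I" for i a using rec[OF that] Im that by auto
  have fp: "projection (f i a)" if "i < k" "a \<in> I" for i a
    using fm[of i i a a] that fstar Im by (simp add: projection_def f_def[symmetric])
  have fmin: "min_proj (f i a)" if i: "i < k" and a: "a \<in> I" for i a
    unfolding min_proj_def
  proof (intro conjI ballI fB fp f0 i a)
    fix x assume "x \<in> B"
    then have "e 0 i * x * e i 0 \<in> B" using eB i k by (auto intro!: closed)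
    then obtain c where c: "a * (e 0 i * x * e i 0) * a = scaleC c a"
      using min_projD[OF Im(1)[OF a]] by blast
    have "f i a * x * f i a = e i 0 * (a * (e 0 i * x * e i 0) * a) * e 0 i"
      by (simp add: f_def mult.assoc)
    also have "\<dots> = scaleC c (f i a)" unfolding c by (simp add: f_def scaleC_mult_right scaleC_mult_left)
    finally show "\<exists>c. f i a * x * f i a = scaleC c (f i a)" by blast
  qed
  have feq: "mvn a (f i a)" if i: "i < k" and a: "a \<in> I" for i a
  proof -
    have "star (e i 0 * a) * (e i 0 * a) = a * (e 0 i * e i 0) * a"
      using mu(2)[of i 0] i k Im(5)[OF a] by (simp add: star_mult mult.assoc)
    also have "\<dots> = a" using mu(1)[of 0 i i 0] i k a ea Im by simp
    moreover have "(e i 0 * a) * star (e i 0 * a) = e i 0 * (a * a) * e 0 i"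
      using mu(2)[of i 0] i k Im(5)[OF a] by (simp add: star_mult mult.assoc)
    ultimately show ?thesis using Im[OF a] eB[of i 0] i k unfolding mvn_def f_def
      by (intro conjI bexI[of _ "e i 0 * a"]) (auto intro: closed)
  qed
  have inj: "inj_on (\<lambda>(i, a). f i a) ({..<k} \<times> I)"
  proof (rule inj_onI, clarify)
    fix i a j b assume ij: "i < k" "j < k" "a \<in> I" "b \<in> I" "f i a = f j b"
    have "i = j"
    proof (rule ccontr)
      assume "i \<noteq> j"
      then have "f i a * f j b = 0" using fm[of i j a b] ij(1-4) by simp
      then have "f i a * f i a = 0" using ij(5) by simp
      then show False using ij fp[of i a] f0[of i a] by (simp add: projection_def)
    qed
    then show "i = j \<and> a = b" using rec ij by metis
  qed
  define Q where "Q = (\<lambda>(i, a). f i a) ` ({..<k} \<times> I)"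
  have "min_decomposition Q 1"
    unfolding min_decomposition_def
  proof (intro conjI ballI impI)
    show "finite Q" using fI by (simp add: Q_def)
    show "min_proj q" if "q \<in> Q" for q using that fmin by (auto simp: Q_def)
    show "p * q = 0" if pq: "p \<in> Q" "q \<in> Q" "p \<noteq> q" for p q
    proof -
      obtain i a j b where ij: "i < k" "a \<in> I" "j < k" "b \<in> I" "p = f i a" "q = f j b"
        using pq by (auto simp: Q_def)
      show ?thesis
      proof (cases "i = j")
        case True
        then have "a * b = 0" using orth[of a b] pq(3) ij by blast
        then show ?thesis using fm[of i j a b] ij by simp
      qed (use fm[of i j a b] ij in simp)
    qed
    have "\<Sum>Q = (\<Sum>i<k. \<Sum>a\<in>I. f i a)"
      unfolding Q_def by (subst sum.reindex[OF inj]) (simp add: sum.cartesian_product)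
    also have "\<dots> = (\<Sum>i<k. e i 0 * \<Sum>I * e 0 i)"
      by (simp add: f_def sum_distrib_left sum_distrib_right)
    also have "\<dots> = (\<Sum>i<k. e i i)" unfolding sI using mu(1) k by (intro sum.cong) auto
    finally show "\<Sum>Q = 1" using e by (simp add: matrix_units_def)
  qed
  moreover have "multiplicity_of p Q = k * multiplicity_of p I" for p
  proof -
    have iff: "mvn p (f i a) \<longleftrightarrow> mvn p a" if "i < k" "a \<in> I" for i a
      using feq[OF that] mvn_trans mvn_sym by blast
    have "{q \<in> Q. mvn p q} = (\<lambda>(i, a). f i a) ` ({..<k} \<times> {a \<in> I. mvn p a})"
      using iff by (auto simp: Q_def)
    moreover have "inj_on (\<lambda>(i, a). f i a) ({..<k} \<times> {a \<in> I. mvn p a})"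
      by (rule inj_on_subset[OF inj]) auto
    ultimately show ?thesis by (simp add: multiplicity_of_def card_image card_cartesian_product)
  qed
  ultimately show ?thesis by blast
qed

text \<open>
  In a finite-dimensional algebra, unital systems of matrix units of the same size are unitarily
  equivalent: by \<open>multiplicity_eq_dim\<close> and \<open>multiplicity_matrix_units\<close>, the multiplicities of their
  corner projections agree.
\<close>

theorem matrix_units_conjugate:
  assumes e: "matrix_units 1 k e" "\<And>i j. i < k \<Longrightarrow> j < k \<Longrightarrow> e i j \<in> B"
    and f: "matrix_units 1 k f" "\<And>i j. i < k \<Longrightarrow> j < k \<Longrightarrow> f i j \<in> B"
  shows "\<exists>u\<in>B. unitary_element u \<and> (\<forall>i<k. \<forall>j<k. f i j = u * e i j * star u)"
proof -
  have k: "0 < k" using e(1) by (cases k) (auto simp: matrix_units_def)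
  note me = matrix_unitsD[OF e(1)] and mf = matrix_unitsD[OF f(1)]
  obtain I J where I: "min_decomposition I (e 0 0)" and J: "min_decomposition J (f 0 0)"
    using min_proj_decomposition[OF e(2)[OF k k] me(5)[OF k k]]
      min_proj_decomposition[OF f(2)[OF k k] mf(5)[OF k k]] unfolding min_decomposition_def by blast
  obtain Q where Q: "min_decomposition Q 1" "\<And>p. min_proj p \<Longrightarrow> multiplicity_of p Q = k * multiplicity_of p I"
    using multiplicity_matrix_units[OF e k I] by blast
  obtain R where R: "min_decomposition R 1" "\<And>p. min_proj p \<Longrightarrow> multiplicity_of p R = k * multiplicity_of p J"
    using multiplicity_matrix_units[OF f k J] by blast
  have "mvn (e 0 0) (f 0 0)"
  proof (rule mvn_if_multiplicities_eq[OF I J])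
    fix p assume p: "min_proj p"
    then have "k * multiplicity_of p I = k * multiplicity_of p J"
      using Q R multiplicity_eq_dim by metis
    then show "multiplicity_of p I = multiplicity_of p J" using k by simp
  qed
  then obtain v where v: "v \<in> B" "star v * v = e 0 0" "v * star v = f 0 0" by (auto simp: mvn_def)
  have ve: "v * e 0 0 = v" using partial_isometry_source[OF me(5)[OF k k] v(2)] .
  have fv: "f 0 0 * v = v" using partial_isometry_range(2)[OF me(5)[OF k k] v(2)] v(3) by simp
  define u where "u = (\<Sum>i<k. f i 0 * v * e 0 i)"
  have su: "star u = (\<Sum>i<k. e i 0 * star v * f 0 i)"
    unfolding u_def star_sum using me(2) mf(2) k by (intro sum.cong) (auto simp: star_mult mult.assoc)
  have ue: "u * e i j = f i 0 * v * e 0 j" if "i < k" "j < k" for i j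
  proof -
    have "u * e i j = (\<Sum>l<k. if l = i then f i 0 * v * e 0 j else 0)"
      unfolding u_def sum_distrib_right using that me(1) k by (intro sum.cong) (auto simp: mult.assoc)
    then show ?thesis using that by simp
  qed
  have fu: "f i j * u = f i 0 * v * e 0 j" if "i < k" "j < k" for i j
  proof -
    have "f i j * u = (\<Sum>l<k. if l = j then f i 0 * v * e 0 j else 0)"
      unfolding u_def sum_distrib_left using that mf(1) k
      by (intro sum.cong) (auto simp: mult.assoc[symmetric])
    then show ?thesis using that by simp
  qed
  have eu: "e i j * star u = e i 0 * star v * f 0 j" if "i < k" "j < k" for i j
    using arg_cong[OF ue[of j i], of star] that me(2) mf(2) k by (simp add: star_mult mult.assoc)
  have "u * star u = (\<Sum>i<k. f i 0 * v * (e 0 i * star u))"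
    unfolding u_def sum_distrib_right by (simp add: mult.assoc)
  also have "\<dots> = (\<Sum>i<k. f i i)"
  proof (intro sum.cong refl)
    fix i assume i: "i \<in> {..<k}"
    have "f i 0 * v * (e 0 i * star u) = f i 0 * (v * e 0 0 * star v) * f 0 i"
      using eu[of 0 i] i k by (simp add: mult.assoc)
    also have "\<dots> = f i i" using ve v(3) mf(1) i k by simp
    finally show "f i 0 * v * (e 0 i * star u) = f i i" .
  qed
  finally have uu: "u * star u = 1" using f(1) by (simp add: matrix_units_def)
  have "star u * u = (\<Sum>i<k. e i 0 * star v * (f 0 i * u))"
    unfolding su sum_distrib_right by (simp add: mult.assoc)
  also have "\<dots> = (\<Sum>i<k. e i i)"
  proof (intro sum.cong refl)
    fix i assume i: "i \<in> {..<k}"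
    have "e i 0 * star v * (f 0 i * u) = e i 0 * (star v * (f 0 0 * v)) * e 0 i"
      using fu[of 0 i] i k by (simp add: mult.assoc)
    also have "\<dots> = e i i" using fv v(2) me(1) i k by simp
    finally show "e i 0 * star v * (f 0 i * u) = e i i" .
  qed
  finally have "unitary_element u" using uu e(1) by (simp add: unitary_element_def matrix_units_def)
  moreover have "f i j = u * e i j * star u" if "i < k" "j < k" for i j
  proof -
    have "u * e i j * star u = f i j * (u * star u)" using ue fu that by (simp add: mult.assoc[symmetric])
    then show ?thesis using uu by simp
  qed
  moreover have "u \<in> B" unfolding u_def using e(2) f(2) v k by (intro sum_closed mult_closed) auto
  ultimately show ?thesis by blast
qed

text \<open>
  Conversely, divisibility of all multiplicities by \<open>k\<close> allows matrix units to be built from groups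
  of \<open>k\<close> equivalent minimal projections.
\<close>

lemma matrix_units_if_multiplicities_dvd:
  assumes "finite T" "\<And>p. p \<in> T \<Longrightarrow> min_proj p" "\<And>p q. p \<in> T \<Longrightarrow> q \<in> T \<Longrightarrow> p \<noteq> q \<Longrightarrow> p * q = 0"
    and "0 < k" "\<And>p. min_proj p \<Longrightarrow> k dvd multiplicity_of p T"
  shows "\<exists>e. matrix_units (\<Sum>T) k e \<and> (\<forall>i<k. \<forall>j<k. e i j \<in> B)"
  using assms
proof (induction "card T" arbitrary: T rule: less_induct)
  case less
  show ?case
  proof (cases "T = {}")
    case True
    then show ?thesis by (intro exI[of _ "\<lambda>i j. 0"]) (auto simp: matrix_units_def zero_closed)
  next
    case False
    then obtain a where a: "a \<in> T" by blast
    then have am: "min_proj a" using less.prems by blast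
    then have ap: "projection a" and aa: "mvn a a" by (auto simp: min_proj_def mvn_refl)
    have "{b \<in> T. mvn a b} \<noteq> {}" using a aa by blast
    then have "multiplicity_of a T \<noteq> 0" using less.prems(1) by (simp add: multiplicity_of_def)
    then have "k \<le> card {b \<in> T. mvn a b}"
      using less.prems(5)[OF am] by (simp add: multiplicity_of_def dvd_imp_le)
    then obtain C where C: "C \<subseteq> {b \<in> T. mvn a b}" "card C = k"
      using obtain_subset_with_card_n by metis
    then have CT: "C \<subseteq> T" by blast
    then have fC: "finite C" using less.prems(1) finite_subset by blast
    then obtain c where c: "bij_betw c {..<k} C"
      using C ex_bij_betw_nat_finite[of C] by (auto simp: atLeast0LessThan)
    then have cC: "c i \<in> C" if "i < k" for i using that by (auto simp: bij_betw_def)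
    have "\<forall>i\<in>{..<k}. \<exists>v\<in>B. star v * v = a \<and> v * star v = c i"
      using cC C by (auto simp: mvn_def subset_iff)
    then obtain v where v: "\<And>i. i < k \<Longrightarrow> v i \<in> B \<and> star (v i) * v i = a \<and> v i * star (v i) = c i"
      by (metis lessThan_iff)
    have "matrix_units (\<Sum>i<k. v i * star (v i)) k (\<lambda>i j. v i * star (v j))"
    proof (rule matrix_units_of_partial_isometries)
      fix i j assume ij: "i < k" "j < k" "i \<noteq> j"
      then have "c i \<noteq> c j" using c by (auto simp: bij_betw_def inj_on_def)
      then have "c i * c j = 0" using less.prems(3) cC ij CT by blast
      then show "v i * star (v i) * (v j * star (v j)) = 0" using v ij by simp
    qed (use v ap in auto)
    moreover have "(\<Sum>i<k. v i * star (v i)) = \<Sum>C"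
    proof -
      have "(\<Sum>i<k. v i * star (v i)) = (\<Sum>i<k. c i)" using v by (intro sum.cong) auto
      then show ?thesis using sum.reindex_bij_betw[OF c, of "\<lambda>x. x"] by simp
    qed
    ultimately have 1: "matrix_units (\<Sum>C) k (\<lambda>i j. v i * star (v j))" by simp
    have "\<exists>e. matrix_units (\<Sum>(T - C)) k e \<and> (\<forall>i<k. \<forall>j<k. e i j \<in> B)"
    proof (rule less.hyps)
      have "C \<noteq> {}" using C less.prems(4) by auto
      then show "card (T - C) < card T" using CT less.prems(1) by (intro psubset_card_mono) auto
      fix p assume p: "min_proj p"
      have "multiplicity_of p (T - C) = card ({b \<in> T. mvn p b} - {b \<in> C. mvn p b})"
        unfolding multiplicity_of_def by (rule arg_cong[where f = card]) auto
      also have "\<dots> = multiplicity_of p T - card {b \<in> C. mvn p b}"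
        unfolding multiplicity_of_def using CT fC by (intro card_Diff_subset) auto
      also have "card {b \<in> C. mvn p b} = (if mvn p a then k else 0)"
      proof -
        have "mvn p b \<longleftrightarrow> mvn p a" if "b \<in> C" for b
          using that C mvn_trans mvn_sym by blast
        then have "{b \<in> C. mvn p b} = (if mvn p a then C else {})" by auto
        then show ?thesis using C by simp
      qed
      finally show "k dvd multiplicity_of p (T - C)" using less.prems(5)[OF p] by (simp add: dvd_diff_nat)
    qed (use less.prems in auto)
    then obtain e where e: "matrix_units (\<Sum>(T - C)) k e" "\<forall>i<k. \<forall>j<k. e i j \<in> B" by blast
    have "\<Sum>C * \<Sum>(T - C) = 0"
      unfolding sum_product using less.prems(3) CT by (intro sum.neutral ballI) auto
    moreover have "\<Sum>T = \<Sum>C + \<Sum>(T - C)"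
      using sum.subset_diff[OF CT less.prems(1), of "\<lambda>x. x"] by (simp add: add.commute)
    ultimately have "matrix_units (\<Sum>T) k (\<lambda>i j. v i * star (v j) + e i j)"
      using matrix_units_add[OF 1 e(1)] by simp
    then show ?thesis using e(2) v by (intro exI[of _ "\<lambda>i j. v i * star (v j) + e i j"]) (auto intro!: closed)
  qed
qed

theorem matrix_units_lcm:
  assumes e: "matrix_units 1 m e" "\<And>i j. i < m \<Longrightarrow> j < m \<Longrightarrow> e i j \<in> B"
    and f: "matrix_units 1 n f" "\<And>i j. i < n \<Longrightarrow> j < n \<Longrightarrow> f i j \<in> B"
  shows "\<exists>g. matrix_units 1 (lcm m n) g \<and> (\<forall>i<lcm m n. \<forall>j<lcm m n. g i j \<in> B)"
proof -
  obtain Q where Q: "min_decomposition Q 1"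
    using min_proj_decomposition[OF one_closed projection_1] unfolding min_decomposition_def by blast
  have dvd: "k dvd multiplicity_of p Q"
    if e: "matrix_units 1 k e" "\<And>i j. i < k \<Longrightarrow> j < k \<Longrightarrow> e i j \<in> B" and p: "min_proj p" for k e p
  proof -
    have k: "0 < k" using e(1) by (cases k) (auto simp: matrix_units_def)
    obtain I where I: "min_decomposition I (e 0 0)"
      using min_proj_decomposition[OF e(2)[OF k k] matrix_unitsD(5)[OF e(1) k k]]
      unfolding min_decomposition_def by blast
    show ?thesis
      using multiplicity_matrix_units[OF e k I] multiplicity_eq_dim Q p by (metis dvd_triv_left)
  qed
  have "0 < m" "0 < n" using e(1) f(1) by (cases m; cases n; auto simp: matrix_units_def)+
  then show ?thesis
    using matrix_units_if_multiplicities_dvd[of Q "lcm m n"] dvd[OF e] dvd[OF f] Q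
    by (auto simp: min_decomposition_def lcm_pos_nat)
qed

section \<open>Perturbation of matrix units\<close>

text \<open>
  Orthogonal projections \<open>e i\<close> with sum \<open>1\<close> are approximated by the spectral projections of \<open>h\<close>, an
  approximation of \<open>\<Sum>i. i e i\<close>, that belong to the eigenvalues near \<open>i\<close>.
\<close>

lemma near_orthogonal_projections:
  assumes e: "\<And>i. i < k \<Longrightarrow> projection (e i)" "\<And>i j. i < k \<Longrightarrow> j < k \<Longrightarrow> i \<noteq> j \<Longrightarrow> e i * e j = 0"
    "(\<Sum>i<k. e i) = 1"
    and h: "h \<in> B" "star h = h"
  defines "d \<equiv> norm (h - (\<Sum>i<k. scaleC (of_nat i) (e i)))"
  shows "\<exists>P. (\<forall>i<k. P i \<in> B \<and> projection (P i) \<and> norm (P i - e i) \<le> real k * (2 * (real k + 1) * d)) \<and>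
     (\<forall>i<k. \<forall>j<k. i \<noteq> j \<longrightarrow> P i * P j = 0) \<and> (\<Sum>i<k. P i) = 1"
proof -
  obtain Q and l :: "'a \<Rightarrow> real" where Q: "resolution_of_unity Q"
    and QB: "\<And>q. q \<in> Q \<Longrightarrow> q \<in> B" and Q0: "\<And>q. q \<in> Q \<Longrightarrow> q \<noteq> 0"
    and l: "\<And>q. q \<in> Q \<Longrightarrow> h * q = scaleC (complex_of_real (l q)) q"
    using spectral_resolution[OF h] by metis
  have Qp: "projection q" if "q \<in> Q" for q using Q that by (auto simp: resolution_of_unity_def)
  have Qo: "p * q = 0" if "p \<in> Q" "q \<in> Q" "p \<noteq> q" for p q using Q that by (auto simp: resolution_of_unity_def)
  have fQ: "finite Q" and sQ: "\<Sum>Q = 1" using Q by (auto simp: resolution_of_unity_def)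
  define H where "H = (\<Sum>i<k. scaleC (of_nat i) (e i))"
  have d: "d = norm (h - H)" by (simp add: d_def H_def)
  have eH: "e i * H = scaleC (of_nat i) (e i)" if "i < k" for i
  proof -
    have "e i * H = (\<Sum>j<k. if j = i then scaleC (of_nat i) (e i) else 0)"
      unfolding H_def sum_distrib_left using e that
      by (intro sum.cong) (auto simp: scaleC_mult_right projection_def)
    then show ?thesis using that by simp
  qed
  have en: "norm (e i) \<le> 1" if "i < k" for i using e that by (simp add: projection_norm_le)
  have near: "\<exists>i<k. \<bar>real i - l q\<bar> \<le> real k * d" if q: "q \<in> Q" for q
  proof -
    have nq: "norm q = 1" using projection_norm Qp Q0 q by blast
    have "\<exists>i<k. norm (e i * q) \<ge> 1 / real k"
    proof (rule ccontr)
      assume neg: "\<not> (\<exists>i<k. norm (e i * q) \<ge> 1 / real k)"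
      have k: "k > 0" using e(3) by (cases k) auto
      have "q = (\<Sum>i<k. e i) * q" using e(3) by simp
      then have "norm q \<le> (\<Sum>i<k. norm (e i * q))" unfolding sum_distrib_right by (metis norm_sum)
      also have "\<dots> < (\<Sum>i<k. 1 / real k)" using neg k by (intro sum_strict_mono) (auto simp: not_le)
      also have "\<dots> = 1" using k by simp
      finally show False using nq by simp
    qed
    then obtain i where i: "i < k" "norm (e i * q) \<ge> 1 / real k" by blast
    have "e i * (H - h) * q = scaleC (complex_of_real (real i - l q)) (e i * q)"
      using eH[OF i(1)] l[OF q]
      by (simp add: right_diff_distrib left_diff_distrib scaleC_mult_left scaleC_mult_right mult.assoc complex_vector.scale_left_diff_distrib)
    then have "\<bar>real i - l q\<bar> * norm (e i * q) = norm (e i * (H - h) * q)"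
      by (simp only: norm_scaleC norm_of_real)
    also have "\<dots> \<le> norm (e i) * norm (H - h) * norm q"
      by (meson norm_mult_ineq mult_right_mono norm_ge_zero order_trans)
    also have "\<dots> \<le> d" using en[OF i(1)] nq by (simp add: d norm_minus_commute mult_left_le_one_le)
    finally have "\<bar>real i - l q\<bar> * norm (e i * q) \<le> d" .
    moreover have "\<bar>real i - l q\<bar> * (1 / real k) \<le> \<bar>real i - l q\<bar> * norm (e i * q)"
      using i by (intro mult_left_mono) auto
    ultimately have "\<bar>real i - l q\<bar> * (1 / real k) \<le> d" by linarith
    then show ?thesis using i(1) by (intro exI[of _ i]) (simp add: field_simps)
  qed
  \<comment> \<open>\<open>t\<close> assigns to each spectral projection an integer that is close to its eigenvalue.\<close>
  then obtain t where t: "\<And>q. q \<in> Q \<Longrightarrow> t q < k \<and> \<bar>real (t q) - l q\<bar> \<le> real k * d" by metis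
  define P where "P i = \<Sum>{q \<in> Q. t q = i}" for i
  have PB: "P i \<in> B" for i unfolding P_def using QB by (intro sum_closed) auto
  have Pp: "projection (P i)" for i
    unfolding P_def by (rule projection_sum) (use Qp Qo in auto)
  have Po: "P i * P j = 0" if "i \<noteq> j" for i j
    unfolding P_def sum_product using that by (intro sum.neutral ballI) (auto intro: Qo)
  have Ps: "(\<Sum>i<k. P i) = 1"
  proof -
    have "(\<Sum>i<k. P i) = \<Sum>Q" unfolding P_def by (rule sum.group) (use fQ t in auto)
    then show ?thesis using sQ by simp
  qed
  have off: "norm (e i * P j) \<le> (real k + 1) * d" if ij: "i < k" "j < k" "i \<noteq> j" for i j
  proof -
    have "h * P j - scaleC (of_nat j) (P j) =
        (\<Sum>q\<in>{q \<in> Q. t q = j}. scaleC (complex_of_real (l q - real j)) q)"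
      unfolding P_def sum_distrib_left complex_vector.scale_sum_right sum_subtractf[symmetric] using l
      by (intro sum.cong) (auto simp: complex_vector.scale_left_diff_distrib)
    also have "\<dots> = (\<Sum>q\<in>Q. scaleC (complex_of_real (if t q = j then l q - real j else 0)) q)"
      using fQ by (intro sum.mono_neutral_cong_left) auto
    also have "norm \<dots> \<le> real k * d"
      using t by (intro resolution_norm_le[OF Q]) (auto simp: d abs_minus_commute)
    finally have 1: "norm (h * P j - scaleC (of_nat j) (P j)) \<le> real k * d" .
    have "scaleC (complex_of_real (real i - real j)) (e i * P j) =
        e i * (H - h) * P j + e i * (h * P j - scaleC (of_nat j) (P j))"
      using eH[OF ij(1)]
      by (simp add: right_diff_distrib left_diff_distrib scaleC_mult_left scaleC_mult_right mult.assoc complex_vector.scale_left_diff_distrib)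
    then have "\<bar>real i - real j\<bar> * norm (e i * P j) =
        norm (e i * (H - h) * P j + e i * (h * P j - scaleC (of_nat j) (P j)))"
      by (metis norm_scaleC norm_of_real)
    also have "\<dots> \<le> norm (e i * (H - h) * P j) + norm (e i * (h * P j - scaleC (of_nat j) (P j)))"
      by (rule norm_triangle_ineq)
    also have "norm (e i * (H - h) * P j) \<le> norm (e i) * norm (H - h) * norm (P j)"
      by (meson norm_mult_ineq mult_right_mono norm_ge_zero order_trans)
    also have "\<dots> \<le> 1 * d * 1"
      using en[OF ij(1)] projection_norm_le[OF Pp[of j]]
      by (intro mult_mono) (auto simp: d norm_minus_commute)
    also have "norm (e i * (h * P j - scaleC (of_nat j) (P j))) \<le>
        norm (e i) * norm (h * P j - scaleC (of_nat j) (P j))" by (rule norm_mult_ineq)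
    also have "\<dots> \<le> 1 * (real k * d)" using en[OF ij(1)] 1 by (intro mult_mono) auto
    finally have "\<bar>real i - real j\<bar> * norm (e i * P j) \<le> (real k + 1) * d"
      by (simp add: algebra_simps)
    moreover have "1 * norm (e i * P j) \<le> \<bar>real i - real j\<bar> * norm (e i * P j)"
      using ij(3) by (intro mult_right_mono) auto
    ultimately show ?thesis by linarith
  qed
  have "norm (P j - e j) \<le> real k * (2 * (real k + 1) * d)" if j: "j < k" for j
  proof -
    have "P j - e j = (\<Sum>i<k. e i) * P j - e j * (\<Sum>i<k. P i)" using e(3) Ps by simp
    also have "\<dots> = (\<Sum>i<k. e i * P j - e j * P i)"
      by (simp add: sum_distrib_left sum_distrib_right sum_subtractf)
    also have "norm \<dots> \<le> (\<Sum>i<k. norm (e i * P j - e j * P i))" by (rule norm_sum)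
    also have "\<dots> \<le> (\<Sum>i<k. 2 * (real k + 1) * d)"
    proof (rule sum_mono)
      fix i assume "i \<in> {..<k}"
      then show "norm (e i * P j - e j * P i) \<le> 2 * (real k + 1) * d"
        using off[of i j] off[of j i] j norm_triangle_ineq4[of "e i * P j" "e j * P i"]
        by (cases "i = j") (auto simp: d algebra_simps)
    qed
    finally show ?thesis by simp
  qed
  then show ?thesis using PB Pp Po Ps by blast
qed

end

lemma dense_increasing_approx:
  fixes Bs :: "nat \<Rightarrow> 'a::cstar_algebra set"
  assumes inc: "\<And>n. Bs n \<subseteq> Bs (Suc n)" and ne: "\<And>n. Bs n \<noteq> {}" and dense: "closure (\<Union>n. Bs n) = UNIV"
  shows "\<exists>y. (\<forall>n. y n \<in> Bs n) \<and> y \<longlonglongrightarrow> a"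
proof -
  have "\<exists>y\<in>Bs n. dist a y < infdist a (Bs n) + 1 / real (Suc n)" for n
    using cInf_lessD[of "dist a ` Bs n" "infdist a (Bs n) + 1 / real (Suc n)"] ne[of n]
    by (auto simp: infdist_def)
  then obtain y where y: "\<And>n. y n \<in> Bs n" "\<And>n. dist a (y n) < infdist a (Bs n) + 1 / real (Suc n)" by metis
  have "y \<longlonglongrightarrow> a"
  proof (rule LIMSEQ_I, simp only: dist_norm[symmetric])
    fix r :: real assume r: "r > 0"
    have "a \<in> closure (\<Union>n. Bs n)" using dense by simp
    then obtain z N where z: "z \<in> Bs N" "dist z a < r / 2"
      using r unfolding closure_approachable by (metis UN_E half_gt_zero)
    obtain M where M: "1 / real (Suc M) < r / 2" using r nat_approx_posE[of "r/2"] by auto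
    have "dist (y n) a < r" if n: "n \<ge> max N M" for n
    proof -
      have "Bs N \<subseteq> Bs n" using lift_Suc_mono_le[of Bs N n] inc n by auto
      then have "infdist a (Bs n) \<le> dist a z" using z by (intro infdist_le) auto
      moreover have "1 / real (Suc n) \<le> 1 / real (Suc M)" using n by (intro divide_left_mono) auto
      ultimately show ?thesis using y(2)[of n] z M by (simp add: dist_commute)
    qed
    then show "\<exists>no. \<forall>n\<ge>no. dist (y n) a < r" by blast
  qed
  then show ?thesis using y by blast
qed

text \<open>
  Matrix units of a C*-algebra with a dense increasing union of finite-dimensional subalgebras lie
  close to matrix units of some member of the sequence. The diagonal is corrected by means of the
  spectral projections of an approximation of \<open>\<Sum>i. i e\<^sub>i\<^sub>i\<close>, and the first column by polar decomposition.
\<close>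

theorem matrix_units_perturb:
  fixes Bs :: "nat \<Rightarrow> 'a::cstar_algebra set"
  assumes fd: "\<And>n. fd_subalgebra (Bs n)" and inc: "\<And>n. Bs n \<subseteq> Bs (Suc n)"
    and dense: "closure (\<Union>n. Bs n) = UNIV"
    and e: "matrix_units 1 k e" and r: "0 < r"
  shows "\<exists>n f. matrix_units 1 k f \<and> (\<forall>i<k. \<forall>j<k. f i j \<in> Bs n \<and> norm (f i j - e i j) < r)"
proof -
  have k: "0 < k" using e by (cases k) (auto simp: matrix_units_def)
  note me = matrix_unitsD[OF e]
  have ne: "Bs n \<noteq> {}" for n using fd_subalgebra.one_closed[OF fd] by blast
  note approx = dense_increasing_approx[OF inc ne dense]
  define H where "H = (\<Sum>i<k. scaleC (of_nat i) (e i i))"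
  have sH: "star H = H" unfolding H_def star_sum using me(2) by (intro sum.cong) (auto simp: star_scaleC)
  obtain h0 where h0: "\<And>n. h0 n \<in> Bs n" "h0 \<longlonglongrightarrow> H" using approx[of H] by blast
  define h where "h n = scaleC (1/2) (h0 n + star (h0 n))" for n
  have hB: "h n \<in> Bs n" for n
    using h0(1) fd[of n] unfolding h_def by (simp add: fd_subalgebra.closed)
  have hs: "star (h n) = h n" for n by (simp add: h_def star_scaleC star_add star_star add.commute)
  have "h \<longlonglongrightarrow> scaleC (1/2) (H + star H)"
    unfolding h_def by (intro tendsto_scaleC tendsto_add tendsto_star h0(2))
  also have "scaleC (1/2) (H + star H) = H" by (simp add: sH scaleC_add_right scaleC_one flip: scaleC_add_left)
  finally have hH: "h \<longlonglongrightarrow> H" .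
  have "\<exists>P. (\<forall>i<k. P i \<in> Bs n \<and> projection (P i) \<and> norm (P i - e i i) \<le> real k * (2 * (real k + 1) * norm (h n - H))) \<and>
     (\<forall>i<k. \<forall>j<k. i \<noteq> j \<longrightarrow> P i * P j = 0) \<and> (\<Sum>i<k. P i) = 1" for n
    unfolding H_def
    by (rule fd_subalgebra.near_orthogonal_projections[OF fd _ _ _ hB hs])
      (use me k e in \<open>auto simp: matrix_units_def\<close>)
  then obtain P where P: "\<And>n i. i < k \<Longrightarrow> P n i \<in> Bs n \<and> projection (P n i)"
    "\<And>n i. i < k \<Longrightarrow> norm (P n i - e i i) \<le> real k * (2 * (real k + 1) * norm (h n - H))"
    "\<And>n i j. i < k \<Longrightarrow> j < k \<Longrightarrow> i \<noteq> j \<Longrightarrow> P n i * P n j = 0" "\<And>n. (\<Sum>i<k. P n i) = 1"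
    by metis
  have Plim: "(\<lambda>n. P n i) \<longlonglongrightarrow> e i i" if "i < k" for i
  proof (rule LIM_zero_cancel, rule tendsto_norm_zero_cancel, rule tendsto_sandwich[OF _ _ tendsto_const])
    show "\<forall>\<^sub>F n in sequentially. 0 \<le> norm (P n i - e i i)" by simp
    show "\<forall>\<^sub>F n in sequentially. norm (P n i - e i i) \<le> real k * (2 * (real k + 1) * norm (h n - H))"
      using P(2) that by simp
    have "(\<lambda>n. real k * (2 * (real k + 1) * norm (h n - H))) \<longlonglongrightarrow> real k * (2 * (real k + 1) * norm (H - H))"
      by (intro tendsto_intros hH)
    then show "(\<lambda>n. real k * (2 * (real k + 1) * norm (h n - H))) \<longlonglongrightarrow> 0" by simp
  qed
  obtain y where y: "\<And>i n. y i n \<in> Bs n" "\<And>i. y i \<longlonglongrightarrow> e i 0"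
    using choice[of "\<lambda>i y. (\<forall>n. y n \<in> Bs n) \<and> y \<longlonglongrightarrow> e i 0"] approx by blast
  \<comment> \<open>Approximations of the first column that are compatible with the corrected diagonal.\<close>
  define x where "x i n = P n i * y i n * P n 0" for i n
  have xlim: "x i \<longlonglongrightarrow> e i 0" if i: "i < k" for i
  proof -
    have "x i \<longlonglongrightarrow> e i i * e i 0 * e 0 0" unfolding x_def by (intro tendsto_mult Plim y i k)
    then show ?thesis using me(1) i k by simp
  qed
  have l1: "(\<lambda>n. norm (star (x i n) * x i n - P n 0)) \<longlonglongrightarrow> 0" if i: "i < k" for i
  proof -
    have "(\<lambda>n. norm (star (x i n) * x i n - P n 0)) \<longlonglongrightarrow> norm (star (e i 0) * e i 0 - e 0 0)"
      by (intro tendsto_norm tendsto_diff tendsto_mult tendsto_star Plim xlim i k)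
    then show ?thesis using me i k by simp
  qed
  have l2: "(\<lambda>n. norm (x i n * star (x i n) - P n i)) \<longlonglongrightarrow> 0" if i: "i < k" for i
  proof -
    have "(\<lambda>n. norm (x i n * star (x i n) - P n i)) \<longlonglongrightarrow> norm (e i 0 * star (e i 0) - e i i)"
      by (intro tendsto_norm tendsto_diff tendsto_mult tendsto_star Plim xlim i k)
    then show ?thesis using me i k by simp
  qed
  have l3: "(\<lambda>n. 2 * norm (x i n) * norm (star (x i n) * x i n - P n 0) + norm (x i n - e i 0)) \<longlonglongrightarrow> 0"
    if i: "i < k" for i
  proof -
    have "(\<lambda>n. 2 * norm (x i n) * norm (star (x i n) * x i n - P n 0) + norm (x i n - e i 0)) \<longlonglongrightarrow>
        2 * norm (e i 0) * 0 + norm (e i 0 - e i 0)"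
      by (intro tendsto_intros l1 xlim i)
    then show ?thesis by simp
  qed
  have "\<forall>\<^sub>F n in sequentially. \<forall>i\<in>{..<k}. norm (star (x i n) * x i n - P n 0) < 1/2 \<and>
      norm (x i n * star (x i n) - P n i) < 1 \<and>
      2 * norm (x i n) * norm (star (x i n) * x i n - P n 0) + norm (x i n - e i 0) < r / 2"
    using r by (intro eventually_ball_finite ballI eventually_conj order_tendstoD(2)[OF l1]
        order_tendstoD(2)[OF l2] order_tendstoD(2)[OF l3]) auto
  then obtain n where n: "\<And>i. i < k \<Longrightarrow> norm (star (x i n) * x i n - P n 0) < 1/2 \<and>
      norm (x i n * star (x i n) - P n i) < 1 \<and>
      2 * norm (x i n) * norm (star (x i n) * x i n - P n 0) + norm (x i n - e i 0) < r / 2"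
    by (auto simp: eventually_sequentially)
  have Pn: "P n i * P n i = P n i" if "i < k" for i using P(1)[OF that] by (simp add: projection_def)
  have "\<exists>v\<in>Bs n. star v * v = P n 0 \<and> v * star v = P n i \<and> norm (v - e i 0) < r / 2" if i: "i < k" for i
  proof -
    have "x i n \<in> Bs n" using P(1)[OF i] P(1)[OF k] y fd[of n] by (simp add: x_def fd_subalgebra.closed)
    then obtain v where v: "v \<in> Bs n" "star v * v = P n 0" "v * star v = P n i"
      "norm (v - x i n) \<le> 2 * norm (x i n) * norm (star (x i n) * x i n - P n 0)"
      using fd_subalgebra.polar_near_partial_isometry[OF fd[of n], of "P n 0" "P n i" "x i n"]
        P(1)[OF i] P(1)[OF k] n[OF i] Pn[OF i] Pn[OF k]
      by (auto simp: x_def mult.assoc simp flip: mult.assoc[of "P n i" "P n i"])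
    have "norm (v - e i 0) \<le> norm (v - x i n) + norm (x i n - e i 0)"
      using norm_triangle_ineq[of "v - x i n" "x i n - e i 0"] by simp
    also have "\<dots> < r / 2" using v(4) n[OF i] by linarith
    finally show ?thesis using v by blast
  qed
  then obtain v where v: "\<And>i. i < k \<Longrightarrow> v i \<in> Bs n \<and> star (v i) * v i = P n 0 \<and>
      v i * star (v i) = P n i \<and> norm (v i - e i 0) < r / 2" by metis
  have "matrix_units (\<Sum>i<k. v i * star (v i)) k (\<lambda>i j. v i * star (v j))"
    by (rule matrix_units_of_partial_isometries) (use v P k in auto)
  moreover have "(\<Sum>i<k. v i * star (v i)) = 1" using P(4)[of n] v by (metis (no_types, lifting) lessThan_iff sum.cong)
  moreover have "norm (v i * star (v j) - e i j) < r" if i: "i < k" and j: "j < k" for i j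
  proof -
    have norm1: "norm w \<le> 1" if "star w * w = p" "projection p" for w p :: 'a
      using cstar_identity[of w] that projection_norm_le[of p] power2_le_imp_le[of "norm w" 1] by simp
    have nv: "norm (v j) \<le> 1" using norm1[of "v j" "P n 0"] v[OF j] P(1)[OF k] by blast
    have "star (e i 0) * e i 0 = e 0 0" using me(2)[OF i k] me(1)[OF k i i k] by simp
    then have nei: "norm (e i 0) \<le> 1" using norm1 me(5)[OF k k] by blast
    have "v i * star (v j) - e i j = (v i - e i 0) * star (v j) + e i 0 * star (v j - e j 0)"
      using me(1,2) i j k by (simp add: star_diff algebra_simps)
    then have "norm (v i * star (v j) - e i j) \<le> norm ((v i - e i 0) * star (v j)) + norm (e i 0 * star (v j - e j 0))"
      by (metis norm_triangle_ineq)
    also have "\<dots> \<le> norm (v i - e i 0) * norm (v j) + norm (e i 0) * norm (v j - e j 0)"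
      using norm_mult_ineq[of "v i - e i 0" "star (v j)"] norm_mult_ineq[of "e i 0" "star (v j - e j 0)"] by simp
    also have "\<dots> \<le> norm (v i - e i 0) * 1 + 1 * norm (v j - e j 0)"
      using nv nei by (intro add_mono mult_mono) auto
    also have "\<dots> < r" using v[OF i] v[OF j] by simp
    finally show ?thesis .
  qed
  moreover have "v i * star (v j) \<in> Bs n" if "i < k" "j < k" for i j
    using v that fd[of n] by (simp add: fd_subalgebra.closed)
  ultimately show ?thesis by (intro exI[of _ n] exI[of _ "\<lambda>i j. v i * star (v j)"]) auto
qed

section \<open>Unital homomorphisms from full matrix algebras\<close>

text \<open>Unital *-homomorphisms from the \<open>k \<times> k\<close> matrices to the ambient algebra.\<close>

definition unital_mat_hom :: "nat \<Rightarrow> (complex mat \<Rightarrow> 'a::cstar_algebra) \<Rightarrow> bool" where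
  "unital_mat_hom k f \<longleftrightarrow> star_hom (matrix_cstar k) (cstar_of UNIV) f \<and> f (1\<^sub>m k) = 1"

lemma matrix_cstar_simps [simp]:
  "carrier (matrix_cstar k) = carrier_mat k k" "calg_add (matrix_cstar k) = (+)"
  "calg_zero (matrix_cstar k) = 0\<^sub>m k k" "calg_mult (matrix_cstar k) = (*)"
  "calg_scale (matrix_cstar k) = (\<cdot>\<^sub>m)" "calg_star (matrix_cstar k) = mat_adjoint"
  "calg_norm (matrix_cstar k) = op_norm_mat"
  by (simp_all add: matrix_cstar_def)

lemma cstar_of_simps [simp]:
  "carrier (cstar_of B) = B" "calg_add (cstar_of B) = (+)"
  "calg_zero (cstar_of B) = 0" "calg_mult (cstar_of B) = (*)"
  "calg_scale (cstar_of B) = scaleC" "calg_star (cstar_of B) = star"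
  "calg_norm (cstar_of B) = norm"
  by (simp_all add: cstar_of_def)

lemma calg_dist_cstar_of [simp]: "calg_dist (cstar_of B) x y = norm (x - y)"
  by (simp add: calg_dist_def scaleC_minus_one)

lemma mat_adjoint_carrier [simp]: "A \<in> carrier_mat k k \<Longrightarrow> mat_adjoint A \<in> carrier_mat k k"
  by (auto simp: mat_adjoint_def)

lemma mat_adjoint_index [simp]:
  "A \<in> carrier_mat k k \<Longrightarrow> i < k \<Longrightarrow> j < k \<Longrightarrow> mat_adjoint A $$ (i, j) = cnj (A $$ (j, i))"
  by (auto simp: mat_adjoint_def mat_of_rows_def)

lemma mat_adjoint_dim [simp]: "A \<in> carrier_mat k k \<Longrightarrow> dim_row (mat_adjoint A) = k"
  "A \<in> carrier_mat k k \<Longrightarrow> dim_col (mat_adjoint A) = k"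
  using mat_adjoint_carrier by blast+

lemma mult_mat_index:
  assumes "A \<in> carrier_mat k k" "C \<in> carrier_mat k k" "i < k" "j < k"
  shows "(A * C) $$ (i, j) = (\<Sum>l<k. A $$ (i, l) * C $$ (l, j))"
  using assms by (simp add: scalar_prod_def atLeast0LessThan)

lemma unital_mat_hom_iff:
  "unital_mat_hom k f \<longleftrightarrow>
     (\<forall>X\<in>carrier_mat k k. \<forall>Y\<in>carrier_mat k k. f (X + Y) = f X + f Y) \<and>
     (\<forall>X\<in>carrier_mat k k. \<forall>Y\<in>carrier_mat k k. f (X * Y) = f X * f Y) \<and>
     (\<forall>c. \<forall>X\<in>carrier_mat k k. f (c \<cdot>\<^sub>m X) = scaleC c (f X)) \<and>
     (\<forall>X\<in>carrier_mat k k. f (mat_adjoint X) = star (f X)) \<and> f (1\<^sub>m k) = 1"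
  by (simp add: unital_mat_hom_def star_hom_def)

lemma unital_mat_homD:
  assumes "unital_mat_hom k f" "X \<in> carrier_mat k k"
  shows "Y \<in> carrier_mat k k \<Longrightarrow> f (X + Y) = f X + f Y"
    and "Y \<in> carrier_mat k k \<Longrightarrow> f (X * Y) = f X * f Y"
    and "f (c \<cdot>\<^sub>m X) = scaleC c (f X)" and "f (mat_adjoint X) = star (f X)"
  using assms by (simp_all add: unital_mat_hom_iff)

lemma unital_mat_hom_one: "unital_mat_hom k f \<Longrightarrow> f (1\<^sub>m k) = 1"
  by (simp add: unital_mat_hom_def)

lemma unital_mat_hom_zero: "unital_mat_hom k f \<Longrightarrow> f (0\<^sub>m k k) = 0"
  using unital_mat_homD(3)[of k f "0\<^sub>m k k" 0] by (simp add: smult_zero_mat)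

lemma is_unit_of_matrix_cstar: "is_unit_of (matrix_cstar k) e \<longleftrightarrow> e = 1\<^sub>m k"
proof
  assume e: "is_unit_of (matrix_cstar k) e"
  then have "e * 1\<^sub>m k = 1\<^sub>m k" "e \<in> carrier_mat k k" by (simp_all add: is_unit_of_def)
  then show "e = 1\<^sub>m k" by simp
qed (simp add: is_unit_of_def)

lemma unital_star_hom_matrix_iff:
  "unital_star_hom (matrix_cstar k) Y f \<longleftrightarrow> star_hom (matrix_cstar k) Y f \<and> is_unit_of Y (f (1\<^sub>m k))"
  by (auto simp: unital_star_hom_def is_unit_of_matrix_cstar)

lemma unital_mat_hom_comp:
  assumes "unital_mat_hom k f" "unital_star_hom (matrix_cstar l) (matrix_cstar k) g"
  shows "unital_mat_hom l (f \<circ> g)"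
  using assms unfolding unital_star_hom_matrix_iff is_unit_of_matrix_cstar
  by (auto simp: star_hom_def unital_mat_hom_iff)

text \<open>The standard matrix units.\<close>

definition mat_unit :: "nat \<Rightarrow> nat \<Rightarrow> nat \<Rightarrow> complex mat" where
  "mat_unit k i j = mat k k (\<lambda>(a, b). if a = i \<and> b = j then 1 else 0)"

lemma mat_unit_carrier [simp]: "mat_unit k i j \<in> carrier_mat k k"
  by (simp add: mat_unit_def)

lemma mat_unit_index [simp]:
  "a < k \<Longrightarrow> b < k \<Longrightarrow> mat_unit k i j $$ (a, b) = (if a = i \<and> b = j then 1 else 0)"
  by (simp add: mat_unit_def)

lemma mat_unit_dim [simp]: "dim_row (mat_unit k i j) = k" "dim_col (mat_unit k i j) = k"
  by (simp_all add: mat_unit_def)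

lemma mat_unit_mult:
  assumes "i < k" "j < k" "l < k" "m < k"
  shows "mat_unit k i j * mat_unit k l m = (if j = l then mat_unit k i m else 0\<^sub>m k k)"
proof (rule eq_matI)
  fix a b assume "a < dim_row (if j = l then mat_unit k i m else 0\<^sub>m k k)"
    "b < dim_col (if j = l then mat_unit k i m else 0\<^sub>m k k)"
  then have ab: "a < k" "b < k" by (auto split: if_splits)
  have "(mat_unit k i j * mat_unit k l m) $$ (a, b) =
      (\<Sum>c<k. if c = j then (if a = i \<and> j = l \<and> b = m then 1 else 0) else 0)"
    unfolding mult_mat_index[OF mat_unit_carrier mat_unit_carrier ab]
    using ab by (intro sum.cong) auto
  then show "(mat_unit k i j * mat_unit k l m) $$ (a, b) = (if j = l then mat_unit k i m else 0\<^sub>m k k) $$ (a, b)"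
    using assms ab by auto
qed (use assms in auto)

lemma mat_unit_sandwich:
  assumes "X \<in> carrier_mat k k" "i < k" "j < k"
  shows "mat_unit k i i * X * mat_unit k j j = X $$ (i, j) \<cdot>\<^sub>m mat_unit k i j"
proof (rule eq_matI)
  fix a b assume "a < dim_row (X $$ (i, j) \<cdot>\<^sub>m mat_unit k i j)" "b < dim_col (X $$ (i, j) \<cdot>\<^sub>m mat_unit k i j)"
  then have ab: "a < k" "b < k" by auto
  have 1: "(mat_unit k i i * X) $$ (a, c) = (if a = i then X $$ (i, c) else 0)" if "c < k" for c
  proof -
    have "(mat_unit k i i * X) $$ (a, c) = (\<Sum>l<k. if l = i then (if a = i then X $$ (i, c) else 0) else 0)"
      unfolding mult_mat_index[OF mat_unit_carrier assms(1) ab(1) that]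
      using ab by (intro sum.cong) auto
    then show ?thesis using assms by simp
  qed
  have "(mat_unit k i i * X * mat_unit k j j) $$ (a, b) =
      (\<Sum>c<k. if c = j then (if a = i \<and> b = j then X $$ (i, j) else 0) else 0)"
    unfolding mult_mat_index[OF mult_carrier_mat[OF mat_unit_carrier assms(1)] mat_unit_carrier ab]
    using ab 1 by (intro sum.cong) auto
  then show "(mat_unit k i i * X * mat_unit k j j) $$ (a, b) = (X $$ (i, j) \<cdot>\<^sub>m mat_unit k i j) $$ (a, b)"
    using assms ab by auto
qed (use assms in auto)

lemma mat_unit_adjoint:
  "mat_adjoint (mat_unit k i j) = mat_unit k j i"
  by (rule eq_matI) (auto simp: mat_adjoint_index[OF mat_unit_carrier] mat_adjoint_dim[OF mat_unit_carrier])

lemma unital_mat_hom_matrix_units: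
  assumes f: "unital_mat_hom k f"
  shows "matrix_units 1 k (\<lambda>i j. f (mat_unit k i j))"
proof -
  note fD = unital_mat_homD[OF f]
  have part: "f (mat k k (\<lambda>(a, b). if a = b \<and> a < n then 1 else 0)) = (\<Sum>i<n. f (mat_unit k i i))"
    if "n \<le> k" for n
    using that
  proof (induction n)
    case 0
    have "mat k k (\<lambda>(a, b). if a = b \<and> a < 0 then 1 else 0) = (0\<^sub>m k k :: complex mat)"
      by (rule eq_matI) auto
    then show ?case unfolding \<open>mat k k _ = 0\<^sub>m k k\<close> using unital_mat_hom_zero[OF f] by simp
  next
    case (Suc n)
    have "mat k k (\<lambda>(a, b). if a = b \<and> a < Suc n then 1 else 0) =
        mat k k (\<lambda>(a, b). if a = b \<and> a < n then 1 else 0) + mat_unit k n n"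
      by (rule eq_matI) auto
    then show ?case using Suc fD(1)[of "mat k k (\<lambda>(a, b). if a = b \<and> a < n then 1 else 0)" "mat_unit k n n"]
      by simp
  qed
  have "mat k k (\<lambda>(a, b). if a = b \<and> a < k then 1 else 0) = (1\<^sub>m k :: complex mat)" by (rule eq_matI) auto
  then have "(\<Sum>i<k. f (mat_unit k i i)) = 1" using part[of k] unital_mat_hom_one[OF f] by simp
  moreover have "f (mat_unit k i j) * f (mat_unit k l m) = (if j = l then f (mat_unit k i m) else 0)"
    if "i < k" "j < k" "l < k" "m < k" for i j l m
    using mat_unit_mult[OF that] fD(2)[OF mat_unit_carrier mat_unit_carrier, symmetric] unital_mat_hom_zero[OF f] by auto
  moreover have "star (f (mat_unit k i j)) = f (mat_unit k j i)" for i j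
    using fD(4)[OF mat_unit_carrier] mat_unit_adjoint by metis
  ultimately show ?thesis by (simp add: matrix_units_def)
qed

lemma unital_mat_hom_sandwich:
  assumes f: "unital_mat_hom k f" and X: "X \<in> carrier_mat k k" "i < k" "j < k"
  shows "f (mat_unit k i i) * f X * f (mat_unit k j j) = scaleC (X $$ (i, j)) (f (mat_unit k i j))"
proof -
  have "f (mat_unit k i i) * f X * f (mat_unit k j j) = f (mat_unit k i i * X * mat_unit k j j)"
    using unital_mat_homD(2)[OF f] X(1) mult_carrier_mat[OF mat_unit_carrier X(1)] by simp
  then show ?thesis unfolding mat_unit_sandwich[OF X] using unital_mat_homD(3)[OF f] by simp
qed

lemma unital_mat_hom_expand:
  assumes f: "unital_mat_hom k f" and X: "X \<in> carrier_mat k k"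
  shows "f X = (\<Sum>i<k. \<Sum>j<k. scaleC (X $$ (i, j)) (f (mat_unit k i j)))"
proof -
  have one: "(\<Sum>i<k. f (mat_unit k i i)) = 1"
    using unital_mat_hom_matrix_units[OF f] by (simp add: matrix_units_def)
  have "f X = (\<Sum>i<k. f (mat_unit k i i)) * f X * (\<Sum>j<k. f (mat_unit k j j))" by (simp add: one)
  also have "\<dots> = (\<Sum>i<k. \<Sum>j<k. f (mat_unit k i i) * f X * f (mat_unit k j j))"
    unfolding sum_distrib_right by (simp only: sum_distrib_left)
  finally show ?thesis using unital_mat_hom_sandwich[OF f X] by simp
qed

lemma unital_mat_hom_of_matrix_units:
  assumes e: "matrix_units 1 k e"
  shows "unital_mat_hom k (\<lambda>X. \<Sum>i<k. \<Sum>j<k. scaleC (X $$ (i, j)) (e i j))"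
  unfolding unital_mat_hom_iff
proof (intro conjI ballI allI)
  fix X Y :: "complex mat" assume XY: "X \<in> carrier_mat k k" "Y \<in> carrier_mat k k"
  show "(\<Sum>i<k. \<Sum>j<k. scaleC ((X + Y) $$ (i, j)) (e i j)) =
      (\<Sum>i<k. \<Sum>j<k. scaleC (X $$ (i, j)) (e i j)) + (\<Sum>i<k. \<Sum>j<k. scaleC (Y $$ (i, j)) (e i j))"
    using XY by (simp add: scaleC_add_left sum.distrib)
  have "(\<Sum>i<k. \<Sum>j<k. scaleC (X $$ (i, j)) (e i j)) * (\<Sum>i<k. \<Sum>j<k. scaleC (Y $$ (i, j)) (e i j)) =
      (\<Sum>i<k. \<Sum>j<k. \<Sum>l<k. \<Sum>m<k. scaleC (X $$ (i, j) * Y $$ (l, m)) (e i j * e l m))"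
    unfolding sum_distrib_right unfolding sum_distrib_left
    by (simp add: scaleC_mult_left scaleC_mult_right scaleC_scaleC mult.commute)
  also have "\<dots> = (\<Sum>i<k. \<Sum>j<k. \<Sum>m<k. scaleC (X $$ (i, j) * Y $$ (j, m)) (e i m))"
  proof (rule sum.cong[OF refl], rule sum.cong[OF refl])
    fix i j assume ij: "i \<in> {..<k}" "j \<in> {..<k}"
    have "(\<Sum>l<k. \<Sum>m<k. scaleC (X $$ (i, j) * Y $$ (l, m)) (e i j * e l m)) =
        (\<Sum>l<k. if l = j then \<Sum>m<k. scaleC (X $$ (i, j) * Y $$ (j, m)) (e i m) else 0)"
      using matrix_unitsD(1)[OF e] ij by (intro sum.cong) auto
    then show "(\<Sum>l<k. \<Sum>m<k. scaleC (X $$ (i, j) * Y $$ (l, m)) (e i j * e l m)) =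
        (\<Sum>m<k. scaleC (X $$ (i, j) * Y $$ (j, m)) (e i m))" using ij by simp
  qed
  also have "\<dots> = (\<Sum>i<k. \<Sum>m<k. \<Sum>j<k. scaleC (X $$ (i, j) * Y $$ (j, m)) (e i m))"
    by (rule sum.cong[OF refl], rule sum.swap)
  also have "\<dots> = (\<Sum>i<k. \<Sum>m<k. scaleC ((X * Y) $$ (i, m)) (e i m))"
    using mult_mat_index[OF XY] by (simp add: complex_vector.scale_sum_left)
  finally show "(\<Sum>i<k. \<Sum>j<k. scaleC ((X * Y) $$ (i, j)) (e i j)) =
      (\<Sum>i<k. \<Sum>j<k. scaleC (X $$ (i, j)) (e i j)) * (\<Sum>i<k. \<Sum>j<k. scaleC (Y $$ (i, j)) (e i j))" by simp
next
  fix X :: "complex mat" and c assume X: "X \<in> carrier_mat k k"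
  then show "(\<Sum>i<k. \<Sum>j<k. scaleC ((c \<cdot>\<^sub>m X) $$ (i, j)) (e i j)) = scaleC c (\<Sum>i<k. \<Sum>j<k. scaleC (X $$ (i, j)) (e i j))"
    by (simp add: complex_vector.scale_sum_right scaleC_scaleC)
next
  fix X :: "complex mat" assume X: "X \<in> carrier_mat k k"
  have "star (\<Sum>i<k. \<Sum>j<k. scaleC (X $$ (i, j)) (e i j)) = (\<Sum>i<k. \<Sum>j<k. scaleC (cnj (X $$ (i, j))) (e j i))"
    using matrix_unitsD(2)[OF e] by (simp add: star_sum star_scaleC)
  also have "\<dots> = (\<Sum>i<k. \<Sum>j<k. scaleC (cnj (X $$ (j, i))) (e i j))" by (rule sum.swap)
  finally show "(\<Sum>i<k. \<Sum>j<k. scaleC (mat_adjoint X $$ (i, j)) (e i j)) = star (\<Sum>i<k. \<Sum>j<k. scaleC (X $$ (i, j)) (e i j))"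
    using X by simp
next
  have "(\<Sum>i<k. \<Sum>j<k. scaleC (1\<^sub>m k $$ (i, j)) (e i j)) = (\<Sum>i<k. \<Sum>j<k. if j = i then e i i else 0)"
    by (intro sum.cong refl) (auto simp: scaleC_one)
  also have "\<dots> = 1" using e by (simp add: matrix_units_def)
  finally show "(\<Sum>i<k. \<Sum>j<k. scaleC (1\<^sub>m k $$ (i, j)) (e i j)) = 1" .
qed

section \<open>The operator norm\<close>

lemma l2_norm_vec_L2_set: "l2_norm_vec v = L2_set (\<lambda>i. cmod (v $ i)) {..<dim_vec v}"
  by (simp add: l2_norm_vec_def L2_set_def)

lemma l2_norm_vec_nonneg [simp]: "0 \<le> l2_norm_vec v"
  by (simp add: l2_norm_vec_L2_set)

lemma mult_mat_vec_index:
  assumes "A \<in> carrier_mat k k" "v \<in> carrier_vec k" "i < k"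
  shows "(A *\<^sub>v v) $ i = (\<Sum>j<k. A $$ (i, j) * v $ j)"
  using assms by (simp add: scalar_prod_def atLeast0LessThan)

lemma l2_norm_mult_le_entries:
  assumes A: "A \<in> carrier_mat k k" and v: "v \<in> carrier_vec k"
  shows "l2_norm_vec (A *\<^sub>v v) \<le> (\<Sum>i<k. \<Sum>j<k. cmod (A $$ (i, j))) * l2_norm_vec v"
proof -
  have "l2_norm_vec (A *\<^sub>v v) \<le> (\<Sum>i<k. cmod ((A *\<^sub>v v) $ i))"
    unfolding l2_norm_vec_L2_set using A by (simp add: L2_set_le_sum del: index_mult_mat_vec)
  also have "\<dots> \<le> (\<Sum>i<k. \<Sum>j<k. cmod (A $$ (i, j)) * l2_norm_vec v)"
  proof (rule sum_mono)
    fix i assume i: "i \<in> {..<k}"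
    have "cmod ((A *\<^sub>v v) $ i) \<le> (\<Sum>j<k. cmod (A $$ (i, j)) * cmod (v $ j))"
      using mult_mat_vec_index[OF A v] i norm_sum[of "\<lambda>j. A $$ (i, j) * v $ j" "{..<k}"] by (simp add: norm_mult)
    also have "\<dots> \<le> (\<Sum>j<k. cmod (A $$ (i, j)) * l2_norm_vec v)"
      using v by (intro sum_mono mult_left_mono) (auto simp: l2_norm_vec_L2_set intro!: member_le_L2_set)
    finally show "cmod ((A *\<^sub>v v) $ i) \<le> (\<Sum>j<k. cmod (A $$ (i, j)) * l2_norm_vec v)" .
  qed
  finally show ?thesis by (simp add: sum_distrib_right)
qed

lemma op_norm_bdd:
  assumes A: "A \<in> carrier_mat k k"
  shows "bdd_above {l2_norm_vec (A *\<^sub>v v) | v. v \<in> carrier_vec (dim_col A) \<and> l2_norm_vec v \<le> 1}"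
proof (rule bdd_aboveI)
  fix x assume "x \<in> {l2_norm_vec (A *\<^sub>v v) | v. v \<in> carrier_vec (dim_col A) \<and> l2_norm_vec v \<le> 1}"
  then obtain v where v: "v \<in> carrier_vec k" "l2_norm_vec v \<le> 1" "x = l2_norm_vec (A *\<^sub>v v)" using A by auto
  have "x \<le> (\<Sum>i<k. \<Sum>j<k. cmod (A $$ (i, j))) * l2_norm_vec v"
    using l2_norm_mult_le_entries[OF A v(1)] v(3) by simp
  also have "\<dots> \<le> (\<Sum>i<k. \<Sum>j<k. cmod (A $$ (i, j))) * 1"
    using v by (intro mult_left_mono sum_nonneg) auto
  finally show "x \<le> (\<Sum>i<k. \<Sum>j<k. cmod (A $$ (i, j)))" by simp
qed

lemma l2_norm_mult_le_op_norm1: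
  assumes A: "A \<in> carrier_mat k k" and v: "v \<in> carrier_vec k" "l2_norm_vec v \<le> 1"
  shows "l2_norm_vec (A *\<^sub>v v) \<le> op_norm_mat A"
  unfolding op_norm_mat_def using A v by (intro cSup_upper[OF _ op_norm_bdd[OF A]]) auto

lemma op_norm_leI:
  assumes A: "A \<in> carrier_mat k k"
    and "\<And>v. v \<in> carrier_vec k \<Longrightarrow> l2_norm_vec v \<le> 1 \<Longrightarrow> l2_norm_vec (A *\<^sub>v v) \<le> c"
  shows "op_norm_mat A \<le> c"
  unfolding op_norm_mat_def
proof (rule cSup_least)
  have "l2_norm_vec (0\<^sub>v k) \<le> 1" by (simp add: l2_norm_vec_def)
  then show "{l2_norm_vec (A *\<^sub>v v) | v. v \<in> carrier_vec (dim_col A) \<and> l2_norm_vec v \<le> 1} \<noteq> {}"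
    using A by (auto intro!: exI[of _ "0\<^sub>v k"])
qed (use assms in auto)

lemma op_norm_nonneg:
  assumes A: "A \<in> carrier_mat k k"
  shows "0 \<le> op_norm_mat A"
proof -
  have "l2_norm_vec (A *\<^sub>v 0\<^sub>v k) \<le> op_norm_mat A"
    by (rule l2_norm_mult_le_op_norm1[OF A]) (simp_all add: l2_norm_vec_def)
  then show ?thesis using l2_norm_vec_nonneg order_trans by blast
qed

lemma l2_norm_vec_smult: "l2_norm_vec (c \<cdot>\<^sub>v v) = cmod c * l2_norm_vec v"
proof -
  have "l2_norm_vec (c \<cdot>\<^sub>v v) = sqrt ((cmod c)\<^sup>2 * (\<Sum>i<dim_vec v. (cmod (v $ i))\<^sup>2))"
    by (simp add: l2_norm_vec_def norm_mult power_mult_distrib sum_distrib_left)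
  then show ?thesis by (simp add: real_sqrt_mult l2_norm_vec_def)
qed

lemma l2_norm_mult_le_op_norm:
  assumes A: "A \<in> carrier_mat k k" and v: "v \<in> carrier_vec k"
  shows "l2_norm_vec (A *\<^sub>v v) \<le> op_norm_mat A * l2_norm_vec v"
proof (cases "l2_norm_vec v = 0")
  case True
  then show ?thesis using l2_norm_mult_le_entries[OF A v] by simp
next
  case False
  define r where "r = l2_norm_vec v"
  have r: "r > 0" using False by (simp add: r_def less_le)
  define w where "w = complex_of_real (1 / r) \<cdot>\<^sub>v v"
  have w: "w \<in> carrier_vec k" "l2_norm_vec w \<le> 1"
    unfolding w_def l2_norm_vec_smult using v r by (auto simp: r_def[symmetric] norm_divide)
  have "A *\<^sub>v w = complex_of_real (1 / r) \<cdot>\<^sub>v (A *\<^sub>v v)"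
    unfolding w_def using A v by (rule mult_mat_vec)
  then have "1 / r * l2_norm_vec (A *\<^sub>v v) \<le> op_norm_mat A"
    using l2_norm_mult_le_op_norm1[OF A w] r by (simp add: l2_norm_vec_smult norm_divide)
  then show ?thesis using r by (simp add: r_def[symmetric] field_simps)
qed

lemma op_norm_entry_le:
  assumes A: "A \<in> carrier_mat k k" and ij: "i < k" "j < k"
  shows "cmod (A $$ (i, j)) \<le> op_norm_mat A"
proof -
  have u: "unit_vec k j \<in> carrier_vec k" by simp
  have "(\<Sum>l<k. (cmod (unit_vec k j $ l))\<^sup>2) = (\<Sum>l<k. if l = j then 1 else 0)"
    using ij by (intro sum.cong) (auto simp: unit_vec_def)
  then have "l2_norm_vec (unit_vec k j) \<le> 1" using ij by (simp add: l2_norm_vec_def)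
  then have "l2_norm_vec (A *\<^sub>v unit_vec k j) \<le> op_norm_mat A" by (rule l2_norm_mult_le_op_norm1[OF A u])
  moreover have "(A *\<^sub>v unit_vec k j) $ i = A $$ (i, j)"
  proof -
    have "(\<Sum>l<k. A $$ (i, l) * unit_vec k j $ l) = (\<Sum>l<k. if l = j then A $$ (i, j) else 0)"
      using ij by (intro sum.cong) (auto simp: unit_vec_def)
    then show ?thesis using mult_mat_vec_index[OF A u ij(1)] ij by simp
  qed
  moreover have "cmod ((A *\<^sub>v unit_vec k j) $ i) \<le> l2_norm_vec (A *\<^sub>v unit_vec k j)"
    unfolding l2_norm_vec_L2_set using A ij by (intro member_le_L2_set[where f = "\<lambda>i. cmod ((A *\<^sub>v unit_vec k j) $ i)"]) auto
  ultimately show ?thesis by simp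
qed

lemma op_norm_le_entries:
  assumes A: "A \<in> carrier_mat k k"
  shows "op_norm_mat A \<le> (\<Sum>i<k. \<Sum>j<k. cmod (A $$ (i, j)))"
proof (rule op_norm_leI[OF A])
  fix v assume v: "v \<in> carrier_vec k" "l2_norm_vec v \<le> 1"
  have "l2_norm_vec (A *\<^sub>v v) \<le> (\<Sum>i<k. \<Sum>j<k. cmod (A $$ (i, j))) * l2_norm_vec v"
    by (rule l2_norm_mult_le_entries[OF A v(1)])
  also have "\<dots> \<le> (\<Sum>i<k. \<Sum>j<k. cmod (A $$ (i, j))) * 1"
    using v by (intro mult_left_mono sum_nonneg) auto
  finally show "l2_norm_vec (A *\<^sub>v v) \<le> (\<Sum>i<k. \<Sum>j<k. cmod (A $$ (i, j)))" by simp
qed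

lemma l2_norm_mult_square_le:
  assumes A: "A \<in> carrier_mat k k" and v: "v \<in> carrier_vec k"
  shows "(l2_norm_vec (A *\<^sub>v v))\<^sup>2 \<le> l2_norm_vec v * l2_norm_vec ((mat_adjoint A * A) *\<^sub>v v)"
proof -
  define w where "w = A *\<^sub>v v"
  have w: "w \<in> carrier_vec k" using A v by (simp add: w_def)
  define z where "z = mat_adjoint A *\<^sub>v w"
  have z: "z \<in> carrier_vec k" using mat_adjoint_carrier[OF A] by (simp add: z_def carrier_vecI)
  have "(mat_adjoint A * A) *\<^sub>v v = z"
    unfolding z_def w_def by (rule assoc_mult_mat_vec[OF mat_adjoint_carrier[OF A] A v])
  have "(l2_norm_vec w)\<^sup>2 = (\<Sum>i<k. (cmod (w $ i))\<^sup>2)"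
    using w by (simp add: l2_norm_vec_def sum_nonneg)
  then have "complex_of_real ((l2_norm_vec w)\<^sup>2) = (\<Sum>i<k. cnj (w $ i) * w $ i)"
    by (simp only: of_real_sum complex_norm_square mult.commute)
  also have "\<dots> = (\<Sum>i<k. \<Sum>j<k. cnj (A $$ (i, j)) * cnj (v $ j) * w $ i)"
  proof (rule sum.cong[OF refl])
    fix i assume "i \<in> {..<k}"
    then have "cnj (w $ i) = (\<Sum>j<k. cnj (A $$ (i, j)) * cnj (v $ j))"
      unfolding w_def by (subst mult_mat_vec_index[OF A v]) auto
    then show "cnj (w $ i) * w $ i = (\<Sum>j<k. cnj (A $$ (i, j)) * cnj (v $ j) * w $ i)"
      by (simp add: sum_distrib_right)
  qed
  also have "\<dots> = (\<Sum>j<k. \<Sum>i<k. cnj (A $$ (i, j)) * cnj (v $ j) * w $ i)" by (rule sum.swap)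
  also have "\<dots> = (\<Sum>j<k. cnj (v $ j) * z $ j)"
    unfolding z_def using mult_mat_vec_index[OF mat_adjoint_carrier[OF A] w] A
    by (intro sum.cong) (auto simp: sum_distrib_left mult_ac)
  finally have "(l2_norm_vec w)\<^sup>2 = cmod (\<Sum>j<k. cnj (v $ j) * z $ j)"
    by (metis norm_of_real abs_of_nonneg zero_le_power2)
  also have "\<dots> \<le> (\<Sum>j<k. \<bar>cmod (v $ j)\<bar> * \<bar>cmod (z $ j)\<bar>)"
    using norm_sum[of "\<lambda>j. cnj (v $ j) * z $ j" "{..<k}"] by (simp add: norm_mult)
  also have "\<dots> \<le> l2_norm_vec v * l2_norm_vec z"
    using L2_set_mult_ineq[of "\<lambda>j. cmod (v $ j)" "\<lambda>j. cmod (z $ j)" "{..<k}"] v z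
    by (simp add: l2_norm_vec_L2_set)
  finally show ?thesis using \<open>(mat_adjoint A * A) *\<^sub>v v = z\<close> by (simp add: w_def)
qed

lemma mat_adjoint_adjoint:
  assumes A: "(A :: complex mat) \<in> carrier_mat k k"
  shows "mat_adjoint (mat_adjoint A) = A"
  using A by (intro eq_matI) (simp_all add: mat_adjoint_index[OF mat_adjoint_carrier[OF A]]
      mat_adjoint_dim[OF mat_adjoint_carrier[OF A]])

lemma op_norm_adjoint_le:
  assumes A: "A \<in> carrier_mat k k"
  shows "op_norm_mat (mat_adjoint A) \<le> op_norm_mat A"
proof (rule op_norm_leI[OF mat_adjoint_carrier[OF A]])
  fix v assume v: "v \<in> carrier_vec k" "l2_norm_vec v \<le> 1"
  let ?x = "l2_norm_vec (mat_adjoint A *\<^sub>v v)"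
  have w: "mat_adjoint A *\<^sub>v v \<in> carrier_vec k" using mat_adjoint_carrier[OF A] v by simp
  have "?x\<^sup>2 \<le> l2_norm_vec v * l2_norm_vec ((A * mat_adjoint A) *\<^sub>v v)"
    using l2_norm_mult_square_le[OF mat_adjoint_carrier[OF A] v(1)] mat_adjoint_adjoint[OF A] by simp
  also have "(A * mat_adjoint A) *\<^sub>v v = A *\<^sub>v (mat_adjoint A *\<^sub>v v)"
    by (rule assoc_mult_mat_vec[OF A mat_adjoint_carrier[OF A] v(1)])
  also have "l2_norm_vec v * l2_norm_vec \<dots> \<le> 1 * (op_norm_mat A * ?x)"
    using v l2_norm_mult_le_op_norm[OF A w] by (intro mult_mono) auto
  finally have "?x * ?x \<le> op_norm_mat A * ?x" by (simp add: power2_eq_square)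
  then show "?x \<le> op_norm_mat A"
    using op_norm_nonneg[OF A] by (cases "?x = 0") (auto simp: mult_le_cancel_right)
qed

lemma op_norm_cstar_identity:
  assumes A: "A \<in> carrier_mat k k"
  shows "op_norm_mat (mat_adjoint A * A) = (op_norm_mat A)\<^sup>2"
proof (rule antisym)
  have AA: "mat_adjoint A * A \<in> carrier_mat k k" using mult_carrier_mat[OF mat_adjoint_carrier[OF A] A] .
  show "op_norm_mat (mat_adjoint A * A) \<le> (op_norm_mat A)\<^sup>2"
  proof (rule op_norm_leI[OF AA])
    fix v assume v: "v \<in> carrier_vec k" "l2_norm_vec v \<le> 1"
    have "l2_norm_vec (mat_adjoint A * A *\<^sub>v v) = l2_norm_vec (mat_adjoint A *\<^sub>v (A *\<^sub>v v))"
      using assoc_mult_mat_vec[OF mat_adjoint_carrier[OF A] A v(1)] by simp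
    also have "\<dots> \<le> op_norm_mat (mat_adjoint A) * l2_norm_vec (A *\<^sub>v v)"
      by (rule l2_norm_mult_le_op_norm[OF mat_adjoint_carrier[OF A]]) (use A v in simp)
    also have "\<dots> \<le> op_norm_mat A * op_norm_mat A"
      using op_norm_adjoint_le[OF A] l2_norm_mult_le_op_norm1[OF A v] op_norm_nonneg[OF A]
      by (intro mult_mono) auto
    finally show "l2_norm_vec (mat_adjoint A * A *\<^sub>v v) \<le> (op_norm_mat A)\<^sup>2" by (simp add: power2_eq_square)
  qed
  have "op_norm_mat A \<le> sqrt (op_norm_mat (mat_adjoint A * A))"
  proof (rule op_norm_leI[OF A])
    fix v assume v: "v \<in> carrier_vec k" "l2_norm_vec v \<le> 1"
    have "(l2_norm_vec (A *\<^sub>v v))\<^sup>2 \<le> l2_norm_vec v * l2_norm_vec ((mat_adjoint A * A) *\<^sub>v v)"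
      by (rule l2_norm_mult_square_le[OF A v(1)])
    also have "\<dots> \<le> 1 * op_norm_mat (mat_adjoint A * A)"
      using v l2_norm_mult_le_op_norm1[OF AA v] by (intro mult_mono) auto
    finally show "l2_norm_vec (A *\<^sub>v v) \<le> sqrt (op_norm_mat (mat_adjoint A * A))"
      by (simp add: real_le_rsqrt)
  qed
  then have "(op_norm_mat A)\<^sup>2 \<le> (sqrt (op_norm_mat (mat_adjoint A * A)))\<^sup>2"
    using op_norm_nonneg[OF A] by (intro power_mono)
  then show "(op_norm_mat A)\<^sup>2 \<le> op_norm_mat (mat_adjoint A * A)" using op_norm_nonneg[OF AA] by simp
qed

lemma le_if_iterated_squares_le:
  fixes a b C :: real
  assumes "0 \<le> a" "0 \<le> b" and le: "\<And>n. a ^ (2 ^ n) \<le> C * b ^ (2 ^ n)"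
  shows "a \<le> b"
proof (rule ccontr)
  assume "\<not> a \<le> b"
  then have ab: "b < a" by simp
  show False
  proof (cases "b = 0")
    case True
    then show False using le[of 0] ab by simp
  next
    case False
    then have b: "b > 0" using assms by simp
    then have "1 < a / b" using ab by simp
    then obtain n where n: "C < (a / b) ^ n" using real_arch_pow by blast
    have "(a / b) ^ n \<le> (a / b) ^ (2 ^ n)" using \<open>1 < a / b\<close> by (intro power_increasing) auto
    also have "\<dots> \<le> C" using le[of n] b by (simp add: power_divide field_simps)
    finally show False using n by simp
  qed
qed

text \<open>
  A unital homomorphism is isometric: \<open>norm \<circ> f\<close> and the operator norm are equivalent, and both
  satisfy the C*-identity, so that the constants disappear under iterated squaring.
\<close>

theorem unital_mat_hom_isometric:
  assumes f: "unital_mat_hom k f" and X: "X \<in> carrier_mat k k"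
  shows "norm (f X) = op_norm_mat X"
proof -
  let ?C = "real k * real k"
  have mu: "matrix_units 1 k (\<lambda>i j. f (mat_unit k i j))" by (rule unital_mat_hom_matrix_units[OF f])
  note me = matrix_unitsD[OF mu]
  have k: "0 < k" using mu by (cases k) (auto simp: matrix_units_def)
  have unit0: "f (mat_unit k i j) \<noteq> 0" if ij: "i < k" "j < k" for i j
  proof
    assume z: "f (mat_unit k i j) = 0"
    have "f (mat_unit k l l) = f (mat_unit k l i) * f (mat_unit k i j) * f (mat_unit k j l)" if "l < k" for l
      using me(1)[of l i i j] me(1)[of l j j l] ij that by simp
    then have "(\<Sum>l<k. f (mat_unit k l l)) = 0" using z by (intro sum.neutral) auto
    then show False using mu by (simp add: matrix_units_def)
  qed
  have unit1: "norm (f (mat_unit k i j)) = 1" if ij: "i < k" "j < k" for i j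
  proof -
    have "(norm (f (mat_unit k i j)))\<^sup>2 = norm (f (mat_unit k j j))"
      using cstar_identity[of "f (mat_unit k i j)"] me(1,2) ij by simp
    also have "\<dots> = 1" using projection_norm[OF me(5)[OF ij(2) ij(2)]] unit0 ij by simp
    finally show ?thesis using power2_eq_1_iff[of "norm (f (mat_unit k i j))"] norm_ge_zero by (metis neg_0_le_iff_le not_one_le_zero)
  qed
  have up: "norm (f Y) \<le> ?C * op_norm_mat Y" if Y: "Y \<in> carrier_mat k k" for Y
  proof -
    have "norm (f Y) \<le> (\<Sum>i<k. \<Sum>j<k. norm (scaleC (Y $$ (i, j)) (f (mat_unit k i j))))"
      unfolding unital_mat_hom_expand[OF f Y]
      by (rule order_trans[OF norm_sum]) (intro sum_mono norm_sum)
    also have "\<dots> \<le> (\<Sum>i<k. \<Sum>j<k. op_norm_mat Y)"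
      using op_norm_entry_le[OF Y] unit1 by (intro sum_mono) (simp add: norm_scaleC)
    finally show ?thesis by simp
  qed
  have down: "op_norm_mat Y \<le> ?C * norm (f Y)" if Y: "Y \<in> carrier_mat k k" for Y
  proof -
    have "cmod (Y $$ (i, j)) \<le> norm (f Y)" if ij: "i < k" "j < k" for i j
    proof -
      have "cmod (Y $$ (i, j)) = norm (f (mat_unit k i i) * f Y * f (mat_unit k j j))"
        unfolding unital_mat_hom_sandwich[OF f Y ij] using unit1[OF ij] by (simp add: norm_scaleC)
      also have "\<dots> \<le> norm (f (mat_unit k i i)) * norm (f Y) * norm (f (mat_unit k j j))"
        by (meson norm_mult_ineq mult_right_mono norm_ge_zero order_trans)
      finally show ?thesis using unit1 ij by simp
    qed
    then have "(\<Sum>i<k. \<Sum>j<k. cmod (Y $$ (i, j))) \<le> (\<Sum>i<k. \<Sum>j<k. norm (f Y))"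
      by (intro sum_mono) auto
    then show ?thesis using op_norm_le_entries[OF Y] by simp
  qed
  define Y where "Y n = ((\<lambda>Z. mat_adjoint Z * Z) ^^ n) X" for n
  have Y0: "Y 0 = X" and YS: "Y (Suc n) = mat_adjoint (Y n) * Y n" for n by (simp_all add: Y_def)
  have Y: "Y n \<in> carrier_mat k k" for n
    by (induction n) (auto simp: Y0 YS X intro!: mult_carrier_mat)
  have nY: "norm (f (Y n)) = norm (f X) ^ (2 ^ n)" for n
  proof (induction n)
    case (Suc n)
    have "f (Y (Suc n)) = star (f (Y n)) * f (Y n)"
      unfolding YS using unital_mat_homD(2)[OF f mat_adjoint_carrier[OF Y] Y] unital_mat_homD(4)[OF f Y] by simp
    then have "norm (f (Y (Suc n))) = (norm (f (Y n)))\<^sup>2" by (simp add: cstar_identity)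
    then show ?case using Suc by (simp add: power_mult[symmetric] mult.commute)
  qed (simp add: Y0)
  have oY: "op_norm_mat (Y n) = op_norm_mat X ^ (2 ^ n)" for n
  proof (induction n)
    case (Suc n)
    have "op_norm_mat (Y (Suc n)) = (op_norm_mat (Y n))\<^sup>2" unfolding YS by (rule op_norm_cstar_identity[OF Y])
    then show ?case using Suc by (simp add: power_mult[symmetric] mult.commute)
  qed (simp add: Y0)
  show ?thesis
  proof (rule antisym)
    show "norm (f X) \<le> op_norm_mat X"
      by (rule le_if_iterated_squares_le[where C = ?C])
        (use up[OF Y] nY oY op_norm_nonneg[OF X] in auto)
    show "op_norm_mat X \<le> norm (f X)"
      by (rule le_if_iterated_squares_le[where C = ?C])
        (use down[OF Y] nY oY op_norm_nonneg[OF X] in auto)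
  qed
qed

section \<open>Coherent systems of homomorphisms\<close>

text \<open>The embedding \<open>X \<mapsto> X \<otimes> 1\<close> of the \<open>d \<times> d\<close> matrices into the \<open>d r \<times> d r\<close> matrices.\<close>

definition amplify :: "nat \<Rightarrow> nat \<Rightarrow> complex mat \<Rightarrow> complex mat" where
  "amplify d r X = mat (d * r) (d * r) (\<lambda>(a, b). if a mod r = b mod r then X $$ (a div r, b div r) else 0)"

lemma amplify_carrier [simp]: "amplify d r X \<in> carrier_mat (d * r) (d * r)"
  by (simp add: amplify_def)

lemma amplify_index [simp]: "a < d * r \<Longrightarrow> b < d * r \<Longrightarrow>
    amplify d r X $$ (a, b) = (if a mod r = b mod r then X $$ (a div r, b div r) else 0)"
  by (simp add: amplify_def)

lemma amplify_dim [simp]: "dim_row (amplify d r X) = d * r" "dim_col (amplify d r X) = d * r"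
  by (simp_all add: amplify_def)

lemma amplify_unital_star_hom:
  assumes r: "0 < r"
  shows "unital_star_hom (matrix_cstar d) (matrix_cstar (d * r)) (amplify d r)"
proof -
  have dv: "a div r < d" if "a < d * r" for a using that by (simp add: less_mult_imp_div_less)
  have "amplify d r (X * Y) = amplify d r X * amplify d r Y"
    if XY: "X \<in> carrier_mat d d" "Y \<in> carrier_mat d d" for X Y
  proof (rule eq_matI)
    fix a b assume "a < dim_row (amplify d r X * amplify d r Y)" "b < dim_col (amplify d r X * amplify d r Y)"
    then have ab: "a < d * r" "b < d * r" by auto
    have "(amplify d r X * amplify d r Y) $$ (a, b) =
        (\<Sum>c<d * r. if c mod r = a mod r then if a mod r = b mod r then X $$ (a div r, c div r) * Y $$ (c div r, b div r) else 0 else 0)"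
      unfolding mult_mat_index[OF amplify_carrier amplify_carrier ab] using ab by (intro sum.cong) auto
    also have "\<dots> = (\<Sum>c\<in>{c \<in> {..<d * r}. c mod r = a mod r}. if a mod r = b mod r then X $$ (a div r, c div r) * Y $$ (c div r, b div r) else 0)"
      by (rule sum.inter_filter[symmetric]) simp
    also have "\<dots> = (\<Sum>t<d. if a mod r = b mod r then X $$ (a div r, t) * Y $$ (t, b div r) else 0)"
    proof (rule sum.reindex_bij_witness[of _ "\<lambda>t. t * r + a mod r" "\<lambda>c. c div r"])
      fix t assume t: "t \<in> {..<d}"
      have "t * r + a mod r < (t + 1) * r" using r by simp
      also have "\<dots> \<le> d * r" using t by (intro mult_le_mono1) auto
      finally show "t * r + a mod r \<in> {c \<in> {..<d * r}. c mod r = a mod r}" by simp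
    next
      fix c assume "c \<in> {c \<in> {..<d * r}. c mod r = a mod r}"
      then show "c div r * r + a mod r = c" by (metis (mono_tags, lifting) div_mult_mod_eq mem_Collect_eq)
    qed (use r dv in auto)
    also have "\<dots> = (if a mod r = b mod r then (X * Y) $$ (a div r, b div r) else 0)"
      using mult_mat_index[OF XY dv[OF ab(1)] dv[OF ab(2)]] by simp
    finally show "amplify d r (X * Y) $$ (a, b) = (amplify d r X * amplify d r Y) $$ (a, b)"
      using ab by simp
  qed auto
  moreover have "amplify d r (1\<^sub>m d) = 1\<^sub>m (d * r)"
  proof (rule eq_matI)
    fix a b assume "a < dim_row (1\<^sub>m (d * r))" "b < dim_col (1\<^sub>m (d * r))"
    then have ab: "a < d * r" "b < d * r" by auto
    have "a = b \<longleftrightarrow> a mod r = b mod r \<and> a div r = b div r" by (metis div_mult_mod_eq)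
    then show "amplify d r (1\<^sub>m d) $$ (a, b) = 1\<^sub>m (d * r) $$ (a, b)"
      using ab dv[OF ab(1)] dv[OF ab(2)] by auto
  qed auto
  moreover have "amplify d r (X + Y) = amplify d r X + amplify d r Y"
    if XY: "X \<in> carrier_mat d d" "Y \<in> carrier_mat d d" for X Y
    using XY dv by (intro eq_matI) auto
  moreover have "amplify d r (c \<cdot>\<^sub>m X) = c \<cdot>\<^sub>m amplify d r X" if "X \<in> carrier_mat d d" for X c
    using that dv by (intro eq_matI) auto
  moreover have "amplify d r (mat_adjoint X) = mat_adjoint (amplify d r X)" if "X \<in> carrier_mat d d" for X
    using that dv
    by (intro eq_matI) (auto simp: mat_adjoint_index[OF amplify_carrier] mat_adjoint_dim[OF amplify_carrier])
  ultimately show ?thesis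
    unfolding unital_star_hom_matrix_iff is_unit_of_matrix_cstar by (simp add: star_hom_def)
qed

text \<open>Unital *-homomorphisms from the \<open>k \<times> k\<close> matrices with range in \<open>B\<close>.\<close>

definition hom_into :: "'a::cstar_algebra set \<Rightarrow> nat \<Rightarrow> (complex mat \<Rightarrow> 'a) \<Rightarrow> bool" where
  "hom_into B k f \<longleftrightarrow> unital_mat_hom k f \<and> (\<forall>X\<in>carrier_mat k k. f X \<in> B)"

lemma hom_into_matrix_units:
  assumes "hom_into B k f"
  shows "matrix_units 1 k (\<lambda>i j. f (mat_unit k i j))" "f (mat_unit k i j) \<in> B"
  using assms unital_mat_hom_matrix_units by (auto simp: hom_into_def)

lemma hom_into_comp:
  assumes "hom_into B k f" "unital_star_hom (matrix_cstar l) (matrix_cstar k) g"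
  shows "hom_into B l (f \<circ> g)"
  using assms unital_mat_hom_comp
  by (auto simp: hom_into_def unital_star_hom_matrix_iff star_hom_def)

context fd_subalgebra
begin

lemma hom_into_of_matrix_units:
  assumes "matrix_units 1 k e" "\<And>i j. i < k \<Longrightarrow> j < k \<Longrightarrow> e i j \<in> B"
  shows "hom_into B k (\<lambda>X. \<Sum>i<k. \<Sum>j<k. scaleC (X $$ (i, j)) (e i j))"
  unfolding hom_into_def using unital_mat_hom_of_matrix_units assms
  by (auto intro!: sum_closed scale_closed)

lemma hom_into_conjugate:
  assumes f: "hom_into B k f" and g: "hom_into B k g"
  shows "\<exists>u\<in>B. unitary_element u \<and> (\<forall>X\<in>carrier_mat k k. g X = u * f X * star u)"
proof -
  have fh: "unital_mat_hom k f" and gh: "unital_mat_hom k g" using f g by (auto simp: hom_into_def)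
  obtain u where u: "u \<in> B" "unitary_element u"
    "\<forall>i<k. \<forall>j<k. g (mat_unit k i j) = u * f (mat_unit k i j) * star u"
    using matrix_units_conjugate[OF hom_into_matrix_units[OF f] hom_into_matrix_units[OF g]] by blast
  have "g X = u * f X * star u" if X: "X \<in> carrier_mat k k" for X
    unfolding unital_mat_hom_expand[OF fh X] unital_mat_hom_expand[OF gh X] using u(3)
    by (simp add: sum_distrib_left sum_distrib_right scaleC_mult_left scaleC_mult_right)
  then show ?thesis using u by blast
qed

lemma hom_into_conj:
  assumes f: "hom_into B k f" and u: "u \<in> B" "unitary_element u"
  shows "hom_into B k (\<lambda>X. u * f X * star u)"
proof -
  have fh: "unital_mat_hom k f" using f by (auto simp: hom_into_def)
  have "u * f (X * Y) * star u = (u * f X * star u) * (u * f Y * star u)"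
    if "X \<in> carrier_mat k k" "Y \<in> carrier_mat k k" for X Y
    using unital_mat_homD(2)[OF fh] that by (simp only: unitary_conj_mult[OF u(2)])
  moreover have "u * star u = 1" using u(2) by (simp add: unitary_element_def)
  ultimately have "unital_mat_hom k (\<lambda>X. u * f X * star u)"
    unfolding unital_mat_hom_iff
    by (simp add: unital_mat_homD[OF fh] unital_mat_hom_one[OF fh] distrib_left distrib_right
        scaleC_mult_left scaleC_mult_right star_mult star_star mult.assoc[of u "star _" "star u"])
  then show ?thesis using f u by (auto simp: hom_into_def intro!: closed)
qed

end

text \<open>
  If each matrix algebra of an inductive system maps to some member of an increasing sequence of
  finite-dimensional algebras, then the homomorphisms can be chosen compatible with the connecting
  maps: each new homomorphism is corrected by a unitary from a common finite-dimensional algebra.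
\<close>

theorem coherent_homs:
  fixes Bs :: "nat \<Rightarrow> 'a::cstar_algebra set"
  assumes fd: "\<And>n. fd_subalgebra (Bs n)" and inc: "\<And>n. Bs n \<subseteq> Bs (Suc n)"
    and f: "\<And>i. unital_star_hom (matrix_cstar (k i)) (matrix_cstar (k (Suc i))) (f i)"
    and ex: "\<And>i. \<exists>n g. hom_into (Bs n) (k i) g"
  shows "\<exists>F. \<forall>i. (\<exists>n. hom_into (Bs n) (k i) (F i)) \<and>
     (\<forall>X\<in>carrier_mat (k i) (k i). F (Suc i) (f i X) = F i X)"
proof -
  have mono: "Bs m \<subseteq> Bs n" if "m \<le> n" for m n using lift_Suc_mono_le[of Bs m n] inc that by auto
  have "\<exists>F. \<forall>i. (\<exists>n. hom_into (Bs n) (k i) (F i)) \<and>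
     (\<forall>X\<in>carrier_mat (k i) (k i). F (Suc i) (f i X) = F i X)"
  proof (rule dependent_nat_choice)
    show "\<exists>g n. hom_into (Bs n) (k 0) g" using ex[of 0] by blast
    fix g i assume "\<exists>n. hom_into (Bs n) (k i) g"
    then obtain m where m: "hom_into (Bs m) (k i) g" by blast
    obtain n h where n: "hom_into (Bs n) (k (Suc i)) h" using ex[of "Suc i"] by blast
    define N where "N = max m n"
    have g: "hom_into (Bs N) (k i) g" and h: "hom_into (Bs N) (k (Suc i)) h"
      using m n mono[of m N] mono[of n N] by (auto simp: hom_into_def N_def)
    interpret fd_subalgebra "Bs N" by (rule fd)
    obtain u where u: "u \<in> Bs N" "unitary_element u"
      "\<forall>X\<in>carrier_mat (k i) (k i). g X = u * (h \<circ> f i) X * star u"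
      using hom_into_conjugate[OF hom_into_comp[OF h f] g] by blast
    then show "\<exists>h. (\<exists>n. hom_into (Bs n) (k (Suc i)) h) \<and> (\<forall>X\<in>carrier_mat (k i) (k i). h (f i X) = g X)"
      using hom_into_conj[OF h u(1,2)] by (intro exI[of _ "\<lambda>X. u * h X * star u"]) auto
  qed
  then show ?thesis by blast
qed

section \<open>The canonical maps into an inductive limit\<close>

text \<open>The part of the laws of a carrier-based C*-algebra that the canonical maps depend on.\<close>

definition null_laws :: "('b, 'm) cstar_alg_scheme \<Rightarrow> bool" where
  "null_laws X \<longleftrightarrow> calg_zero X \<in> carrier X \<and>
     (\<forall>x\<in>carrier X. \<forall>y\<in>carrier X. calg_add X x y \<in> carrier X) \<and>
     (\<forall>c. \<forall>x\<in>carrier X. calg_scale X c x \<in> carrier X) \<and>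
     (\<forall>x\<in>carrier X. calg_add X x (calg_scale X (- 1) x) = calg_zero X) \<and>
     calg_add X (calg_zero X) (calg_zero X) = calg_zero X \<and>
     calg_mult X (calg_zero X) (calg_zero X) = calg_zero X \<and>
     (\<forall>c. calg_scale X c (calg_zero X) = calg_zero X) \<and>
     calg_star X (calg_zero X) = calg_zero X \<and> calg_norm X (calg_zero X) = 0"

lemma null_laws_cstar_structure:
  assumes "cstar_structure X"
  shows "null_laws X"
proof -
  interpret cstar_structure X by (rule assms)
  have s0: "calg_scale X 0 x = calg_zero X" if "x \<in> carrier X" for x
    using scale_add_left[OF that, of 1 "-1"] add_inverse[OF that] scale_one[OF that] by simp
  have z: "calg_zero X = calg_scale X 0 (calg_zero X)" using s0[OF zero_closed] by simp
  have sc: "calg_scale X c (calg_zero X) = calg_zero X" for c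
    using scale_scale[OF zero_closed, of c 0] z by simp
  have "calg_mult X (calg_zero X) (calg_zero X) = calg_zero X"
    using mult_scale_left[OF zero_closed zero_closed, of 0] s0[OF mult_closed[OF zero_closed zero_closed]] z by simp
  moreover have "calg_star X (calg_zero X) = calg_zero X"
    using star_scale[OF zero_closed, of 0] s0[OF star_closed[OF zero_closed]] z by simp
  ultimately show ?thesis
    using sc by (simp add: null_laws_def zero_closed add_closed scale_closed add_inverse add_zero norm_eq_zero)
qed

lemma op_norm_zero: "op_norm_mat (0\<^sub>m k k) = 0"
  using op_norm_le_entries[of "0\<^sub>m k k" k] op_norm_nonneg[of "0\<^sub>m k k" k] by simp

lemma null_laws_matrix_cstar: "null_laws (matrix_cstar k)"
proof -
  have "mat_adjoint (0\<^sub>m k k) = (0\<^sub>m k k :: complex mat)"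
    by (rule eq_matI) (simp_all add: mat_adjoint_index[OF zero_carrier_mat] mat_adjoint_dim[OF zero_carrier_mat])
  moreover have "x + - 1 \<cdot>\<^sub>m x = 0\<^sub>m k k" if "x \<in> carrier_mat k k" for x :: "complex mat"
    using that by (intro eq_matI) auto
  moreover have "c \<cdot>\<^sub>m 0\<^sub>m k k = (0\<^sub>m k k :: complex mat)" for c by (rule eq_matI) auto
  ultimately show ?thesis by (simp add: null_laws_def op_norm_zero)
qed

lemma coherent_sequences_simps [simp]:
  "carrier (coherent_sequences F f) =
     {a. (\<forall>n. a n \<in> carrier (F n)) \<and> (\<exists>N. \<forall>n\<ge>N. a (Suc n) = f n (a n))}"
  "calg_add (coherent_sequences F f) = (\<lambda>a b n. calg_add (F n) (a n) (b n))"
  "calg_zero (coherent_sequences F f) = (\<lambda>n. calg_zero (F n))"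
  "calg_mult (coherent_sequences F f) = (\<lambda>a b n. calg_mult (F n) (a n) (b n))"
  "calg_scale (coherent_sequences F f) = (\<lambda>c a n. calg_scale (F n) c (a n))"
  "calg_star (coherent_sequences F f) = (\<lambda>a n. calg_star (F n) (a n))"
  by (simp_all add: coherent_sequences_def)

text \<open>The coherent sequence \<open>0, \<dots>, 0, x, f n x, f (n + 1) (f n x), \<dots>\<close> with \<open>x\<close> at position \<open>n\<close>.\<close>

primrec tail_seq ::
  "(nat \<Rightarrow> ('b, 'm) cstar_alg_scheme) \<Rightarrow> (nat \<Rightarrow> 'b \<Rightarrow> 'b) \<Rightarrow> nat \<Rightarrow> 'b \<Rightarrow> nat \<Rightarrow> 'b" where
  "tail_seq F f n x 0 = (if n = 0 then x else calg_zero (F 0))"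
| "tail_seq F f n x (Suc m) =
     (if Suc m < n then calg_zero (F (Suc m)) else if Suc m = n then x else f m (tail_seq F f n x m))"

lemma tail_seq_step: "n \<le> m \<Longrightarrow> tail_seq F f n x (Suc m) = f m (tail_seq F f n x m)"
  by simp

lemma tail_seq_start: "tail_seq F f n x n = x"
  by (cases n) simp_all

lemma tail_seq_coherent:
  assumes f: "\<And>n. star_hom (F n) (F (Suc n)) (f n)" and F: "\<And>n. null_laws (F n)"
    and x: "x \<in> carrier (F n)"
  shows "tail_seq F f n x \<in> carrier (coherent_sequences F f)"
proof -
  have "tail_seq F f n x m \<in> carrier (F m)" for m
    by (induction m) (use f F x in \<open>auto simp: star_hom_def null_laws_def\<close>)
  then show ?thesis by (auto intro!: exI[of _ n])
qed

lemma tail_seq_in_carrier: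
  assumes "\<And>n. star_hom (F n) (F (Suc n)) (f n)" "\<And>n. null_laws (F n)" "x \<in> carrier (F n)"
  shows "tail_seq F f n x m \<in> carrier (F m)"
  using tail_seq_coherent[OF assms] by simp

text \<open>
  The canonical map sends \<open>x\<close> to the image of its tail sequence. Sequences that eventually agree have
  the same image, as their difference is a null sequence.
\<close>

lemma inductive_limit_maps:
  fixes D :: "'a::cstar_algebra set"
  assumes il: "is_inductive_limit F f (cstar_of D)"
    and F: "\<And>n. null_laws (F n)" and f: "\<And>n. star_hom (F n) (F (Suc n)) (f n)"
  shows "\<exists>J. (\<forall>n. star_hom (F n) (cstar_of D) (J n)) \<and>
    (\<forall>n. \<forall>x\<in>carrier (F n). J (Suc n) (f n x) = J n x) \<and>
    (\<forall>y\<in>D. \<forall>e>0. \<exists>n. \<exists>x\<in>carrier (F n). norm (J n x - y) < e)"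
proof -
  let ?C = "coherent_sequences F f"
  obtain j where j: "star_hom ?C (cstar_of D) j"
    "\<And>a. a \<in> carrier ?C \<Longrightarrow> (\<lambda>n. calg_norm (F n) (a n)) \<longlonglongrightarrow> norm (j a)"
    "\<And>y e. y \<in> D \<Longrightarrow> e > 0 \<Longrightarrow> \<exists>a\<in>carrier ?C. norm (j a - y) < e"
    using il unfolding is_inductive_limit_def by auto
  have j_add: "j (calg_add ?C a b) = j a + j b" if "a \<in> carrier ?C" "b \<in> carrier ?C" for a b
    using j(1) that unfolding star_hom_def by (metis cstar_of_simps(2))
  have j_scale: "j (calg_scale ?C c a) = scaleC c (j a)" if "a \<in> carrier ?C" for a c
    using j(1) that unfolding star_hom_def by (metis cstar_of_simps(5))
  have j_mult: "j (calg_mult ?C a b) = j a * j b" if "a \<in> carrier ?C" "b \<in> carrier ?C" for a b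
    using j(1) that unfolding star_hom_def by (metis cstar_of_simps(4))
  have j_star: "j (calg_star ?C a) = star (j a)" if "a \<in> carrier ?C" for a
    using j(1) that unfolding star_hom_def by (metis cstar_of_simps(6))
  have j_in: "j a \<in> D" if "a \<in> carrier ?C" for a
    using j(1) that unfolding star_hom_def by (metis cstar_of_simps(1))
  have f_zero: "f n (calg_zero (F n)) = calg_zero (F (Suc n))" for n
  proof -
    have z: "calg_zero (F n) \<in> carrier (F n)" using F by (simp add: null_laws_def)
    then have fz: "f n (calg_zero (F n)) \<in> carrier (F (Suc n))" using f[of n] by (simp add: star_hom_def)
    have "f n (calg_zero (F n)) = f n (calg_add (F n) (calg_zero (F n)) (calg_scale (F n) (- 1) (calg_zero (F n))))"
      using F[of n] by (simp add: null_laws_def)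
    also have "\<dots> = calg_add (F (Suc n)) (f n (calg_zero (F n))) (calg_scale (F (Suc n)) (- 1) (f n (calg_zero (F n))))"
    proof -
      have sz: "calg_scale (F n) (- 1) (calg_zero (F n)) \<in> carrier (F n)"
        using F[of n] z by (simp add: null_laws_def)
      then have "f n (calg_add (F n) (calg_zero (F n)) (calg_scale (F n) (- 1) (calg_zero (F n)))) =
          calg_add (F (Suc n)) (f n (calg_zero (F n))) (f n (calg_scale (F n) (- 1) (calg_zero (F n))))"
        using f[of n] z unfolding star_hom_def by blast
      moreover have "f n (calg_scale (F n) (- 1) (calg_zero (F n))) = calg_scale (F (Suc n)) (- 1) (f n (calg_zero (F n)))"
        using f[of n] z unfolding star_hom_def by blast
      ultimately show ?thesis by simp
    qed
    finally show ?thesis using F[of "Suc n"] fz by (simp add: null_laws_def)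
  qed
  have j_eq: "j a = j b" if a: "a \<in> carrier ?C" and b: "b \<in> carrier ?C" and eq: "\<And>m. m \<ge> N \<Longrightarrow> a m = b m" for a b N
  proof -
    define c where "c = calg_add ?C a (calg_scale ?C (- 1) b)"
    have sb: "calg_scale ?C (- 1) b \<in> carrier ?C"
    proof -
      obtain N where bN: "\<And>n. n \<ge> N \<Longrightarrow> b (Suc n) = f n (b n)" and bc: "\<And>n. b n \<in> carrier (F n)" using b by auto
      have "calg_scale (F (Suc n)) (- 1) (b (Suc n)) = f n (calg_scale (F n) (- 1) (b n))" if "n \<ge> N" for n
        using f[of n] bc[of n] bN[OF that] unfolding star_hom_def by simp
      moreover have "calg_scale (F n) (- 1) (b n) \<in> carrier (F n)" for n
        using F[of n] bc[of n] unfolding null_laws_def by blast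
      ultimately show ?thesis by auto
    qed
    obtain Na Nb where N: "\<And>n. n \<ge> Na \<Longrightarrow> a (Suc n) = f n (a n)"
      "\<And>n. n \<ge> Nb \<Longrightarrow> calg_scale ?C (- 1) b (Suc n) = f n (calg_scale ?C (- 1) b n)"
      using a sb by auto
    have "c \<in> carrier ?C"
    proof -
      have "c (Suc n) = f n (c n)" if "n \<ge> max Na Nb" for n
        using N(1)[of n] N(2)[of n] that a sb f[of n] by (simp add: c_def star_hom_def)
      moreover have "c n \<in> carrier (F n)" for n
        using a sb F[of n] by (simp add: c_def null_laws_def)
      ultimately show ?thesis by (simp, blast)
    qed
    then have "(\<lambda>n. calg_norm (F n) (c n)) \<longlonglongrightarrow> norm (j c)" by (rule j(2))
    moreover have "c n = calg_zero (F n)" if "n \<ge> N" for n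
      using eq[OF that] a b F[of n] by (simp add: c_def null_laws_def)
    then have "(\<lambda>n. calg_norm (F n) (c n)) \<longlonglongrightarrow> 0"
      using F by (intro tendsto_eventually) (auto simp: eventually_sequentially null_laws_def intro!: exI[of _ N])
    ultimately have "norm (j c) = 0" by (rule LIMSEQ_unique)
    moreover have "j c = j a + j (calg_scale ?C (- 1) b)"
      unfolding c_def by (rule j_add[OF a sb])
    moreover have "j (calg_scale ?C (- 1) b) = - j b"
      unfolding j_scale[OF b] by (rule scaleC_minus_one)
    ultimately show ?thesis by simp
  qed
  define J where "J n x = j (tail_seq F f n x)" for n x
  have T: "tail_seq F f n x \<in> carrier ?C" if "x \<in> carrier (F n)" for n x
    using that by (rule tail_seq_coherent[where F = F and f = f, OF f F])
  have Tc: "tail_seq F f n x m \<in> carrier (F m)" if "x \<in> carrier (F n)" for n x m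
    using that by (rule tail_seq_in_carrier[where F = F and f = f, OF f F])
  have "star_hom (F n) (cstar_of D) (J n)" for n
  proof -
    have add: "tail_seq F f n (calg_add (F n) x y) = calg_add ?C (tail_seq F f n x) (tail_seq F f n y)"
      if xy: "x \<in> carrier (F n)" "y \<in> carrier (F n)" for x y
    proof
      fix m show "tail_seq F f n (calg_add (F n) x y) m = calg_add ?C (tail_seq F f n x) (tail_seq F f n y) m"
        by (induction m) (use F f Tc[OF xy(1)] Tc[OF xy(2)] in \<open>auto simp: null_laws_def star_hom_def\<close>)
    qed
    have mult: "tail_seq F f n (calg_mult (F n) x y) = calg_mult ?C (tail_seq F f n x) (tail_seq F f n y)"
      if xy: "x \<in> carrier (F n)" "y \<in> carrier (F n)" for x y
    proof
      fix m show "tail_seq F f n (calg_mult (F n) x y) m = calg_mult ?C (tail_seq F f n x) (tail_seq F f n y) m"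
        by (induction m) (use F f Tc[OF xy(1)] Tc[OF xy(2)] in \<open>auto simp: null_laws_def star_hom_def\<close>)
    qed
    have scale: "tail_seq F f n (calg_scale (F n) c x) = calg_scale ?C c (tail_seq F f n x)"
      if x: "x \<in> carrier (F n)" for x c
    proof
      fix m show "tail_seq F f n (calg_scale (F n) c x) m = calg_scale ?C c (tail_seq F f n x) m"
        by (induction m) (use F f Tc[OF x] in \<open>auto simp: null_laws_def star_hom_def\<close>)
    qed
    have star: "tail_seq F f n (calg_star (F n) x) = calg_star ?C (tail_seq F f n x)"
      if x: "x \<in> carrier (F n)" for x
    proof
      fix m show "tail_seq F f n (calg_star (F n) x) m = calg_star ?C (tail_seq F f n x) m"
        by (induction m) (use F f Tc[OF x] in \<open>auto simp: null_laws_def star_hom_def\<close>)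
    qed
    show ?thesis
      unfolding star_hom_def J_def cstar_of_simps
      by (intro conjI ballI allI)
        (simp_all only: add mult scale star j_add j_mult j_scale j_star j_in T)
  qed
  moreover have "J (Suc n) (f n x) = J n x" if x: "x \<in> carrier (F n)" for n x
    unfolding J_def
  proof (rule j_eq)
    have "f n x \<in> carrier (F (Suc n))" using f[of n] x by (simp add: star_hom_def)
    then show "tail_seq F f (Suc n) (f n x) \<in> carrier ?C" by (rule T)
    show "tail_seq F f n x \<in> carrier ?C" by (rule T[OF x])
    fix m assume "m \<ge> Suc n"
    then show "tail_seq F f (Suc n) (f n x) m = tail_seq F f n x m"
    proof (induction m rule: dec_induct)
      case base
      then show ?case unfolding tail_seq_start using tail_seq_step[of n n F f x] by (simp add: tail_seq_start)
    next
      case (step m)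
      then show ?case by simp
    qed
  qed
  moreover have "\<exists>n. \<exists>x\<in>carrier (F n). norm (J n x - y) < e" if y: "y \<in> D" "e > 0" for y e
  proof -
    obtain a where a: "a \<in> carrier ?C" "norm (j a - y) < e" using j(3)[OF y] by blast
    then obtain N where N: "\<And>n. n \<ge> N \<Longrightarrow> a (Suc n) = f n (a n)" and ac: "\<And>n. a n \<in> carrier (F n)" by auto
    have "j a = j (tail_seq F f N (a N))"
    proof (rule j_eq[OF a(1) T[OF ac]])
      fix m assume "m \<ge> N"
      then show "a m = tail_seq F f N (a N) m"
        by (induction m rule: dec_induct) (simp_all add: tail_seq_start N)
    qed
    then show ?thesis using a(2) ac by (auto simp: J_def)
  qed
  ultimately show ?thesis by blast
qed

text \<open>
  The images of the finite-dimensional algebras need not contain the unit, so the scalars are added.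
\<close>

lemma AF_algebra_dense_fd_subalgebras:
  assumes "AF_algebra TYPE('b) (cstar_of (UNIV :: 'a::cstar_algebra set))"
  shows "\<exists>Bs :: nat \<Rightarrow> 'a set. (\<forall>n. fd_subalgebra (Bs n)) \<and> (\<forall>n. Bs n \<subseteq> Bs (Suc n)) \<and>
    closure (\<Union>n. Bs n) = UNIV"
proof -
  obtain F :: "nat \<Rightarrow> 'b cstar_alg" and f where F: "\<And>n. cstar_structure (F n)" "\<And>n. finite_dim (F n)"
    and f: "\<And>n. star_hom (F n) (F (Suc n)) (f n)"
    and il: "is_inductive_limit F f (cstar_of (UNIV :: 'a set))"
    using assms unfolding AF_algebra_def by blast
  obtain J where J: "\<And>n. star_hom (F n) (cstar_of (UNIV :: 'a set)) (J n)"
    "\<And>n x. x \<in> carrier (F n) \<Longrightarrow> J (Suc n) (f n x) = J n x"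
    "\<And>y e. e > 0 \<Longrightarrow> \<exists>n. \<exists>x\<in>carrier (F n). norm (J n x - y) < e"
    using inductive_limit_maps[OF il null_laws_cstar_structure[OF F(1)] f] by auto
  define Bs where "Bs n = {J n x + scaleC c 1 | x c. x \<in> carrier (F n)}" for n
  have BsI: "J n x + scaleC c 1 \<in> Bs n" if "x \<in> carrier (F n)" for n x c
    using that by (auto simp: Bs_def)
  have "fd_subalgebra (Bs n)" for n
  proof -
    interpret X: cstar_structure "F n" by (rule F)
    have hom: "J n (calg_add (F n) x y) = J n x + J n y" "J n (calg_mult (F n) x y) = J n x * J n y"
      "J n (calg_scale (F n) c x) = scaleC c (J n x)" "J n (calg_star (F n) x) = star (J n x)"
      if "x \<in> carrier (F n)" "y \<in> carrier (F n)" for x y c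
      using J(1)[of n] that by (simp_all add: star_hom_def)
    have zero: "J n (calg_zero (F n)) = 0"
    proof -
      have "calg_zero (F n) = calg_scale (F n) 0 (calg_zero (F n))"
        using null_laws_cstar_structure[OF F(1)[of n]] by (simp add: null_laws_def)
      then show ?thesis using hom(3)[OF X.zero_closed X.zero_closed, of 0] by simp
    qed
    show ?thesis
    proof
      show "1 \<in> Bs n" using BsI[OF X.zero_closed, of 1] zero by (simp add: scaleC_one)
    next
      fix a b assume "a \<in> Bs n" "b \<in> Bs n"
      then obtain x c y d where xy: "x \<in> carrier (F n)" "y \<in> carrier (F n)"
        "a = J n x + scaleC c 1" "b = J n y + scaleC d 1" by (auto simp: Bs_def)
      have "a + b = J n (calg_add (F n) x y) + scaleC (c + d) 1"
        using xy hom by (simp add: scaleC_add_left)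
      then show "a + b \<in> Bs n" using BsI[OF X.add_closed[OF xy(1,2)]] by simp
      let ?z = "calg_add (F n) (calg_mult (F n) x y) (calg_add (F n) (calg_scale (F n) d x) (calg_scale (F n) c y))"
      have z: "?z \<in> carrier (F n)" using xy by (intro X.add_closed X.mult_closed X.scale_closed)
      have "a * b = J n ?z + scaleC (c * d) 1"
        using xy by (simp add: hom X.add_closed X.mult_closed X.scale_closed distrib_left distrib_right
            scaleC_mult_left scaleC_mult_right scaleC_scaleC scaleC_add_right mult.commute add.assoc)
      then show "a * b \<in> Bs n" using BsI[OF z] by simp
    next
      fix a c assume "a \<in> Bs n"
      then obtain x d where x: "x \<in> carrier (F n)" "a = J n x + scaleC d 1" by (auto simp: Bs_def)
      have "scaleC c a = J n (calg_scale (F n) c x) + scaleC (c * d) 1"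
        using x hom by (simp add: scaleC_add_right scaleC_scaleC)
      then show "scaleC c a \<in> Bs n" using BsI[OF X.scale_closed[OF x(1)]] by simp
      have "star a = J n (calg_star (F n) x) + scaleC (cnj d) 1"
        using x hom by (simp add: star_add star_scaleC)
      then show "star a \<in> Bs n" using BsI[OF X.star_closed[OF x(1)]] by simp
    next
      obtain S where S: "finite S" "S \<subseteq> carrier (F n)"
        "\<Inter>{V. complex_subspace (F n) V \<and> S \<subseteq> V} = carrier (F n)"
        using F(2)[of n] unfolding finite_dim_def by blast
      define V where "V = {x \<in> carrier (F n). J n x \<in> complex_vector.span (J n ` S)}"
      have "complex_subspace (F n) V"
        unfolding complex_subspace_def V_def
        by (auto simp: hom zero X.zero_closed X.add_closed X.scale_closed complex_vector.span_zero
            intro!: complex_vector.span_add complex_vector.span_scale)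
      moreover have "S \<subseteq> V" using S by (auto simp: V_def intro: complex_vector.span_base)
      ultimately have "carrier (F n) \<subseteq> V" using S(3) by blast
      then have sp: "J n x \<in> complex_vector.span (J n ` S)" if "x \<in> carrier (F n)" for x
        using that by (auto simp: V_def)
      have "Bs n \<subseteq> complex_vector.span (insert 1 (J n ` S))"
      proof
        fix a assume "a \<in> Bs n"
        then obtain x d where x: "x \<in> carrier (F n)" "a = J n x + scaleC d 1" by (auto simp: Bs_def)
        have "J n x \<in> complex_vector.span (insert 1 (J n ` S))"
          using sp[OF x(1)] complex_vector.span_mono[of "J n ` S" "insert 1 (J n ` S)"] by blast
        then show "a \<in> complex_vector.span (insert 1 (J n ` S))"
          unfolding x(2) by (intro complex_vector.span_add complex_vector.span_scale) (auto intro: complex_vector.span_base)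
      qed
      then show "\<exists>S. finite S \<and> Bs n \<subseteq> complex_vector.span S"
        by (intro exI[of _ "insert 1 (J n ` S)"]) (simp add: S(1))
    qed
  qed
  moreover have "Bs n \<subseteq> Bs (Suc n)" for n
  proof
    fix a assume "a \<in> Bs n"
    then obtain x c where x: "x \<in> carrier (F n)" "a = J n x + scaleC c 1" by (auto simp: Bs_def)
    moreover have "f n x \<in> carrier (F (Suc n))" using f[of n] x by (simp add: star_hom_def)
    ultimately show "a \<in> Bs (Suc n)" using J(2)[OF x(1)] BsI[of "f n x" "Suc n" c] by simp
  qed
  moreover have "closure (\<Union>n. Bs n) = UNIV"
  proof -
    have "y \<in> closure (\<Union>n. Bs n)" for y
      unfolding closure_approachable
    proof (intro allI impI)
      fix e :: real assume "0 < e"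
      then obtain n x where x: "x \<in> carrier (F n)" "norm (J n x - y) < e" using J(3) by blast
      moreover have "J n x \<in> Bs n" using BsI[OF x(1), of 0] by simp
      ultimately show "\<exists>z\<in>(\<Union>n. Bs n). dist z y < e" by (auto simp: dist_norm)
    qed
    then show ?thesis by blast
  qed
  ultimately show ?thesis by blast
qed

text \<open>A UHF-algebra, given by a sequence of matrix algebras with coherent maps and dense joint range.\<close>

definition uhf_system ::
  "'a::cstar_algebra set \<Rightarrow> (nat \<Rightarrow> nat) \<Rightarrow> (nat \<Rightarrow> complex mat \<Rightarrow> complex mat) \<Rightarrow>
    (nat \<Rightarrow> complex mat \<Rightarrow> 'a) \<Rightarrow> bool" where
  "uhf_system D k f J \<longleftrightarrow>
     (\<forall>i. unital_star_hom (matrix_cstar (k i)) (matrix_cstar (k (Suc i))) (f i)) \<and>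
     (\<forall>i. hom_into D (k i) (J i)) \<and>
     (\<forall>i. \<forall>X\<in>carrier_mat (k i) (k i). J (Suc i) (f i X) = J i X) \<and>
     (\<forall>y\<in>D. \<forall>e>0. \<exists>n. \<exists>X\<in>carrier_mat (k n) (k n). norm (J n X - y) < e)"

lemma uhf_system_exists:
  assumes "unital_UHF_subalgebra D"
  shows "\<exists>k f J. uhf_system D k f J"
proof -
  obtain k f where f: "\<And>i. unital_star_hom (matrix_cstar (k i)) (matrix_cstar (k (Suc i))) (f i)"
    and il: "is_inductive_limit (\<lambda>i. matrix_cstar (k i)) f (cstar_of D)"
    using assms unfolding unital_UHF_subalgebra_def UHF_algebra_def by blast
  have D1: "1 \<in> D" using assms by (simp add: unital_UHF_subalgebra_def)
  have fh: "star_hom (matrix_cstar (k i)) (matrix_cstar (k (Suc i))) (f i)" and f1: "f i (1\<^sub>m (k i)) = 1\<^sub>m (k (Suc i))" for i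
    using f[of i] by (auto simp: unital_star_hom_matrix_iff is_unit_of_matrix_cstar)
  obtain J where J: "\<And>n. star_hom (matrix_cstar (k n)) (cstar_of D) (J n)"
    "\<And>n X. X \<in> carrier_mat (k n) (k n) \<Longrightarrow> J (Suc n) (f n X) = J n X"
    "\<And>y e. y \<in> D \<Longrightarrow> e > 0 \<Longrightarrow> \<exists>n. \<exists>X\<in>carrier_mat (k n) (k n). norm (J n X - y) < e"
    using inductive_limit_maps[OF il null_laws_matrix_cstar fh] unfolding matrix_cstar_simps by blast
  define e where "e = J 0 (1\<^sub>m (k 0))"
  have one: "J n (1\<^sub>m (k n)) = e" for n
  proof (induction n)
    case (Suc n)
    then show ?case using J(2)[of "1\<^sub>m (k n)" n] f1[of n] by simp
  qed (simp add: e_def)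
  \<comment> \<open>The common image \<open>e\<close> of the units acts as a unit on elements arbitrarily close to \<open>1\<close>.\<close>
  have "e = 1"
  proof (rule ccontr)
    assume "e \<noteq> 1"
    then have "norm (e - 1) > 0" by simp
    define d where "d = norm (e - 1) / (norm e + 1)"
    have pos: "norm e + 1 > 0" by (simp add: add_nonneg_pos)
    then have "d > 0" using \<open>norm (e - 1) > 0\<close> by (simp add: d_def)
    then obtain n X where X: "X \<in> carrier_mat (k n) (k n)" "norm (J n X - 1) < d" using J(3)[OF D1] by blast
    have "J n (1\<^sub>m (k n) * X) = J n (1\<^sub>m (k n)) * J n X"
      using J(1)[of n] X(1) unfolding star_hom_def matrix_cstar_simps cstar_of_simps by (metis one_carrier_mat)
    then have "e * J n X = J n X" using X(1) one by simp
    then have "e - 1 = (J n X - 1) - e * (J n X - 1)" by (simp add: right_diff_distrib)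
    then have "norm (e - 1) \<le> norm (J n X - 1) + norm (e * (J n X - 1))" by (metis norm_triangle_ineq4)
    also have "\<dots> \<le> norm (J n X - 1) + norm e * norm (J n X - 1)" by (simp add: norm_mult_ineq)
    also have "\<dots> = (norm e + 1) * norm (J n X - 1)" by (simp add: algebra_simps)
    also have "\<dots> < (norm e + 1) * d" using X(2) pos by (rule mult_strict_left_mono)
    finally show False using pos by (simp add: d_def)
  qed
  then have "hom_into D (k n) (J n)" for n
    using J(1)[of n] one[of n] by (simp add: hom_into_def unital_mat_hom_def star_hom_def)
  then show ?thesis using f J(2,3) unfolding uhf_system_def by blast
qed

lemma uhf_system_lift:
  assumes "uhf_system D k f J" and "n \<le> m" "X \<in> carrier_mat (k n) (k n)"
    and g: "\<And>i X. X \<in> carrier_mat (k i) (k i) \<Longrightarrow> g (Suc i) (f i X) = g i X"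
  shows "\<exists>Y\<in>carrier_mat (k m) (k m). J m Y = J n X \<and> g m Y = g n X"
  using assms(2)
proof (induction m rule: dec_induct)
  case base
  then show ?case using assms(3) by blast
next
  case (step m)
  then obtain Y where Y: "Y \<in> carrier_mat (k m) (k m)" "J m Y = J n X" "g m Y = g n X" by blast
  have "f m Y \<in> carrier_mat (k (Suc m)) (k (Suc m))"
    using assms(1) Y(1) by (simp add: uhf_system_def unital_star_hom_def star_hom_def)
  moreover have "J (Suc m) (f m Y) = J m Y" using assms(1) Y(1) by (simp add: uhf_system_def)
  ultimately show ?case using g[OF Y(1)] Y by metis
qed

text \<open>
  A coherent system of unital homomorphisms on the matrix algebras is automatically isometric, and
  extends to the UHF-algebra by continuity.
\<close>

theorem uhf_system_extend:
  fixes D M :: "'a::cstar_algebra set"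
  assumes sys: "uhf_system D k f J" and D: "cstar_subalgebra D" "1 \<in> D"
    and M: "cstar_subalgebra M"
    and g: "\<And>i. hom_into M (k i) (g i)"
      "\<And>i X. X \<in> carrier_mat (k i) (k i) \<Longrightarrow> g (Suc i) (f i X) = g i X"
  shows "\<exists>\<phi>. unital_embedding (cstar_of D) (cstar_of M) \<phi> \<and> (\<forall>x\<in>D. norm (\<phi> x) = norm x) \<and>
    (\<forall>x\<in>D. \<forall>y\<in>D. \<phi> (x - y) = \<phi> x - \<phi> y) \<and>
    (\<forall>i. \<forall>X\<in>carrier_mat (k i) (k i). \<phi> (J i X) = g i X)"
proof -
  have J: "hom_into D (k i) (J i)" for i using sys by (simp add: uhf_system_def)
  have Jh: "unital_mat_hom (k i) (J i)" and gh: "unital_mat_hom (k i) (g i)" for i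
    using J g(1) by (auto simp: hom_into_def)
  \<comment> \<open>The graph of the map \<open>J n X \<mapsto> g n X\<close>; it is a linear *-relation that preserves norms.\<close>
  define R where "R x y \<longleftrightarrow> (\<exists>n. \<exists>X\<in>carrier_mat (k n) (k n). x = J n X \<and> y = g n X)" for x y
  have RI: "R (J n X) (g n X)" if "X \<in> carrier_mat (k n) (k n)" for n X using that by (auto simp: R_def)
  have common: "\<exists>n. \<exists>X\<in>carrier_mat (k n) (k n). \<exists>X'\<in>carrier_mat (k n) (k n).
      x = J n X \<and> y = g n X \<and> x' = J n X' \<and> y' = g n X'" if xy: "R x y" "R x' y'" for x y x' y'
  proof -
    obtain n X m X' where 1: "X \<in> carrier_mat (k n) (k n)" "x = J n X" "y = g n X"
      "X' \<in> carrier_mat (k m) (k m)" "x' = J m X'" "y' = g m X'"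
      using xy unfolding R_def by blast
    obtain Y where Y: "Y \<in> carrier_mat (k (max n m)) (k (max n m))" "J (max n m) Y = x" "g (max n m) Y = y"
      using uhf_system_lift[OF sys max.cobounded1 1(1), of g m] g(2) 1 by auto
    obtain Y' where Y': "Y' \<in> carrier_mat (k (max n m)) (k (max n m))" "J (max n m) Y' = x'" "g (max n m) Y' = y'"
      using uhf_system_lift[OF sys max.cobounded2 1(4), of g n] g(2) 1 by auto
    show ?thesis using Y Y' by blast
  qed
  have R_norm: "norm y = norm x" if "R x y" for x y
    using that unital_mat_hom_isometric[OF Jh] unital_mat_hom_isometric[OF gh] by (auto simp: R_def)
  have R_add: "R (x + x') (y + y')" and R_mult: "R (x * x') (y * y')" if xy: "R x y" "R x' y'" for x y x' y'
  proof -
    obtain n X X' where 1: "X \<in> carrier_mat (k n) (k n)" "X' \<in> carrier_mat (k n) (k n)"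
      "x = J n X" "y = g n X" "x' = J n X'" "y' = g n X'" using common[OF xy] by blast
    show "R (x + x') (y + y')" "R (x * x') (y * y')"
      using RI[of "X + X'" n] RI[of "X * X'" n] 1 unital_mat_homD[OF Jh 1(1)] unital_mat_homD[OF gh 1(1)] by auto
  qed
  have R_scale: "R (scaleC c x) (scaleC c y)" and R_star: "R (star x) (star y)" if xy: "R x y" for x y c
  proof -
    obtain n X where 1: "X \<in> carrier_mat (k n) (k n)" "x = J n X" "y = g n X" using xy by (auto simp: R_def)
    show "R (scaleC c x) (scaleC c y)" "R (star x) (star y)"
      using RI[of "c \<cdot>\<^sub>m X" n] RI[of "mat_adjoint X" n] 1 unital_mat_homD[OF Jh 1(1)] unital_mat_homD[OF gh 1(1)] by auto
  qed
  have R_diff: "R (x - x') (y - y')" if "R x y" "R x' y'" for x y x' y'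
    using R_add[OF that(1) R_scale[OF that(2), of "-1"]] by (simp add: scaleC_minus_one)
  have R_unique: "y = y'" if "R x y" "R x y'" for x y y'
    using R_norm[OF R_diff[OF that]] by simp
  define U where "U = {x. \<exists>y. R x y}"
  define h where "h x = (THE y. R x y)" for x
  have hR: "h x = y" if "R x y" for x y
    unfolding h_def using that R_unique by blast
  have Rh: "R x (h x)" if "x \<in> U" for x using that hR by (auto simp: U_def)
  have "uniformly_continuous_on U h"
    unfolding uniformly_continuous_on_def
  proof (intro allI impI)
    fix e :: real assume e: "e > 0"
    have "dist (h x) (h y) = dist x y" if "x \<in> U" "y \<in> U" for x y
      using R_norm[OF R_diff[OF Rh[OF that(1)] Rh[OF that(2)]]] by (simp add: dist_norm)
    then show "\<exists>d>0. \<forall>x\<in>U. \<forall>x'\<in>U. dist x' x < d \<longrightarrow> dist (h x') (h x) < e" using e by auto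
  qed
  then obtain \<phi> where uc: "uniformly_continuous_on (closure U) \<phi>" and \<phi>h: "\<And>x. x \<in> U \<Longrightarrow> h x = \<phi> x"
    using uniformly_continuous_on_extension_on_closure by metis
  have R\<phi>: "\<phi> x = y" if "R x y" for x y
  proof -
    have "x \<in> U" using that unfolding U_def by blast
    then show ?thesis using \<phi>h[of x] hR[OF that] by simp
  qed
  have DU: "D \<subseteq> closure U"
  proof
    fix y assume y: "y \<in> D"
    show "y \<in> closure U"
      unfolding closure_approachable
    proof (intro allI impI)
      fix e :: real assume "0 < e"
      then obtain n X where "X \<in> carrier_mat (k n) (k n)" "norm (J n X - y) < e"
        using sys y unfolding uhf_system_def by blast
      then show "\<exists>z\<in>U. dist z y < e" using RI by (auto simp: U_def dist_norm)
    qed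
  qed
  have lim: "\<exists>p q. (\<forall>i. R (p i) (q i)) \<and> p \<longlonglongrightarrow> x \<and> q \<longlonglongrightarrow> \<phi> x" if x: "x \<in> D" for x
  proof -
    have "x \<in> closure U" using x DU by blast
    then obtain p where p: "\<And>i. p i \<in> U" "p \<longlonglongrightarrow> x" unfolding closure_sequential by blast
    have "(\<lambda>i. \<phi> (p i)) \<longlonglongrightarrow> \<phi> x"
      using uniformly_continuous_imp_continuous[OF uc] p \<open>x \<in> closure U\<close> closure_subset[of U]
      unfolding continuous_on_sequentially o_def by blast
    moreover have "R (p i) (\<phi> (p i))" for i using Rh[OF p(1)] \<phi>h[OF p(1)] by simp
    ultimately show ?thesis
      using p(2) by (intro exI[of _ p] exI[of _ "\<lambda>i. \<phi> (p i)"] conjI allI)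
  qed
  have cont: "\<phi> x = y" if "\<And>i. R (p i) (q i)" "p \<longlonglongrightarrow> x" "q \<longlonglongrightarrow> y" "x \<in> D" for p q x y
  proof -
    have "p i \<in> U" for i using that(1) by (auto simp: U_def)
    then have "(\<lambda>i. \<phi> (p i)) \<longlonglongrightarrow> \<phi> x"
      using uniformly_continuous_imp_continuous[OF uc] that(2,4) DU closure_subset[of U]
      unfolding continuous_on_sequentially o_def by blast
    moreover have "(\<lambda>i. \<phi> (p i)) = q" using R\<phi>[OF that(1)] by blast
    ultimately show ?thesis using that(3) LIMSEQ_unique by blast
  qed
  have Dcl: "x + y \<in> D" "x * y \<in> D" "scaleC c x \<in> D" "star x \<in> D" if "x \<in> D" "y \<in> D" for x y c
    using D that by (auto simp: cstar_subalgebra_def)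
  have \<phi>_add: "\<phi> (x + y) = \<phi> x + \<phi> y" and \<phi>_mult: "\<phi> (x * y) = \<phi> x * \<phi> y" if xy: "x \<in> D" "y \<in> D" for x y
  proof -
    obtain p q p' q' where pq: "\<And>i. R (p i) (q i)" "p \<longlonglongrightarrow> x" "q \<longlonglongrightarrow> \<phi> x"
      "\<And>i. R (p' i) (q' i)" "p' \<longlonglongrightarrow> y" "q' \<longlonglongrightarrow> \<phi> y" using lim[OF xy(1)] lim[OF xy(2)] by blast
    show "\<phi> (x + y) = \<phi> x + \<phi> y"
      by (rule cont[OF R_add[OF pq(1,4)] tendsto_add[OF pq(2,5)] tendsto_add[OF pq(3,6)] Dcl(1)[OF xy]])
    show "\<phi> (x * y) = \<phi> x * \<phi> y"
      by (rule cont[OF R_mult[OF pq(1,4)] tendsto_mult[OF pq(2,5)] tendsto_mult[OF pq(3,6)] Dcl(2)[OF xy]])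
  qed
  have \<phi>_scale: "\<phi> (scaleC c x) = scaleC c (\<phi> x)" and \<phi>_star: "\<phi> (star x) = star (\<phi> x)"
    and \<phi>_norm: "norm (\<phi> x) = norm x" and \<phi>_M: "\<phi> x \<in> M" if x: "x \<in> D" for x c
  proof -
    obtain p q where pq: "\<And>i. R (p i) (q i)" "p \<longlonglongrightarrow> x" "q \<longlonglongrightarrow> \<phi> x" using lim[OF x] by blast
    show "\<phi> (scaleC c x) = scaleC c (\<phi> x)"
      by (rule cont[OF R_scale[OF pq(1)] tendsto_scaleC[OF pq(2)] tendsto_scaleC[OF pq(3)] Dcl(3)[OF x x]])
    show "\<phi> (star x) = star (\<phi> x)"
      by (rule cont[OF R_star[OF pq(1)] tendsto_star[OF pq(2)] tendsto_star[OF pq(3)] Dcl(4)[OF x x]])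
    have "(\<lambda>i. norm (q i)) \<longlonglongrightarrow> norm x" using tendsto_norm[OF pq(2)] R_norm[OF pq(1)] by simp
    then show "norm (\<phi> x) = norm x" using tendsto_norm[OF pq(3)] LIMSEQ_unique by blast
    have "q i \<in> M" for i using pq(1)[of i] g(1) by (auto simp: R_def hom_into_def)
    then show "\<phi> x \<in> M" using M pq(3) by (meson closed_sequentially cstar_subalgebra_def)
  qed
  have \<phi>_diff: "\<phi> (x - y) = \<phi> x - \<phi> y" if "x \<in> D" "y \<in> D" for x y
    using \<phi>_add[OF that(1) Dcl(3)[OF that(2) that(2), of "-1"]] \<phi>_scale[OF that(2), of "-1"]
    by (simp add: scaleC_minus_one)
  have \<phi>J: "\<phi> (J i X) = g i X" if "X \<in> carrier_mat (k i) (k i)" for i X by (rule R\<phi>[OF RI[OF that]])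
  have one: "\<phi> 1 = 1" using \<phi>J[of "1\<^sub>m (k 0)" 0] unital_mat_hom_one[OF Jh] unital_mat_hom_one[OF gh] by simp
  then have "1 \<in> M" using \<phi>_M[OF D(2)] by simp
  have "star_hom (cstar_of D) (cstar_of M) \<phi>"
    unfolding star_hom_def cstar_of_simps using \<phi>_add \<phi>_mult \<phi>_scale \<phi>_star \<phi>_M by blast
  moreover have "is_unit_of (cstar_of D) 1" "is_unit_of (cstar_of M) (\<phi> 1)"
    using D(2) \<open>1 \<in> M\<close> one by (simp_all add: is_unit_of_def)
  moreover have "inj_on \<phi> D"
  proof (rule inj_onI)
    fix x y assume xy: "x \<in> D" "y \<in> D" "\<phi> x = \<phi> y"
    then have "x - y \<in> D" using Dcl(1)[OF xy(1) Dcl(3)[OF xy(2) xy(2), of "-1"]] by (simp add: scaleC_minus_one)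
    then have "norm (x - y) = norm (\<phi> x - \<phi> y)" using \<phi>_norm \<phi>_diff[OF xy(1,2)] by metis
    then show "x = y" using xy by simp
  qed
  ultimately have "unital_embedding (cstar_of D) (cstar_of M) \<phi>"
    unfolding unital_embedding_def unital_star_hom_def cstar_of_simps by blast
  then show ?thesis using \<phi>_norm \<phi>_diff \<phi>J by blast
qed

section \<open>Construction of the maximal UHF-subalgebra\<close>

lemma closure_increasing_subalgebras:
  fixes C :: "nat \<Rightarrow> 'a::cstar_algebra set"
  assumes C: "\<And>n. fd_subalgebra (C n)" and inc: "\<And>n. C n \<subseteq> C (Suc n)"
  shows "cstar_subalgebra (closure (\<Union>n. C n))"
proof -
  let ?U = "\<Union>n. C n"
  have mono: "C m \<subseteq> C n" if "m \<le> n" for m n using lift_Suc_mono_le[of C m n] inc that by auto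
  have pair: "\<exists>n. x \<in> C n \<and> y \<in> C n" if "x \<in> ?U" "y \<in> ?U" for x y
  proof -
    obtain m n where "x \<in> C m" "y \<in> C n" using \<open>x \<in> ?U\<close> \<open>y \<in> ?U\<close> by blast
    then show ?thesis using mono[of m "max m n"] mono[of n "max m n"] by auto
  qed
  have U2: "x + y \<in> ?U" "x * y \<in> ?U" if xy: "x \<in> ?U" "y \<in> ?U" for x y
  proof -
    obtain n where n: "x \<in> C n" "y \<in> C n" using pair[OF xy] by blast
    show "x + y \<in> ?U" "x * y \<in> ?U"
      using fd_subalgebra.add_closed[OF C n] fd_subalgebra.mult_closed[OF C n] by blast+
  qed
  have U1: "scaleC c x \<in> ?U" "star x \<in> ?U" if x: "x \<in> ?U" for x c
  proof -
    obtain n where n: "x \<in> C n" using x by blast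
    show "scaleC c x \<in> ?U" "star x \<in> ?U"
      using fd_subalgebra.scale_closed[OF C n] fd_subalgebra.star_closed[OF C n] by blast+
  qed
  have cl: "x \<in> closure ?U" if "\<And>i. p i \<in> ?U" "p \<longlonglongrightarrow> x" for p x
    using that unfolding closure_sequential by blast
  have "x + y \<in> closure ?U \<and> x * y \<in> closure ?U" if xy: "x \<in> closure ?U" "y \<in> closure ?U" for x y
  proof -
    obtain p q where p: "\<And>i. p i \<in> ?U" "p \<longlonglongrightarrow> x" and q: "\<And>i. q i \<in> ?U" "q \<longlonglongrightarrow> y"
      using xy unfolding closure_sequential by blast
    show ?thesis
      using cl[OF U2(1)[OF p(1) q(1)] tendsto_add[OF p(2) q(2)]]
        cl[OF U2(2)[OF p(1) q(1)] tendsto_mult[OF p(2) q(2)]] by blast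
  qed
  moreover have "scaleC c x \<in> closure ?U \<and> star x \<in> closure ?U" if x: "x \<in> closure ?U" for x c
  proof -
    obtain p where p: "\<And>i. p i \<in> ?U" "p \<longlonglongrightarrow> x" using x unfolding closure_sequential by blast
    show ?thesis
      using cl[OF U1(1)[OF p(1)] tendsto_scaleC[OF p(2)]] cl[OF U1(2)[OF p(1)] tendsto_star[OF p(2)]] by blast
  qed
  moreover have "0 \<in> closure ?U" using fd_subalgebra.zero_closed[OF C[of 0]] closure_subset[of ?U] by blast
  ultimately show ?thesis unfolding cstar_subalgebra_def by (simp add: closed_closure)
qed

lemma fd_subalgebra_hom_range:
  assumes f: "unital_mat_hom k f"
  shows "fd_subalgebra (f ` carrier_mat k k)"
proof
  note fD = unital_mat_homD[OF f]
  show "1 \<in> f ` carrier_mat k k"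
    using unital_mat_hom_one[OF f] by (metis image_eqI one_carrier_mat)
  fix x assume "x \<in> f ` carrier_mat k k"
  then obtain X where X: "X \<in> carrier_mat k k" "x = f X" by blast
  show "scaleC c x \<in> f ` carrier_mat k k" for c
    using fD(3)[OF X(1), of c] X by (metis image_eqI smult_carrier_mat)
  show "star x \<in> f ` carrier_mat k k"
    using fD(4)[OF X(1)] X by (metis image_eqI mat_adjoint_carrier)
  fix y assume "y \<in> f ` carrier_mat k k"
  then obtain Y where Y: "Y \<in> carrier_mat k k" "y = f Y" by blast
  show "x + y \<in> f ` carrier_mat k k"
    using fD(1)[OF X(1) Y(1)] X Y by (metis image_eqI add_carrier_mat)
  show "x * y \<in> f ` carrier_mat k k"
    using fD(2)[OF X(1) Y(1)] X Y by (metis image_eqI mult_carrier_mat)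
next
  let ?S = "(\<lambda>(i, j). f (mat_unit k i j)) ` ({..<k} \<times> {..<k})"
  have "f X \<in> complex_vector.span ?S" if X: "X \<in> carrier_mat k k" for X
    unfolding unital_mat_hom_expand[OF f X]
    by (intro complex_vector.span_sum complex_vector.span_scale complex_vector.span_base) auto
  then have "finite ?S \<and> f ` carrier_mat k k \<subseteq> complex_vector.span ?S" by auto
  then show "\<exists>S. finite S \<and> f ` carrier_mat k k \<subseteq> complex_vector.span S" by blast
qed

text \<open>
  The closure of the union of a coherent system of matrix algebras is their inductive limit: the map
  from the coherent sequences is given by the eventually constant value of \<open>J n (a n)\<close>.
\<close>

lemma unital_UHF_subalgebra_closure:
  fixes J :: "nat \<Rightarrow> complex mat \<Rightarrow> 'a::cstar_algebra"
  assumes k: "\<And>i. 0 < k i \<and> k i dvd k (Suc i)"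
    and f: "\<And>i. unital_star_hom (matrix_cstar (k i)) (matrix_cstar (k (Suc i))) (f i)"
    and J: "\<And>i. unital_mat_hom (k i) (J i)"
      "\<And>i X. X \<in> carrier_mat (k i) (k i) \<Longrightarrow> J (Suc i) (f i X) = J i X"
  shows "unital_UHF_subalgebra (closure (\<Union>i. J i ` carrier_mat (k i) (k i)))"
proof -
  let ?F = "\<lambda>i. matrix_cstar (k i)"
  let ?C = "coherent_sequences ?F f"
  let ?U = "\<Union>i. J i ` carrier_mat (k i) (k i)"
  let ?M = "closure ?U"
  have fh: "star_hom (?F i) (?F (Suc i)) (f i)" for i using f[of i] by (simp add: unital_star_hom_def)
  have fc: "f i X \<in> carrier_mat (k (Suc i)) (k (Suc i))" if "X \<in> carrier_mat (k i) (k i)" for i X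
    using fh[of i] that by (simp add: star_hom_def)
  have sub: "cstar_subalgebra ?M"
  proof (rule closure_increasing_subalgebras)
    show "fd_subalgebra (J i ` carrier_mat (k i) (k i))" for i by (rule fd_subalgebra_hom_range[OF J(1)])
    show "J i ` carrier_mat (k i) (k i) \<subseteq> J (Suc i) ` carrier_mat (k (Suc i)) (k (Suc i))" for i
      using J(2) fc by (metis image_eqI image_subsetI)
  qed
  define ev where "ev a y \<longleftrightarrow> (\<exists>N. \<forall>n\<ge>N. J n (a n) = y)" for a :: "nat \<Rightarrow> complex mat" and y
  define j where "j a = (SOME y. ev a y)" for a
  have ev_unique: "y = z" if yz: "ev a y" "ev a z" for a y z
  proof -
    obtain N M where "\<forall>n\<ge>N. J n (a n) = y" "\<forall>n\<ge>M. J n (a n) = z" using yz unfolding ev_def by blast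
    then show ?thesis by (metis max.cobounded1 max.cobounded2)
  qed
  have ev_j: "j a = y" if "ev a y" for a y
    unfolding j_def using that ev_unique by (metis someI)
  have Cc: "a n \<in> carrier_mat (k n) (k n)" if "a \<in> carrier ?C" for a n using that by simp
  have ev_ex: "\<exists>y. ev a y \<and> y \<in> ?U" if a: "a \<in> carrier ?C" for a
  proof -
    obtain N where N: "\<And>n. n \<ge> N \<Longrightarrow> a (Suc n) = f n (a n)" using a by auto
    have "J n (a n) = J N (a N)" if "n \<ge> N" for n
      using that
    proof (induction n rule: dec_induct)
      case (step n)
      then show ?case using N[of n] J(2)[OF Cc[OF a]] by simp
    qed simp
    then show ?thesis using Cc[OF a, of N] unfolding ev_def by blast
  qed
  have ev_self: "ev a (j a)" and j_in: "j a \<in> ?M" if a: "a \<in> carrier ?C" for a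
  proof -
    obtain y where y: "ev a y" "y \<in> ?U" using ev_ex[OF a] by blast
    show "ev a (j a)" "j a \<in> ?M"
      using y closure_subset[of ?U] unfolding ev_j[OF y(1)] by blast+
  qed
  have ev2: "\<exists>N. \<forall>n\<ge>N. J n (a n) = y \<and> J n (b n) = z" if yz: "ev a y" "ev b z" for a b y z
  proof -
    obtain N M where "\<forall>n\<ge>N. J n (a n) = y" "\<forall>n\<ge>M. J n (b n) = z" using yz unfolding ev_def by blast
    then show ?thesis by (intro exI[of _ "max N M"]) auto
  qed
  have "star_hom ?C (cstar_of ?M) j"
    unfolding star_hom_def cstar_of_simps
  proof (intro conjI ballI allI)
    fix a assume a: "a \<in> carrier ?C"
    show "j a \<in> ?M" by (rule j_in[OF a])
    obtain N where N: "\<And>n. n \<ge> N \<Longrightarrow> J n (a n) = j a" using ev_self[OF a] unfolding ev_def by blast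
    show "j (calg_scale ?C c a) = scaleC c (j a)" for c
      by (rule ev_j) (auto simp: ev_def unital_mat_homD(3)[OF J(1) Cc[OF a]] N intro!: exI[of _ N])
    show "j (calg_star ?C a) = star (j a)"
      by (rule ev_j) (auto simp: ev_def unital_mat_homD(4)[OF J(1) Cc[OF a]] N intro!: exI[of _ N])
    fix b assume b: "b \<in> carrier ?C"
    obtain N where N: "\<And>n. n \<ge> N \<Longrightarrow> J n (a n) = j a" "\<And>n. n \<ge> N \<Longrightarrow> J n (b n) = j b"
      using ev2[OF ev_self[OF a] ev_self[OF b]] by blast
    show "j (calg_add ?C a b) = j a + j b"
      by (rule ev_j) (auto simp: ev_def unital_mat_homD(1)[OF J(1) Cc[OF a] Cc[OF b]] N intro!: exI[of _ N])
    show "j (calg_mult ?C a b) = j a * j b"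
      by (rule ev_j) (auto simp: ev_def unital_mat_homD(2)[OF J(1) Cc[OF a] Cc[OF b]] N intro!: exI[of _ N])
  qed
  moreover have "(\<lambda>n. op_norm_mat (a n)) \<longlonglongrightarrow> norm (j a)" if a: "a \<in> carrier ?C" for a
  proof (rule tendsto_eventually)
    obtain N where "\<And>n. n \<ge> N \<Longrightarrow> J n (a n) = j a" using ev_self[OF a] unfolding ev_def by blast
    then show "\<forall>\<^sub>F n in sequentially. op_norm_mat (a n) = norm (j a)"
      using unital_mat_hom_isometric[OF J(1) Cc[OF a]] unfolding eventually_sequentially by metis
  qed
  moreover have "\<exists>a\<in>carrier ?C. norm (j a - x) < e" if x: "x \<in> ?M" "e > 0" for x e
  proof -
    obtain i X where X: "X \<in> carrier_mat (k i) (k i)" "dist (J i X) x < e"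
      using x unfolding closure_approachable by blast
    define a where "a = tail_seq ?F f i X"
    have a: "a \<in> carrier ?C"
      unfolding a_def using X(1) by (intro tail_seq_coherent fh null_laws_matrix_cstar) simp
    have "J n (a n) = J i X" if "n \<ge> i" for n
      using that
    proof (induction n rule: dec_induct)
      case base
      then show ?case by (simp add: a_def tail_seq_start)
    next
      case (step n)
      then have "a (Suc n) = f n (a n)" unfolding a_def by (intro tail_seq_step)
      then show ?case using step J(2)[OF Cc[OF a]] by simp
    qed
    then have "j a = J i X" by (intro ev_j) (auto simp: ev_def)
    then show ?thesis using X(2) by (intro bexI[OF _ a]) (simp add: dist_norm)
  qed
  ultimately have "is_inductive_limit ?F f (cstar_of ?M)"
    unfolding is_inductive_limit_def matrix_cstar_simps(7) cstar_of_simps calg_dist_cstar_of by blast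
  then have "UHF_algebra (cstar_of ?M)"
    unfolding UHF_algebra_def using k f cstar_structure_cstar_of[OF sub] by blast
  moreover have "1 \<in> ?M"
    using fd_subalgebra.one_closed[OF fd_subalgebra_hom_range[OF J(1)[of 0]]] closure_subset[of ?U] by blast
  ultimately show ?thesis using sub by (simp add: unital_UHF_subalgebra_def)
qed

lemma hom_into_divisor:
  assumes g: "hom_into B k g" and d: "d dvd k" "0 < k"
  shows "hom_into B d (g \<circ> amplify d (k div d))"
proof -
  have "0 < k div d" "d * (k div d) = k" using d by (auto simp: div_greater_zero_iff dvd_imp_le dvd_pos_nat)
  then show ?thesis using hom_into_comp[OF g] amplify_unital_star_hom[of "k div d" d] by simp
qed

text \<open>
  The sizes of the full matrix algebras that embed unitally are closed under least common multiples.
  A chain \<open>k\<close> of such sizes with respect to divisibility that is cofinal among all of them gives a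
  UHF-subalgebra. For another UHF-subalgebra, the sizes in its system are again of this kind, and a
  coherent system of homomorphisms into the members of the chain provides the embedding.
\<close>

theorem maximal_UHF_subalgebra_exists:
  fixes Bs :: "nat \<Rightarrow> 'a::cstar_algebra set"
  assumes fd: "\<And>n. fd_subalgebra (Bs n)" and inc: "\<And>n. Bs n \<subseteq> Bs (Suc n)"
    and dense: "closure (\<Union>n. Bs n) = UNIV"
  shows "\<exists>M :: 'a set. maximal_UHF_subalgebra M"
proof -
  have mono: "Bs m \<subseteq> Bs n" if "m \<le> n" for m n using lift_Suc_mono_le[of Bs m n] inc that by auto
  define S where "S = {m. \<exists>n g. hom_into (Bs n) m g}"
  have S_units: "\<exists>e. matrix_units 1 m e \<and> (\<forall>i<m. \<forall>j<m. e i j \<in> Bs n)" if "hom_into (Bs n) m g" for m n g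
    using hom_into_matrix_units[OF that] by blast
  have S_pos: "0 < m" if "m \<in> S" for m
    using that S_units by (cases m) (fastforce simp: S_def matrix_units_def)+
  have S_I: "m \<in> S" if "matrix_units 1 m e" "\<And>i j. i < m \<Longrightarrow> j < m \<Longrightarrow> e i j \<in> Bs n" for m n e
    using fd_subalgebra.hom_into_of_matrix_units[OF fd that] unfolding S_def by blast
  have S_1: "1 \<in> S"
    using S_I[of 1 "\<lambda>i j. 1" 0] fd_subalgebra.one_closed[OF fd] by (simp add: matrix_units_def)
  have S_lcm: "lcm m n \<in> S" if mn: "m \<in> S" "n \<in> S" for m n
  proof -
    obtain p q g h where "hom_into (Bs p) m g" "hom_into (Bs q) n h" using mn by (auto simp: S_def)
    then obtain e f where e: "matrix_units 1 m e" "\<forall>i<m. \<forall>j<m. e i j \<in> Bs p"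
      and f: "matrix_units 1 n f" "\<forall>i<n. \<forall>j<n. f i j \<in> Bs q"
      using S_units by meson
    interpret fd_subalgebra "Bs (max p q)" by (rule fd)
    have "\<exists>g. matrix_units 1 (lcm m n) g \<and> (\<forall>i<lcm m n. \<forall>j<lcm m n. g i j \<in> Bs (max p q))"
      by (rule matrix_units_lcm[OF e(1) _ f(1)]) (use e f mono[of p "max p q"] mono[of q "max p q"] in auto)
    then show ?thesis using S_I by blast
  qed
  \<comment> \<open>Every \<open>m\<close> in \<open>S\<close> divides \<open>k m\<close>.\<close>
  define k where "k = rec_nat 1 (\<lambda>i l. if Suc i \<in> S then lcm l (Suc i) else l)"
  have k0: "k 0 = 1" and kS: "k (Suc i) = (if Suc i \<in> S then lcm (k i) (Suc i) else k i)" for i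
    by (simp_all add: k_def)
  have kinS: "k i \<in> S" for i by (induction i) (use S_1 S_lcm in \<open>auto simp: k0 kS\<close>)
  have kpos: "0 < k i" for i using kinS S_pos by blast
  have kdvd: "k i dvd k (Suc i)" for i by (simp add: kS)
  have S_dvd: "m dvd k m" if "m \<in> S" for m using that S_pos[OF that] by (cases m) (auto simp: kS)
  define f where "f i = amplify (k i) (k (Suc i) div k i)" for i
  have f: "unital_star_hom (matrix_cstar (k i)) (matrix_cstar (k (Suc i))) (f i)" for i
  proof -
    have "0 < k (Suc i) div k i" using kpos[of "Suc i"] kpos[of i] kdvd[of i]
      by (simp add: div_greater_zero_iff dvd_imp_le)
    moreover have "k i * (k (Suc i) div k i) = k (Suc i)" using kdvd[of i] by simp
    ultimately show ?thesis
      using amplify_unital_star_hom[of "k (Suc i) div k i" "k i"] by (simp add: f_def)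
  qed
  have "\<exists>n g. hom_into (Bs n) (k i) g" for i using kinS[of i] by (simp add: S_def)
  then obtain J where J: "\<And>i. \<exists>n. hom_into (Bs n) (k i) (J i)"
    "\<And>i X. X \<in> carrier_mat (k i) (k i) \<Longrightarrow> J (Suc i) (f i X) = J i X"
    using coherent_homs[where Bs = Bs and k = k and f = f] fd inc f by metis
  have Jh: "unital_mat_hom (k i) (J i)" for i using J(1)[of i] by (auto simp: hom_into_def)
  define U where "U i = J i ` carrier_mat (k i) (k i)" for i
  define M where "M = closure (\<Union>i. U i)"
  have M: "unital_UHF_subalgebra M"
    unfolding M_def U_def by (rule unital_UHF_subalgebra_closure) (use kpos kdvd f Jh J(2) in auto)
  have Ufd: "fd_subalgebra (U i)" for i unfolding U_def by (rule fd_subalgebra_hom_range[OF Jh])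
  have Uinc: "U i \<subseteq> U (Suc i)" for i
  proof
    fix x assume "x \<in> U i"
    then obtain X where X: "X \<in> carrier_mat (k i) (k i)" "x = J i X" by (auto simp: U_def)
    have "f i X \<in> carrier_mat (k (Suc i)) (k (Suc i))"
      using f[of i] X by (simp add: unital_star_hom_def star_hom_def)
    then show "x \<in> U (Suc i)" using J(2)[OF X(1)] X(2) unfolding U_def by (metis image_eqI)
  qed
  have UM: "U i \<subseteq> M" for i using closure_subset[of "\<Union>i. U i"] by (auto simp: M_def)
  have "\<exists>\<phi>. unital_embedding (cstar_of D) (cstar_of M) \<phi>" if D: "unital_UHF_subalgebra D" for D :: "'a set"
  proof -
    obtain l g I where sys: "uhf_system D l g I" using uhf_system_exists[OF D] by blast
    have lS: "l i \<in> S" for i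
    proof -
      have "hom_into D (l i) (I i)" using sys by (simp add: uhf_system_def)
      then have mu: "matrix_units 1 (l i) (\<lambda>a b. I i (mat_unit (l i) a b))" by (rule hom_into_matrix_units(1))
      then obtain n e where "matrix_units 1 (l i) e" "\<forall>a<l i. \<forall>b<l i. e a b \<in> Bs n"
        using matrix_units_perturb[OF fd inc dense mu, of 1] by auto
      then show ?thesis using S_I by blast
    qed
    have "\<exists>n h. hom_into (U n) (l i) h" for i
    proof -
      have "hom_into (U (l i)) (k (l i)) (J (l i))" using Jh by (auto simp: hom_into_def U_def)
      then show ?thesis using hom_into_divisor[OF _ S_dvd[OF lS] kpos] by blast
    qed
    then obtain G where G: "\<And>i. \<exists>n. hom_into (U n) (l i) (G i)"
      "\<And>i X. X \<in> carrier_mat (l i) (l i) \<Longrightarrow> G (Suc i) (g i X) = G i X"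
      using coherent_homs[where Bs = U and k = l and f = g] Ufd Uinc sys unfolding uhf_system_def by metis
    have GM: "hom_into M (l i) (G i)" for i using G(1)[of i] UM unfolding hom_into_def by blast
    show ?thesis
      using uhf_system_extend[OF sys _ _ _ GM G(2)] D M unfolding unital_UHF_subalgebra_def by blast
  qed
  then show ?thesis using M unfolding maximal_UHF_subalgebra_def by blast
qed

section \<open>Approximate unitary equivalence\<close>

lemma norm_unitary_conj_le:
  assumes "unitary_element u"
  shows "norm (star u * x * u) \<le> norm (x :: 'a::cstar_algebra)"
proof -
  have u: "norm u = 1" using assms by (simp add: unitary_element_def norm_unitary)
  have "norm (star u * x * u) \<le> norm (star u) * norm x * norm u"
    by (meson norm_mult_ineq mult_right_mono norm_ge_zero order_trans)
  then show ?thesis using u by simp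
qed

text \<open>
  Both homomorphisms are perturbed into one finite-dimensional subalgebra, where the perturbations
  are unitarily equivalent.
\<close>

lemma homs_near_conjugate:
  fixes Bs :: "nat \<Rightarrow> 'a::cstar_algebra set" and f g :: "complex mat \<Rightarrow> 'a"
  assumes fd: "\<And>n. fd_subalgebra (Bs n)" and inc: "\<And>n. Bs n \<subseteq> Bs (Suc n)"
    and dense: "closure (\<Union>n. Bs n) = UNIV"
    and f: "unital_mat_hom k f" and g: "unital_mat_hom k g" and r: "0 < r"
  shows "\<exists>u. unitary_element u \<and> (\<forall>X\<in>carrier_mat k k. norm (star u * f X * u - g X) \<le> r * op_norm_mat X)"
proof -
  have muf: "matrix_units 1 k (\<lambda>i j. f (mat_unit k i j))" and mug: "matrix_units 1 k (\<lambda>i j. g (mat_unit k i j))"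
    using unital_mat_hom_matrix_units f g by auto
  have k: "0 < k" using muf by (cases k) (auto simp: matrix_units_def)
  define s where "s = r / (2 * real k * real k)"
  have s: "0 < s" using r k by (simp add: s_def)
  have mono: "Bs m \<subseteq> Bs n" if "m \<le> n" for m n using lift_Suc_mono_le[of Bs m n] inc that by auto
  obtain m e where e: "matrix_units 1 k e"
    "\<forall>i<k. \<forall>j<k. e i j \<in> Bs m \<and> norm (e i j - f (mat_unit k i j)) < s"
    using matrix_units_perturb[OF fd inc dense muf s] by blast
  obtain n d where d: "matrix_units 1 k d"
    "\<forall>i<k. \<forall>j<k. d i j \<in> Bs n \<and> norm (d i j - g (mat_unit k i j)) < s"
    using matrix_units_perturb[OF fd inc dense mug s] by blast
  interpret fd_subalgebra "Bs (max m n)" by (rule fd)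
  have "\<exists>u\<in>Bs (max m n). unitary_element u \<and> (\<forall>i<k. \<forall>j<k. e i j = u * d i j * star u)"
    by (rule matrix_units_conjugate[OF d(1) _ e(1)])
      (use d e mono[of m "max m n"] mono[of n "max m n"] in auto)
  then obtain u where u: "unitary_element u" "\<forall>i<k. \<forall>j<k. e i j = u * d i j * star u" by blast
  have uu: "star u * u = 1" using u by (simp add: unitary_element_def)
  have near: "norm (star u * f (mat_unit k i j) * u - g (mat_unit k i j)) \<le> 2 * s" if ij: "i < k" "j < k" for i j
  proof -
    have "star u * e i j * u = (star u * u) * d i j * (star u * u)" using u(2) ij by (simp add: mult.assoc)
    then have ed: "star u * e i j * u = d i j" by (simp add: uu)
    have "star u * f (mat_unit k i j) * u - g (mat_unit k i j) =
        star u * (f (mat_unit k i j) - e i j) * u + (d i j - g (mat_unit k i j))"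
      unfolding ed[symmetric] by (simp add: algebra_simps)
    then have "norm (star u * f (mat_unit k i j) * u - g (mat_unit k i j)) \<le>
        norm (star u * (f (mat_unit k i j) - e i j) * u) + norm (d i j - g (mat_unit k i j))"
      by (metis norm_triangle_ineq)
    also have "\<dots> \<le> norm (f (mat_unit k i j) - e i j) + norm (d i j - g (mat_unit k i j))"
      using norm_unitary_conj_le[OF u(1)] by simp
    also have "\<dots> \<le> s + s"
      using e(2) d(2) ij by (intro add_mono) (auto simp: norm_minus_commute less_imp_le)
    finally show ?thesis by simp
  qed
  have "norm (star u * f X * u - g X) \<le> r * op_norm_mat X" if X: "X \<in> carrier_mat k k" for X
  proof -
    have "star u * f X * u - g X =
        (\<Sum>i<k. \<Sum>j<k. scaleC (X $$ (i, j)) (star u * f (mat_unit k i j) * u - g (mat_unit k i j)))"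
      unfolding unital_mat_hom_expand[OF f X] unital_mat_hom_expand[OF g X]
      by (simp add: sum_distrib_left sum_distrib_right scaleC_mult_left scaleC_mult_right sum_subtractf
          complex_vector.scale_right_diff_distrib)
    also have "norm \<dots> \<le> (\<Sum>i<k. \<Sum>j<k. norm (scaleC (X $$ (i, j)) (star u * f (mat_unit k i j) * u - g (mat_unit k i j))))"
      by (rule order_trans[OF norm_sum]) (intro sum_mono norm_sum)
    also have "\<dots> \<le> (\<Sum>i<k. \<Sum>j<k. op_norm_mat X * (2 * s))"
      unfolding norm_scaleC
      using op_norm_entry_le[OF X] near op_norm_nonneg[OF X] by (intro sum_mono mult_mono) auto
    also have "\<dots> = r * op_norm_mat X" using k by (simp add: s_def)
    finally show ?thesis .
  qed
  then show ?thesis using u(1) by blast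
qed

theorem maximal_UHF_approx_unitarily_equiv:
  fixes Bs :: "nat \<Rightarrow> 'a::cstar_algebra set"
  assumes fd: "\<And>n. fd_subalgebra (Bs n)" and inc: "\<And>n. Bs n \<subseteq> Bs (Suc n)"
    and dense: "closure (\<Union>n. Bs n) = UNIV"
    and M: "maximal_UHF_subalgebra M" and D: "unital_UHF_subalgebra D"
  shows "\<exists>\<phi>. unital_embedding (cstar_of D) (cstar_of M) \<phi> \<and>
    approx_unitarily_equiv (cstar_of D) (id \<circ> \<phi>) (id :: 'a \<Rightarrow> 'a)"
proof -
  have Msub: "cstar_subalgebra M" "1 \<in> M" and Dsub: "cstar_subalgebra D" "1 \<in> D"
    using M D by (auto simp: maximal_UHF_subalgebra_def unital_UHF_subalgebra_def)
  obtain \<theta> where \<theta>: "unital_embedding (cstar_of D) (cstar_of M) \<theta>"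
    using M D unfolding maximal_UHF_subalgebra_def by blast
  have \<theta>h: "star_hom (cstar_of D) (cstar_of M) \<theta>" using \<theta> by (simp add: unital_embedding_def unital_star_hom_def)
  have \<theta>1: "\<theta> 1 = 1"
  proof -
    obtain e where e: "is_unit_of (cstar_of D) e" "is_unit_of (cstar_of M) (\<theta> e)"
      using \<theta> by (auto simp: unital_embedding_def unital_star_hom_def)
    have "e * 1 = 1" "\<theta> e * 1 = 1" using e Dsub(2) Msub(2) unfolding is_unit_of_def cstar_of_simps by blast+
    then show ?thesis by simp
  qed
  obtain k f J where sys: "uhf_system D k f J" using uhf_system_exists[OF D] by blast
  have J: "hom_into D (k i) (J i)" and Jf: "X \<in> carrier_mat (k i) (k i) \<Longrightarrow> J (Suc i) (f i X) = J i X" for i X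
    using sys by (auto simp: uhf_system_def)
  have JD: "J i X \<in> D" if "X \<in> carrier_mat (k i) (k i)" for i X using J that by (auto simp: hom_into_def)
  have Jh: "unital_mat_hom (k i) (J i)" for i using J by (auto simp: hom_into_def)
  have "hom_into M (k i) (\<theta> \<circ> J i)" for i
    using \<theta>h \<theta>1 J[of i] by (auto simp: hom_into_def unital_mat_hom_iff star_hom_def)
  \<comment> \<open>
    Continuity of \<open>\<theta>\<close> is not known, so it is replaced by the isometric extension \<open>\<phi>\<close> of its
    restriction to the matrix algebras.\<close>
  then obtain \<phi> where \<phi>: "unital_embedding (cstar_of D) (cstar_of M) \<phi>"
    "\<And>x. x \<in> D \<Longrightarrow> norm (\<phi> x) = norm x" "\<And>x y. x \<in> D \<Longrightarrow> y \<in> D \<Longrightarrow> \<phi> (x - y) = \<phi> x - \<phi> y"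
    "\<And>i X. X \<in> carrier_mat (k i) (k i) \<Longrightarrow> \<phi> (J i X) = \<theta> (J i X)"
    using uhf_system_extend[OF sys Dsub Msub(1), of "\<lambda>i. \<theta> \<circ> J i"] Jf by auto
  have \<phi>Jh: "unital_mat_hom (k i) (\<lambda>X. \<theta> (J i X))" for i
    using \<open>hom_into M (k i) (\<theta> \<circ> J i)\<close> by (simp add: hom_into_def o_def)
  have "\<exists>u. unitary_element u \<and> (\<forall>X\<in>carrier_mat (k n) (k n).
      norm (star u * \<theta> (J n X) * u - J n X) \<le> 1 / real (Suc n) * op_norm_mat X)" for n
    by (rule homs_near_conjugate[OF fd inc dense \<phi>Jh Jh]) simp
  then obtain u where u: "\<And>n. unitary_element (u n)"
    "\<And>n X. X \<in> carrier_mat (k n) (k n) \<Longrightarrow>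
      norm (star (u n) * \<theta> (J n X) * u n - J n X) \<le> 1 / real (Suc n) * op_norm_mat X" by metis
  have "(\<lambda>n. norm (star (u n) * \<phi> a * u n - a)) \<longlonglongrightarrow> 0" if a: "a \<in> D" for a
  proof (rule LIMSEQ_I)
    fix r :: real assume r: "r > 0"
    then obtain m X where X: "X \<in> carrier_mat (k m) (k m)" "norm (J m X - a) < r / 3"
      using sys a unfolding uhf_system_def by (metis divide_pos_pos zero_less_numeral)
    define b where "b = J m X"
    have bD: "b \<in> D" using JD[OF X(1)] by (simp add: b_def)
    have "(\<lambda>n. norm b * (1 / real (Suc n))) \<longlonglongrightarrow> norm b * 0"
      by (intro tendsto_mult tendsto_const LIMSEQ_Suc[OF lim_1_over_n])
    then have "\<forall>\<^sub>F n in sequentially. norm b * (1 / real (Suc n)) < r / 3"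
      using r by (intro order_tendstoD(2)) auto
    then obtain N where N: "\<And>n. n \<ge> N \<Longrightarrow> norm b * (1 / real (Suc n)) < r / 3"
      unfolding eventually_sequentially by blast
    have "norm (norm (star (u n) * \<phi> a * u n - a) - 0) < r" if n: "n \<ge> max m N" for n
    proof -
      obtain Y where Y: "Y \<in> carrier_mat (k n) (k n)" "J n Y = b"
        using uhf_system_lift[OF sys, of m n X J] n X(1) Jf by (auto simp: b_def)
      have nb: "op_norm_mat Y = norm b" using unital_mat_hom_isometric[OF Jh Y(1)] Y(2) by simp
      have "norm (star (u n) * \<phi> b * u n - b) \<le> norm b * (1 / real (Suc n))"
        using u(2)[OF Y(1)] \<phi>(4)[OF Y(1)] Y(2) nb by (simp add: mult.commute)
      moreover have "norm (star (u n) * \<phi> (a - b) * u n) \<le> norm (a - b)"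
      proof -
        have "a - b \<in> D"
        proof -
          have "scaleC (- 1) b \<in> D" using Dsub(1) bD unfolding cstar_subalgebra_def by blast
          then have "a + scaleC (- 1) b \<in> D" using Dsub(1) a unfolding cstar_subalgebra_def by blast
          then show ?thesis by (simp add: scaleC_minus_one)
        qed
        then show ?thesis using norm_unitary_conj_le[OF u(1), of n "\<phi> (a - b)"] \<phi>(2) by simp
      qed
      moreover have "star (u n) * \<phi> a * u n - a =
          star (u n) * \<phi> (a - b) * u n + (star (u n) * \<phi> b * u n - b) + (b - a)"
        unfolding \<phi>(3)[OF a bD] by (simp add: algebra_simps)
      then have "norm (star (u n) * \<phi> a * u n - a) \<le>
          norm (star (u n) * \<phi> (a - b) * u n) + norm (star (u n) * \<phi> b * u n - b) + norm (b - a)"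
        by (simp only: norm_triangle_le add_mono norm_triangle_ineq order_refl)
      moreover have "norm (b - a) < r / 3" "norm (a - b) < r / 3"
        using X(2) by (simp_all add: b_def norm_minus_commute)
      moreover have "norm b * (1 / real (Suc n)) < r / 3" using N n by simp
      ultimately show ?thesis by (simp only: diff_0_right real_norm_def abs_norm_cancel)
    qed
    then show "\<exists>no. \<forall>n\<ge>no. norm (norm (star (u n) * \<phi> a * u n - a) - 0) < r" by blast
  qed
  then have "approx_unitarily_equiv (cstar_of D) (id \<circ> \<phi>) id"
    unfolding approx_unitarily_equiv_def using u(1) by auto
  then show ?thesis using \<phi>(1) by blast
qed

theorem theorem5p4:
  assumes "AF_algebra TYPE('b) (cstar_of (UNIV :: 'a::cstar_algebra set))"
  shows "(\<exists>MU :: 'a set. maximal_UHF_subalgebra MU) \<and>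
    (\<forall>MU :: 'a set. maximal_UHF_subalgebra MU \<longrightarrow>
      (\<forall>D :: 'a set. unital_UHF_subalgebra D \<longrightarrow>
        (\<exists>\<phi>. unital_embedding (cstar_of D) (cstar_of MU) \<phi> \<and>
             approx_unitarily_equiv (cstar_of D) (id \<circ> \<phi>) id)))"
proof -
  obtain Bs :: "nat \<Rightarrow> 'a set" where Bs: "\<And>n. fd_subalgebra (Bs n)" "\<And>n. Bs n \<subseteq> Bs (Suc n)"
    "closure (\<Union>n. Bs n) = UNIV"
    using AF_algebra_dense_fd_subalgebras[OF assms] by blast
  show ?thesis
    using maximal_UHF_subalgebra_exists[OF Bs] maximal_UHF_approx_unitarily_equiv[OF Bs] by blast
qed

end
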